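(* Let $n\geq1$, let $w_0$ be the longest element of $W_n$, and let $\langle f,g\rangle:=\partial_{w_0}(fg)$ for $f,g\in\Gamma[X_n]$. Let $u,v\in W_n$ be such that $\ell(u)+\ell(v)=n^2$. Then \[\langle\mathfrak{C}_u(X_n),\mathfrak{C}_v(X_n)\rangle=\begin{cases}1&\text{if }v=w_0u,\\0&\text{otherwise}.\end{cases}\]
   Context: $c_1,c_2,\ldots$ are commuting variables, $c_0:=1$, $c_p:=0$ for $p<0$; $\Gamma$ is the quotient of $\mathbb{Z}[c_1,c_2,\ldots]$ by the relations $c_p^2+2\sum_{i=1}^p(-1)^ic_{p+i}c_{p-i}=0$, $p\geq1$. $X=(x_1,x_2,\ldots)$, $Y=(y_1,y_2,\ldots)$ are independent variables, $X_n=(x_1,\ldots,x_n)$. $W_k$ is the group of signed permutations of $\{1,\ldots,k\}$, $W_\infty=\bigcup_kW_k$, generated by $s_i=(i,i+1)$, $i\geq1$, and the sign change $s_0$ of $1$; $\ell$ is the length; $w_0=(-1,\ldots,-n)$ has length $n^2$. $W_\infty$ acts on $\Gamma[X,Y]$ by ring automorphisms: $s_i$ ($i\geq1$) interchanges $x_i,x_{i+1}$ and fixes all other variables and all $c_p$; $s_0$ sends $x_1\mapsto-x_1$, fixes $x_j$ ($j\geq2$) and all $y_j$, and $s_0(c_p)=c_p+2\sum_{j=1}^px_1^jc_{p-j}$. $\partial_0=\partial_0^x$, $\partial_i=\partial_i^x$ are given by $\partial_0f=\frac{f-s_0f}{-2x_1}$, $\partial_if=\frac{f-s_if}{x_i-x_{i+1}}$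 ($i\geq1$); $\partial_w=\partial_{i_1}\cdots\partial_{i_\ell}$ for any reduced word $w=s_{i_1}\cdots s_{i_\ell}$. $\omega$ is the ring involution of $\Gamma[X,Y]$ with $\omega(x_j)=-y_j$, $\omega(y_j)=-x_j$, $\omega(c_p)=c_p$, and $\partial_i^y=\omega\partial_i^x\omega$. $\mathfrak{C}_w(X,Y)$, $w\in W_\infty$, is the unique family in $\Gamma[X,Y]$ such that for all $i\geq0$: $\partial_i^x\mathfrak{C}_w=\mathfrak{C}_{ws_i}$ if $\ell(ws_i)<\ell(w)$ and $0$ otherwise; $\partial_i^y\mathfrak{C}_w=\mathfrak{C}_{s_iw}$ if $\ell(s_iw)<\ell(w)$ and $0$ otherwise; and the constant term of $\mathfrak{C}_w$ is $\delta_{w,1}$. For $w\in W_n$, $\mathfrak{C}_w(X_n):=\mathfrak{C}_w(X,0)\in\Gamma[X_n]$. *)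

theory Defs
  imports
    Complex_Main
    "HOL-Library.Poly_Mapping"
    "HOL-Combinatorics.Transposition"
begin

section \<open>Polynomial rings\<close>

text \<open>
  The polynomial ring over \<open>'a\<close> in the variables indexed by \<open>'v\<close> is the type
  \<open>('v \<Rightarrow>\<^sub>0 nat) \<Rightarrow>\<^sub>0 'a\<close> of finitely supported functions from monomials to coefficients,
  with the convolution product of \<^theory>\<open>HOL-Library.Poly_Mapping\<close>.
\<close>

definition Var :: "'v \<Rightarrow> ('v \<Rightarrow>\<^sub>0 nat) \<Rightarrow>\<^sub>0 'a::comm_ring_1"
  where "Var v = Poly_Mapping.single (Poly_Mapping.single v 1) 1"

definition Const :: "'a \<Rightarrow> ('v \<Rightarrow>\<^sub>0 nat) \<Rightarrow>\<^sub>0 'a::comm_ring_1"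
  where "Const a = Poly_Mapping.single 0 a"

lemma lookup_mult_zero:
  fixes f g :: "('v \<Rightarrow>\<^sub>0 nat) \<Rightarrow>\<^sub>0 'a::comm_ring_1"
  shows "Poly_Mapping.lookup (f * g) 0 = Poly_Mapping.lookup f 0 * Poly_Mapping.lookup g 0"
proof -
  have eq: "(0 = l + q) \<longleftrightarrow> (l = 0 \<and> q = 0)" for l q :: "'v \<Rightarrow>\<^sub>0 nat"
  proof
    assume sum: "0 = l + q"
    have "Poly_Mapping.lookup l v = 0 \<and> Poly_Mapping.lookup q v = 0" for v
      using arg_cong[OF sum, of "\<lambda>m. Poly_Mapping.lookup m v"] by (simp add: lookup_add)
    then show "l = 0 \<and> q = 0"
      by (auto intro: poly_mapping_eqI)
  qed simp
  have "Poly_Mapping.lookup (f * g) 0 =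
      (\<Sum>l. Poly_Mapping.lookup f l * (\<Sum>q. Poly_Mapping.lookup g q when 0 = l + q))"
    by (simp add: lookup_mult)
  also have "\<dots> = (\<Sum>l. (Poly_Mapping.lookup f l * Poly_Mapping.lookup g 0) when l = 0)"
  proof (intro arg_cong[where f = Sum_any] ext)
    fix l :: "'v \<Rightarrow>\<^sub>0 nat"
    show "Poly_Mapping.lookup f l * (\<Sum>q. Poly_Mapping.lookup g q when 0 = l + q) =
        (Poly_Mapping.lookup f l * Poly_Mapping.lookup g 0 when l = 0)"
      by (cases "l = 0") (simp_all add: eq)
  qed
  finally show ?thesis by simp
qed


section \<open>The ring \<open>\<Gamma>\<close>\<close>

text \<open>
  The variable of index \<open>k\<close> in \<open>(nat \<Rightarrow>\<^sub>0 nat) \<Rightarrow>\<^sub>0 int\<close> stands for the generator with subscript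
  \<open>k + 1\<close>, so that the variables are exactly the generators with positive subscripts.
\<close>

definition pre_c :: "nat \<Rightarrow> (nat \<Rightarrow>\<^sub>0 nat) \<Rightarrow>\<^sub>0 int"
  where "pre_c p = (if p = 0 then 1 else Var (p - 1))"

definition gamma_relator :: "nat \<Rightarrow> (nat \<Rightarrow>\<^sub>0 nat) \<Rightarrow>\<^sub>0 int"
  where "gamma_relator p =
    (pre_c p)\<^sup>2 + 2 * (\<Sum>i = 1..p. (- 1) ^ i * pre_c (p + i) * pre_c (p - i))"

text \<open>The ideal generated by a set is its span in the ring regarded as a module over itself.\<close>

interpretation ring_module: module "(*) :: 'a \<Rightarrow> 'a \<Rightarrow> 'a::comm_ring_1"
  by standard (simp_all add: algebra_simps)

definition gamma_ideal :: "((nat \<Rightarrow>\<^sub>0 nat) \<Rightarrow>\<^sub>0 int) set"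
  where "gamma_ideal = module.span (*) {gamma_relator p | p. p \<ge> 1}"

definition gamma_rel :: "((nat \<Rightarrow>\<^sub>0 nat) \<Rightarrow>\<^sub>0 int) \<Rightarrow> ((nat \<Rightarrow>\<^sub>0 nat) \<Rightarrow>\<^sub>0 int) \<Rightarrow> bool"
  where "gamma_rel a b \<longleftrightarrow> a - b \<in> gamma_ideal"

lemma gamma_ideal_zero: "0 \<in> gamma_ideal"
  and gamma_ideal_add: "a \<in> gamma_ideal \<Longrightarrow> b \<in> gamma_ideal \<Longrightarrow> a + b \<in> gamma_ideal"
  and gamma_ideal_diff: "a \<in> gamma_ideal \<Longrightarrow> b \<in> gamma_ideal \<Longrightarrow> a - b \<in> gamma_ideal"
  and gamma_ideal_minus: "a \<in> gamma_ideal \<Longrightarrow> - a \<in> gamma_ideal"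
  and gamma_ideal_mult: "a \<in> gamma_ideal \<Longrightarrow> r * a \<in> gamma_ideal"
  unfolding gamma_ideal_def
  by (auto intro: ring_module.span_zero ring_module.span_add ring_module.span_diff
      ring_module.span_neg ring_module.span_scale)

lemma gamma_rel_refl: "gamma_rel a a"
  by (simp add: gamma_rel_def gamma_ideal_zero)

lemma lookup_pre_c_zero: "Poly_Mapping.lookup (pre_c p) 0 = (if p = 0 then 1 else 0)"
proof -
  have "Poly_Mapping.single (p - 1) 1 \<noteq> (0 :: nat \<Rightarrow>\<^sub>0 nat)"
    by (metis lookup_single_eq lookup_zero zero_neq_one)
  then show ?thesis
    by (simp add: pre_c_def Var_def lookup_single lookup_one when_def)
qed

lemma lookup_gamma_relator_zero:
  assumes "p \<ge> 1"
  shows "Poly_Mapping.lookup (gamma_relator p) 0 = 0"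
proof -
  have sum: "Poly_Mapping.lookup (\<Sum>i = 1..p. (- 1) ^ i * pre_c (p + i) * pre_c (p - i)) 0 = 0"
    unfolding lookup_sum
    by (rule sum.neutral) (use assms in \<open>simp add: lookup_mult_zero lookup_pre_c_zero\<close>)
  show ?thesis
    unfolding gamma_relator_def lookup_add lookup_mult_zero power2_eq_square sum
    using assms by (simp add: lookup_pre_c_zero)
qed

lemma lookup_gamma_ideal_zero:
  assumes "a \<in> gamma_ideal"
  shows "Poly_Mapping.lookup a 0 = 0"
proof -
  have "a \<in> module.span (*) {gamma_relator p | p. p \<ge> 1}"
    using assms by (simp only: gamma_ideal_def)
  then show ?thesis
  proof (induction rule: ring_module.span_induct_alt)
    case base
    show ?case by simp
  next
    case (step r a b)
    from step(1) obtain p where "a = gamma_relator p" and "p \<ge> 1"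
      by blast
    then show ?case
      using step(2)
      by (simp only: lookup_add lookup_mult_zero lookup_gamma_relator_zero mult_zero_right
          add_0_left)
  qed
qed

lemma one_notin_gamma_ideal: "1 \<notin> gamma_ideal"
  using lookup_gamma_ideal_zero[of 1] by (auto simp: lookup_one)

quotient_type gamma = "(nat \<Rightarrow>\<^sub>0 nat) \<Rightarrow>\<^sub>0 int" / gamma_rel
proof (rule equivpI)
  show "reflp gamma_rel"
    by (auto simp: reflp_def gamma_rel_refl)
  show "symp gamma_rel"
    unfolding symp_def gamma_rel_def using gamma_ideal_minus by fastforce
  show "transp gamma_rel"
    unfolding transp_def gamma_rel_def using gamma_ideal_add by fastforce
qed

instantiation gamma :: comm_ring_1
begin

lift_definition zero_gamma :: gamma is 0 .

lift_definition one_gamma :: gamma is 1 .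

lift_definition plus_gamma :: "gamma \<Rightarrow> gamma \<Rightarrow> gamma" is "(+)"
proof -
  fix a a' b b' :: "(nat \<Rightarrow>\<^sub>0 nat) \<Rightarrow>\<^sub>0 int"
  assume "gamma_rel a a'" and "gamma_rel b b'"
  then have "(a - a') + (b - b') \<in> gamma_ideal"
    by (simp add: gamma_rel_def gamma_ideal_add)
  then show "gamma_rel (a + b) (a' + b')"
    by (simp add: gamma_rel_def algebra_simps)
qed

lift_definition uminus_gamma :: "gamma \<Rightarrow> gamma" is uminus
proof -
  fix a a' :: "(nat \<Rightarrow>\<^sub>0 nat) \<Rightarrow>\<^sub>0 int"
  assume "gamma_rel a a'"
  then have "- (a - a') \<in> gamma_ideal"
    unfolding gamma_rel_def by (rule gamma_ideal_minus)
  then show "gamma_rel (- a) (- a')"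
    by (simp add: gamma_rel_def)
qed

lift_definition minus_gamma :: "gamma \<Rightarrow> gamma \<Rightarrow> gamma" is "(-)"
proof -
  fix a a' b b' :: "(nat \<Rightarrow>\<^sub>0 nat) \<Rightarrow>\<^sub>0 int"
  assume "gamma_rel a a'" and "gamma_rel b b'"
  then have "(a - a') - (b - b') \<in> gamma_ideal"
    by (simp add: gamma_rel_def gamma_ideal_diff)
  then show "gamma_rel (a - b) (a' - b')"
    by (simp add: gamma_rel_def algebra_simps)
qed

lift_definition times_gamma :: "gamma \<Rightarrow> gamma \<Rightarrow> gamma" is "(*)"
proof -
  fix a a' b b' :: "(nat \<Rightarrow>\<^sub>0 nat) \<Rightarrow>\<^sub>0 int"
  assume "gamma_rel a a'" and "gamma_rel b b'"
  then have "b * (a - a') + a' * (b - b') \<in> gamma_ideal"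
    by (simp add: gamma_rel_def gamma_ideal_add gamma_ideal_mult)
  then show "gamma_rel (a * b) (a' * b')"
    by (simp add: gamma_rel_def algebra_simps)
qed

instance
proof
  fix a b d :: gamma
  show "a + b + d = a + (b + d)"
    by transfer (simp only: gamma_rel_refl add.assoc)
  show "a + b = b + a"
    by transfer (simp only: gamma_rel_refl add.commute)
  show "0 + a = a"
    by transfer (simp only: add_0_left gamma_rel_refl)
  show "- a + a = 0"
    by transfer (simp only: left_minus gamma_rel_refl)
  show "a - b = a + - b"
    by transfer (simp only: diff_conv_add_uminus gamma_rel_refl)
  show "a * b * d = a * (b * d)"
    by transfer (simp only: gamma_rel_refl mult.assoc)
  show "a * b = b * a"
    by transfer (simp only: gamma_rel_refl mult.commute)
  show "1 * a = a"
    by transfer (simp only: mult_1_left gamma_rel_refl)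
  show "(a + b) * d = a * d + b * d"
    by transfer (simp only: gamma_rel_refl distrib_right)
  show "(0 :: gamma) \<noteq> 1"
  proof transfer
    show "\<not> gamma_rel 0 1"
      using gamma_ideal_minus[of "- 1"] one_notin_gamma_ideal by (auto simp: gamma_rel_def)
  qed
qed

end


section \<open>The ring \<open>\<Gamma>[X, Y]\<close>\<close>

text \<open>As above, \<open>XVar k\<close> and \<open>YVar k\<close> index the variables with subscript \<open>k + 1\<close>.\<close>

datatype xy_index = XVar nat | YVar nat

type_synonym gamma_xy = "(xy_index \<Rightarrow>\<^sub>0 nat) \<Rightarrow>\<^sub>0 gamma"

definition cgen :: "nat \<Rightarrow> gamma_xy"
  where "cgen p = Const (abs_gamma (pre_c p))"

definition xvar :: "nat \<Rightarrow> gamma_xy"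
  where "xvar j = Var (XVar (j - 1))"

definition yvar :: "nat \<Rightarrow> gamma_xy"
  where "yvar j = Var (YVar (j - 1))"

definition ring_hom :: "('a::comm_ring_1 \<Rightarrow> 'b::comm_ring_1) \<Rightarrow> bool"
  where "ring_hom \<phi> \<longleftrightarrow>
    \<phi> 1 = 1 \<and> (\<forall>f g. \<phi> (f + g) = \<phi> f + \<phi> g) \<and> (\<forall>f g. \<phi> (f * g) = \<phi> f * \<phi> g)"

text \<open>
  The elements \<open>cgen p\<close>, \<open>xvar j\<close>, \<open>yvar j\<close> (\<open>p, j \<ge> 1\<close>) generate \<open>gamma_xy\<close> as a ring, so a ring
  homomorphism is determined by their images; it exists whenever the prescribed images of the
  \<open>cgen p\<close> satisfy the defining relations of \<open>\<Gamma>\<close>.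
\<close>

definition gamma_xy_hom ::
    "(nat \<Rightarrow> 'b) \<Rightarrow> (nat \<Rightarrow> 'b) \<Rightarrow> (nat \<Rightarrow> 'b) \<Rightarrow> gamma_xy \<Rightarrow> 'b::comm_ring_1"
  where "gamma_xy_hom c' x' y' = (THE \<phi>. ring_hom \<phi> \<and>
    (\<forall>p\<ge>1. \<phi> (cgen p) = c' p) \<and> (\<forall>j\<ge>1. \<phi> (xvar j) = x' j) \<and> (\<forall>j\<ge>1. \<phi> (yvar j) = y' j))"

definition constant_term :: "gamma_xy \<Rightarrow> int"
  where "constant_term = gamma_xy_hom (\<lambda>p. 0) (\<lambda>j. 0) (\<lambda>j. 0)"

definition set_Y_zero :: "gamma_xy \<Rightarrow> gamma_xy"
  where "set_Y_zero = gamma_xy_hom cgen xvar (\<lambda>j. 0)"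

definition omega :: "gamma_xy \<Rightarrow> gamma_xy"
  where "omega = gamma_xy_hom cgen (\<lambda>j. - yvar j) (\<lambda>j. - xvar j)"


section \<open>Signed permutations\<close>

text \<open>
  A signed permutation of \<open>{1..k}\<close> is the corresponding odd permutation of the integers that fixes
  all \<open>i\<close> with \<open>\<bar>i\<bar> > k\<close>. The group operation is composition of functions.
\<close>

type_synonym sperm = "int \<Rightarrow> int"

definition signed_perms :: "nat \<Rightarrow> sperm set"
  where "signed_perms k = {w. bij w \<and> (\<forall>i. w (- i) = - w i) \<and> (\<forall>i. \<bar>i\<bar> > int k \<longrightarrow> w i = i)}"

definition signed_perms_inf :: "sperm set"
  where "signed_perms_inf = (\<Union>k. signed_perms k)"

definition sgen :: "nat \<Rightarrow> sperm"
  where "sgen i = (if i = 0 then transpose 1 (- 1)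
    else transpose (int i) (int i + 1) \<circ> transpose (- int i) (- (int i + 1)))"

definition word_prod :: "nat list \<Rightarrow> sperm"
  where "word_prod a = foldr (\<lambda>i w. sgen i \<circ> w) a id"

definition len :: "sperm \<Rightarrow> nat"
  where "len w = (LEAST k. \<exists>a. length a = k \<and> word_prod a = w)"

definition reduced_word :: "sperm \<Rightarrow> nat list \<Rightarrow> bool"
  where "reduced_word w a \<longleftrightarrow> word_prod a = w \<and> length a = len w"

definition w0 :: "nat \<Rightarrow> sperm"
  where "w0 n = (\<lambda>i. if \<bar>i\<bar> \<le> int n then - i else i)"


section \<open>Divided differences\<close>

definition s_act :: "nat \<Rightarrow> gamma_xy \<Rightarrow> gamma_xy"
  where "s_act i = (if i = 0
    then gamma_xy_hom (\<lambda>p. cgen p + 2 * (\<Sum>j = 1..p. xvar 1 ^ j * cgen (p - j)))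
           (\<lambda>j. if j = 1 then - xvar 1 else xvar j) yvar
    else gamma_xy_hom cgen (\<lambda>j. xvar (transpose i (i + 1) j)) yvar)"

text \<open>The quotients exist, and they are unique: \<open>xvar i - xvar (i + 1)\<close> is a nonzerodivisor, and
  so is \<open>2 * xvar 1\<close>, because \<open>\<Gamma>\<close> is torsion-free.\<close>

definition dd_x :: "nat \<Rightarrow> gamma_xy \<Rightarrow> gamma_xy"
  where "dd_x i f = (if i = 0
    then (THE g. (- 2 * xvar 1) * g = f - s_act 0 f)
    else (THE g. (xvar i - xvar (i + 1)) * g = f - s_act i f))"

definition dd_y :: "nat \<Rightarrow> gamma_xy \<Rightarrow> gamma_xy"
  where "dd_y i = omega \<circ> dd_x i \<circ> omega"

text \<open>The operator does not depend on the choice of the reduced word.\<close>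

definition dd :: "sperm \<Rightarrow> gamma_xy \<Rightarrow> gamma_xy"
  where "dd w = foldr (\<lambda>i D. dd_x i \<circ> D) (SOME a. reduced_word w a) id"


section \<open>Schubert polynomials and the pairing\<close>

text \<open>The conditions characterising the family of double Schubert polynomials of type C; they
  determine its values on \<^const>\<open>signed_perms_inf\<close>.\<close>

definition is_schubert_family :: "(sperm \<Rightarrow> gamma_xy) \<Rightarrow> bool"
  where "is_schubert_family \<CC> \<longleftrightarrow> (\<forall>w\<in>signed_perms_inf.
    (\<forall>i. dd_x i (\<CC> w) = (if len (w \<circ> sgen i) < len w then \<CC> (w \<circ> sgen i) else 0)) \<and>
    (\<forall>i. dd_y i (\<CC> w) = (if len (sgen i \<circ> w) < len w then \<CC> (sgen i \<circ> w) else 0)) \<and>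
    constant_term (\<CC> w) = (if w = id then 1 else 0))"

text \<open>
  For \<open>w\<close> in \<open>signed_perms n\<close>, the value \<open>set_Y_zero (\<CC> w)\<close> lies in the subring of
  \<open>gamma_xy\<close> generated by \<open>\<Gamma>\<close> and \<open>xvar 1, \<dots>, xvar n\<close>, and the pairing below restricts to this subring.
\<close>

definition pairing :: "nat \<Rightarrow> gamma_xy \<Rightarrow> gamma_xy \<Rightarrow> gamma_xy"
  where "pairing n f g = dd (w0 n) (f * g)"

end

theory Submission
  imports
    Defs
    "HOL-Computational_Algebra.Fundamental_Theorem_Algebra"
    "HOL-Computational_Algebra.Polynomial_FPS"
begin

text \<open>
  The argument is the classical one for Schubert polynomials. Write \<open>S\<^sub>w\<close> for \<open>\<CC>\<^sub>w(X, 0)\<close>. The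
  pairing satisfies \<open>\<langle>\<partial>\<^sub>i f, g\<rangle> = \<langle>f, \<partial>\<^sub>i g\<rangle>\<close> for \<open>i < n\<close>: some reduced word of \<open>w\<^sub>0\<close> ends in
  \<open>i\<close>, and \<open>\<partial>\<^sub>i (\<partial>\<^sub>i f \<cdot> g) = \<partial>\<^sub>i f \<cdot> \<partial>\<^sub>i g\<close> is symmetric in \<open>f\<close> and \<open>g\<close> (\<open>pairing_adjoint\<close>).
  As long as \<open>u \<noteq> w\<^sub>0\<close> there is such an \<open>i\<close> with \<open>S\<^sub>u = \<partial>\<^sub>i S\<^bsub>us\<^esub>\<close>, \<open>s = s\<^sub>i\<close>, so one letter after
  the other moves from \<open>v\<close> to \<open>u\<close>. Either \<open>\<partial>\<^sub>i S\<^sub>v = 0\<close> at some step, or the process ends at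
  \<open>\<langle>S\<^bsub>w\<^esub>, S\<^sub>1\<rangle>\<close> with \<open>w = w\<^sub>0\<close>; lengths decide which, because \<open>\<ell>(w\<^sub>0 u) = n\<^sup>2 - \<ell>(u)\<close>.

  Three points below this outline need work.

  \<^item> The operators must be meaningful: the denominators \<open>2 x\<^sub>1\<close> and \<open>x\<^sub>i - x\<^bsub>i+1\<^esub>\<close> must be
    nonzerodivisors. For \<open>2 x\<^sub>1\<close> this says that \<open>\<Gamma>\<close> has no 2-torsion
    (\<open>gamma_two_torsion_free\<close>), which holds because the relators are congruent to the squares
    \<open>c\<^sub>p\<^sup>2\<close> modulo 2, and these form a regular sequence over the field with two elements.

  \<^item> \<open>\<partial>\<^sub>w\<close> must not depend on the reduced word (\<open>dd_word_reduced_unique\<close>): the divided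
    differences satisfy the braid relations, and two reduced words ending in \<open>i\<close> and in \<open>j\<close> can both
    be replaced by words ending in the two sides of the braid relation for \<open>i\<close> and \<open>j\<close>. Lengths are
    computed by counting inversions.

  \<^item> \<open>S\<^sub>1 = 1\<close> must be derived from the axioms of the family. All \<open>\<partial>\<^sub>i\<close> annihilate \<open>S\<^sub>1\<close>, so it is
    invariant under \<open>W\<^sub>\<infinity>\<close>. Symmetry in infinitely many variables puts it into \<open>\<Gamma>\<close>. An element of
    \<open>\<Gamma>\<close> is a function of power series \<open>c(t)\<close> with \<open>c(t) c(-t) = 1\<close>, and invariance under \<open>s\<^sub>0\<close>
    says that the function does not change when \<open>c(t)\<close> is multiplied by \<open>(1 + xt) / (1 - xt)\<close>.
    Over the complex numbers every \<open>c(t)\<close> is, up to any given order, a product of such factors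
    (\<open>complex_gamma_point_approx\<close>), so the function is constant; and elements of \<open>\<Gamma>\<close> are determined
    by their values at complex points (\<open>gamma_eq_zeroI\<close>).
\<close>

section \<open>Homomorphisms out of polynomial rings and out of \<open>\<Gamma>\<close>\<close>

text \<open>
  The scaling law of a ring regarded as a module over itself is associativity of the product read
  from right to left; together with \<open>algebra_simps\<close>, which contains the other orientation, it would
  make rewriting loop.
\<close>

declare ring_module.scale_scale [simp del]

lemma ring_hom_one: "ring_hom \<phi> \<Longrightarrow> \<phi> 1 = 1"
  and ring_hom_add: "ring_hom \<phi> \<Longrightarrow> \<phi> (f + g) = \<phi> f + \<phi> g"
  and ring_hom_mult: "ring_hom \<phi> \<Longrightarrow> \<phi> (f * g) = \<phi> f * \<phi> g"
  by (auto simp: ring_hom_def)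

lemma ring_hom_zero: "ring_hom \<phi> \<Longrightarrow> \<phi> 0 = 0"
  using ring_hom_add[of \<phi> 0 0] by simp

lemma ring_hom_minus: "ring_hom \<phi> \<Longrightarrow> \<phi> (- f) = - \<phi> f"
  using ring_hom_add[of \<phi> "- f" f] by (simp add: ring_hom_zero eq_neg_iff_add_eq_0)

lemma ring_hom_diff: "ring_hom \<phi> \<Longrightarrow> \<phi> (f - g) = \<phi> f - \<phi> g"
  using ring_hom_add[of \<phi> f "- g"] by (simp add: ring_hom_minus)

lemma ring_hom_power: "ring_hom \<phi> \<Longrightarrow> \<phi> (f ^ k) = \<phi> f ^ k"
  by (induction k) (simp_all add: ring_hom_one ring_hom_mult)

lemma ring_hom_sum: "ring_hom \<phi> \<Longrightarrow> \<phi> (\<Sum>i\<in>A. F i) = (\<Sum>i\<in>A. \<phi> (F i))"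
  by (induction A rule: infinite_finite_induct) (simp_all add: ring_hom_zero ring_hom_add)

lemma ring_hom_of_nat: "ring_hom \<phi> \<Longrightarrow> \<phi> (of_nat k) = of_nat k"
  by (induction k) (simp_all add: ring_hom_zero ring_hom_one ring_hom_add)

lemma ring_hom_of_int: "ring_hom \<phi> \<Longrightarrow> \<phi> (of_int k) = of_int k"
  by (cases k rule: int_cases2) (simp_all add: ring_hom_minus ring_hom_of_nat)

lemma ring_hom_numeral: "ring_hom \<phi> \<Longrightarrow> \<phi> (numeral k) = numeral k"
  using ring_hom_of_nat[of \<phi> "numeral k"] by simp

lemmas ring_hom_simps = ring_hom_zero ring_hom_one ring_hom_add ring_hom_mult ring_hom_minus
  ring_hom_diff ring_hom_power ring_hom_sum ring_hom_numeral

lemma ring_hom_comp: "ring_hom \<phi> \<Longrightarrow> ring_hom \<psi> \<Longrightarrow> ring_hom (\<lambda>f. \<phi> (\<psi> f))"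
  by (simp add: ring_hom_def)

lemma ring_hom_id: "ring_hom (\<lambda>f. f)"
  by (simp add: ring_hom_def)

lemma ring_hom_of_int_map: "ring_hom (of_int :: int \<Rightarrow> 'b::comm_ring_1)"
  by (simp add: ring_hom_def)

lemma ring_hom_Const: "ring_hom (Const :: 'a::comm_ring_1 \<Rightarrow> ('v \<Rightarrow>\<^sub>0 nat) \<Rightarrow>\<^sub>0 'a)"
  by (simp add: ring_hom_def Const_def single_add mult_single)

lemma ring_hom_abs_gamma: "ring_hom abs_gamma"
  by (simp add: ring_hom_def one_gamma.abs_eq plus_gamma.abs_eq times_gamma.abs_eq)

lemma poly_mapping_sum_single:
  fixes f :: "'k \<Rightarrow>\<^sub>0 'a::comm_monoid_add"
  shows "f = (\<Sum>k\<in>Poly_Mapping.keys f. Poly_Mapping.single k (Poly_Mapping.lookup f k))"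
  by (rule poly_mapping_eqI) (simp add: lookup_sum lookup_single when_def in_keys_iff)

lemma poly_mapping_single_induct [case_names single add]:
  fixes f :: "'k \<Rightarrow>\<^sub>0 'a::comm_monoid_add"
  assumes single: "\<And>k a. P (Poly_Mapping.single k a)"
    and add: "\<And>f g. P f \<Longrightarrow> P g \<Longrightarrow> P (f + g)"
  shows "P f"
proof -
  have sum: "P (\<Sum>k\<in>K. Poly_Mapping.single k (Poly_Mapping.lookup f k))" if "finite K" for K
    using that by (induction K) (use single[of undefined 0] in \<open>simp_all add: single add\<close>)
  show ?thesis
    by (subst poly_mapping_sum_single) (rule sum[OF finite_keys])
qed

text \<open>Every monomial is a product of variables; the next rule is the form in which statements about
  homomorphisms are reduced to generators.\<close>

lemma polynomial_induct [case_names Const Var add mult]: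
  fixes f :: "('v \<Rightarrow>\<^sub>0 nat) \<Rightarrow>\<^sub>0 'a::comm_ring_1"
  assumes Const: "\<And>a. P (Const a)" and Var: "\<And>v. P (Var v)"
    and add: "\<And>f g. P f \<Longrightarrow> P g \<Longrightarrow> P (f + g)"
    and mult: "\<And>f g. P f \<Longrightarrow> P g \<Longrightarrow> P (f * g)"
  shows "P f"
proof (induction f rule: poly_mapping_single_induct)
  case (single m a)
  have "\<forall>a. P (Poly_Mapping.single m a)"
  proof (induction m rule: poly_mapping_single_induct)
    case (single v k)
    show ?case
    proof (induction k)
      case 0
      then show ?case using Const by (simp add: Const_def)
    next
      case (Suc k)
      have "Poly_Mapping.single (Poly_Mapping.single v (Suc k)) a =
          Var v * Poly_Mapping.single (Poly_Mapping.single v k) a" for a :: 'a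
        by (simp add: Var_def mult_single single_add[symmetric])
      then show ?case using Suc Var mult by metis
    qed
  next
    case (add m m')
    have "Poly_Mapping.single (m + m') a =
        Poly_Mapping.single m a * Poly_Mapping.single m' 1" for a :: 'a
      by (simp add: mult_single)
    then show ?case using add mult by metis
  qed
  then show ?case by blast
qed (rule add)

definition monom_eval :: "('v \<Rightarrow> 'b::comm_ring_1) \<Rightarrow> ('v \<Rightarrow>\<^sub>0 nat) \<Rightarrow> 'b"
  where "monom_eval z m = (\<Prod>v\<in>Poly_Mapping.keys m. z v ^ Poly_Mapping.lookup m v)"

definition poly_eval ::
    "('a \<Rightarrow> 'b) \<Rightarrow> ('v \<Rightarrow> 'b) \<Rightarrow> (('v \<Rightarrow>\<^sub>0 nat) \<Rightarrow>\<^sub>0 'a::comm_ring_1) \<Rightarrow> 'b::comm_ring_1"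
  where "poly_eval \<iota> z f =
    (\<Sum>m\<in>Poly_Mapping.keys f. \<iota> (Poly_Mapping.lookup f m) * monom_eval z m)"

lemma monom_eval_superset:
  assumes "finite S" "Poly_Mapping.keys m \<subseteq> S"
  shows "monom_eval z m = (\<Prod>v\<in>S. z v ^ Poly_Mapping.lookup m v)"
  unfolding monom_eval_def
  by (rule prod.mono_neutral_left) (use assms in \<open>auto simp: in_keys_iff\<close>)

lemma monom_eval_add: "monom_eval z (m + m') = monom_eval z m * monom_eval z m'"
proof -
  let ?S = "Poly_Mapping.keys m \<union> Poly_Mapping.keys m'"
  have "Poly_Mapping.keys (m + m') \<subseteq> ?S" by (rule keys_add)
  then show ?thesis
    by (simp add: monom_eval_superset[of ?S] lookup_add power_add prod.distrib)
qed

lemma poly_eval_single: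
  assumes "ring_hom \<iota>"
  shows "poly_eval \<iota> z (Poly_Mapping.single m a) = \<iota> a * monom_eval z m"
  using assms by (simp add: poly_eval_def ring_hom_zero)

lemma poly_eval_add:
  assumes "ring_hom \<iota>"
  shows "poly_eval \<iota> z (f + g) = poly_eval \<iota> z f + poly_eval \<iota> z g"
  unfolding poly_eval_def
  by (rule setsum_keys_plus_distrib) (simp_all add: assms ring_hom_simps distrib_right)

lemma poly_eval_mult:
  assumes "ring_hom \<iota>"
  shows "poly_eval \<iota> z (f * g) = poly_eval \<iota> z f * poly_eval \<iota> z g"
proof (induction f rule: poly_mapping_single_induct)
  case (single m a)
  show ?case
  proof (induction g rule: poly_mapping_single_induct)
    case (single m' b)
    show ?case
      using assms by (simp add: mult_single poly_eval_single monom_eval_add ring_hom_mult)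
  next
    case (add g h)
    then show ?case using assms by (simp add: distrib_left poly_eval_add)
  qed
next
  case (add f h)
  then show ?case using assms by (simp add: distrib_right poly_eval_add)
qed

lemma ring_hom_poly_eval:
  assumes "ring_hom \<iota>"
  shows "ring_hom (poly_eval \<iota> z)"
proof -
  have "poly_eval \<iota> z 1 = 1"
    using poly_eval_single[OF assms, of z 0 1] assms by (simp add: ring_hom_one monom_eval_def)
  then show ?thesis
    using assms by (simp add: poly_eval_add poly_eval_mult ring_hom_def)
qed

lemma poly_eval_Const: "ring_hom \<iota> \<Longrightarrow> poly_eval \<iota> z (Const a) = \<iota> a"
  by (simp add: Const_def poly_eval_single monom_eval_def)

lemma poly_eval_Var: "ring_hom \<iota> \<Longrightarrow> poly_eval \<iota> z (Var v) = z v"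
  by (simp add: Var_def poly_eval_single monom_eval_def ring_hom_one)

text \<open>
  A sequence that satisfies the defining relations of \<open>\<Gamma>\<close> is the same as a homomorphism from \<open>\<Gamma>\<close>
  to the ring of its entries, in other words a point of the spectrum of \<open>\<Gamma>\<close> over that ring. The
  generator with subscript 0, which the relations mention, is the constant 1.
\<close>

definition gamma_point :: "(nat \<Rightarrow> 'b::comm_ring_1) \<Rightarrow> bool"
  where "gamma_point c \<longleftrightarrow> c 0 = 1 \<and>
    (\<forall>p\<ge>1. (c p)\<^sup>2 + 2 * (\<Sum>i = 1..p. (- 1) ^ i * c (p + i) * c (p - i)) = 0)"

lemma gamma_point_hom:
  assumes "ring_hom \<phi>" "gamma_point c"
  shows "gamma_point (\<lambda>p. \<phi> (c p))"
proof -
  have "\<phi> ((c p)\<^sup>2 + 2 * (\<Sum>i = 1..p. (- 1) ^ i * c (p + i) * c (p - i))) = \<phi> 0" if "p \<ge> 1" for p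
    using assms(2) that by (simp add: gamma_point_def)
  then show ?thesis
    using assms by (simp add: gamma_point_def ring_hom_simps)
qed

text \<open>The shift reflects that the variable of index \<open>k\<close> stands for the generator with subscript
  \<open>k + 1\<close>.\<close>

definition int_eval :: "(nat \<Rightarrow> 'b::comm_ring_1) \<Rightarrow> ((nat \<Rightarrow>\<^sub>0 nat) \<Rightarrow>\<^sub>0 int) \<Rightarrow> 'b"
  where "int_eval c = poly_eval of_int (\<lambda>k. c (Suc k))"

text \<open>At a point the value does not depend on the representative; see \<open>gamma_hom_abs_gamma\<close>.\<close>

definition gamma_hom :: "(nat \<Rightarrow> 'b::comm_ring_1) \<Rightarrow> gamma \<Rightarrow> 'b"
  where "gamma_hom c g = int_eval c (rep_gamma g)"

lemma ring_hom_int_eval: "ring_hom (int_eval c)"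
  unfolding int_eval_def by (intro ring_hom_poly_eval ring_hom_of_int_map)

lemma int_eval_pre_c: "c 0 = 1 \<Longrightarrow> int_eval c (pre_c p) = c p"
  using ring_hom_one[OF ring_hom_int_eval, of c]
  by (simp add: int_eval_def pre_c_def poly_eval_Var ring_hom_of_int_map)

lemma int_eval_gamma_ideal:
  assumes c: "gamma_point c" and a: "a \<in> gamma_ideal"
  shows "int_eval c a = 0"
proof -
  note hom = ring_hom_int_eval[of c]
  have rel: "int_eval c (gamma_relator p) = 0" if "p \<ge> 1" for p
    using c that
    by (simp add: gamma_point_def gamma_relator_def ring_hom_simps[OF hom] int_eval_pre_c)
  have "a \<in> module.span (*) {gamma_relator p | p. p \<ge> 1}"
    using a by (simp only: gamma_ideal_def)
  then show ?thesis
  proof (induction rule: ring_module.span_induct_alt)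
    case base
    show ?case by (simp add: ring_hom_zero[OF hom])
  next
    case (step r a b)
    then show ?case by (auto simp: ring_hom_add[OF hom] ring_hom_mult[OF hom] rel)
  qed
qed

lemma gamma_hom_abs_gamma:
  assumes "gamma_point c"
  shows "gamma_hom c (abs_gamma a) = int_eval c a"
proof -
  have "gamma_rel (rep_gamma (abs_gamma a)) a"
    by (simp add: Quotient3_gamma rep_abs_rsp_left gamma_rel_refl)
  then have "int_eval c (rep_gamma (abs_gamma a) - a) = 0"
    using int_eval_gamma_ideal[OF assms] by (simp add: gamma_rel_def)
  then show ?thesis
    by (simp add: gamma_hom_def ring_hom_simps[OF ring_hom_int_eval])
qed

lemma ring_hom_gamma_hom:
  assumes "gamma_point c"
  shows "ring_hom (gamma_hom c)"
  unfolding ring_hom_def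
proof (intro conjI allI)
  note hom = ring_hom_simps[OF ring_hom_int_eval]
  show "gamma_hom c 1 = 1"
    using gamma_hom_abs_gamma[OF assms, of 1] by (simp add: one_gamma.abs_eq[symmetric] hom)
  fix f g
  obtain a b where ab: "f = abs_gamma a" "g = abs_gamma b"
    by (metis Quotient3_abs_rep Quotient3_gamma)
  show "gamma_hom c (f + g) = gamma_hom c f + gamma_hom c g"
    using gamma_hom_abs_gamma[OF assms] by (simp add: ab plus_gamma.abs_eq hom)
  show "gamma_hom c (f * g) = gamma_hom c f * gamma_hom c g"
    using gamma_hom_abs_gamma[OF assms] by (simp add: ab times_gamma.abs_eq hom)
qed

lemma gamma_induct [case_names int gen add mult]:
  assumes int: "\<And>k. P (of_int k)" and gen: "\<And>p. p \<ge> 1 \<Longrightarrow> P (abs_gamma (pre_c p))"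
    and add: "\<And>f g. P f \<Longrightarrow> P g \<Longrightarrow> P (f + g)"
    and mult: "\<And>f g. P f \<Longrightarrow> P g \<Longrightarrow> P (f * g)"
  shows "P (g :: gamma)"
proof -
  note ghom = ring_hom_simps[OF ring_hom_abs_gamma] ring_hom_of_int[OF ring_hom_abs_gamma]
  have "P (abs_gamma a)" for a
  proof (induction a rule: polynomial_induct)
    case (Const k)
    have "Const k = (of_int k :: (nat \<Rightarrow>\<^sub>0 nat) \<Rightarrow>\<^sub>0 int)"
      using single_of_int[of k, where ?'a = "nat \<Rightarrow>\<^sub>0 nat" and ?'b = int] by (simp add: Const_def)
    then show ?case using int by (simp add: ghom)
  next
    case (Var v)
    then show ?case using gen[of "Suc v"] by (simp add: pre_c_def)
  qed (simp_all add: ghom add mult)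
  then show ?thesis
    by (metis Quotient3_abs_rep Quotient3_gamma)
qed

lemma gamma_xy_induct [case_names int c x y add mult]:
  assumes int: "\<And>k. P (of_int k)" and c: "\<And>p. p \<ge> 1 \<Longrightarrow> P (cgen p)"
    and x: "\<And>j. j \<ge> 1 \<Longrightarrow> P (xvar j)" and y: "\<And>j. j \<ge> 1 \<Longrightarrow> P (yvar j)"
    and add: "\<And>f g. P f \<Longrightarrow> P g \<Longrightarrow> P (f + g)"
    and mult: "\<And>f g. P f \<Longrightarrow> P g \<Longrightarrow> P (f * g)"
  shows "P (f :: gamma_xy)"
proof (induction f rule: polynomial_induct)
  case (Const g)
  note Chom = ring_hom_simps[OF ring_hom_Const] ring_hom_of_int[OF ring_hom_Const]
  show ?case
    by (induction g rule: gamma_induct) (use c in \<open>simp_all add: Chom int add mult cgen_def\<close>)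
next
  case (Var v)
  then show ?case
    by (cases v) (use x[of "Suc _"] y[of "Suc _"] in \<open>simp_all add: xvar_def yvar_def\<close>)
qed (simp_all add: add mult)

text \<open>Identities between compositions of substitutions are checked on generators by this rule; it
  is also the uniqueness needed for the definite description in \<open>gamma_xy_hom\<close>.\<close>

lemma gamma_xy_hom_eqI:
  assumes "ring_hom \<phi>" "ring_hom \<psi>"
    and "\<And>p. p \<ge> 1 \<Longrightarrow> \<phi> (cgen p) = \<psi> (cgen p)" "\<And>j. j \<ge> 1 \<Longrightarrow> \<phi> (xvar j) = \<psi> (xvar j)"
    and "\<And>j. j \<ge> 1 \<Longrightarrow> \<phi> (yvar j) = \<psi> (yvar j)"
  shows "\<phi> f = \<psi> f"
  by (induction f rule: gamma_xy_induct)
    (simp_all add: assms ring_hom_of_int ring_hom_add ring_hom_mult)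

text \<open>
  The value at 0 of the sequence of prescribed images is a dummy (0 in the case of the constant
  term), whereas the relations of \<open>\<Gamma>\<close> involve the generator with subscript 0, which is 1; hence the
  update in the hypothesis.
\<close>

lemma gamma_xy_hom:
  assumes c: "gamma_point (c'(0 := 1))"
  shows ring_hom_gamma_xy_hom: "ring_hom (gamma_xy_hom c' x' y')"
    and gamma_xy_hom_c: "p \<ge> 1 \<Longrightarrow> gamma_xy_hom c' x' y' (cgen p) = c' p"
    and gamma_xy_hom_x: "j \<ge> 1 \<Longrightarrow> gamma_xy_hom c' x' y' (xvar j) = x' j"
    and gamma_xy_hom_y: "j \<ge> 1 \<Longrightarrow> gamma_xy_hom c' x' y' (yvar j) = y' j"
proof -
  define Q where "Q \<phi> \<longleftrightarrow> ring_hom \<phi> \<and> (\<forall>p\<ge>1. \<phi> (cgen p) = c' p) \<and> (\<forall>j\<ge>1. \<phi> (xvar j) = x' j) \<and>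
    (\<forall>j\<ge>1. \<phi> (yvar j) = y' j)" for \<phi>
  define z where "z v = (case v of XVar k \<Rightarrow> x' (Suc k) | YVar k \<Rightarrow> y' (Suc k))" for v
  define \<theta> where "\<theta> = poly_eval (gamma_hom (c'(0 := 1))) z"
  note ghom = ring_hom_gamma_hom[OF c]
  have "ring_hom \<theta>"
    unfolding \<theta>_def by (intro ring_hom_poly_eval ghom)
  moreover have "\<theta> (cgen p) = c' p" if "p \<ge> 1" for p
    using that unfolding \<theta>_def cgen_def poly_eval_Const[OF ghom] gamma_hom_abs_gamma[OF c]
    by (simp add: int_eval_pre_c)
  moreover have "\<theta> (xvar j) = x' j" "\<theta> (yvar j) = y' j" if "j \<ge> 1" for j
    using that unfolding \<theta>_def xvar_def yvar_def poly_eval_Var[OF ghom] by (simp_all add: z_def)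
  ultimately have "Q \<theta>"
    by (simp add: Q_def)
  moreover have "\<phi> = \<psi>" if "Q \<phi>" "Q \<psi>" for \<phi> \<psi>
    by (rule ext, rule gamma_xy_hom_eqI) (use that in \<open>simp_all add: Q_def\<close>)
  ultimately have "\<exists>!\<phi>. Q \<phi>"
    by blast
  then have "Q (THE \<phi>. Q \<phi>)"
    by (rule theI')
  moreover have "gamma_xy_hom c' x' y' = (THE \<phi>. Q \<phi>)"
    unfolding gamma_xy_hom_def Q_def ..
  ultimately have Q: "Q (gamma_xy_hom c' x' y')"
    by (simp only:)
  from Q show "ring_hom (gamma_xy_hom c' x' y')"
    "p \<ge> 1 \<Longrightarrow> gamma_xy_hom c' x' y' (cgen p) = c' p"
    "j \<ge> 1 \<Longrightarrow> gamma_xy_hom c' x' y' (xvar j) = x' j"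
    "j \<ge> 1 \<Longrightarrow> gamma_xy_hom c' x' y' (yvar j) = y' j"
    by (simp_all add: Q_def)
qed

section \<open>Power series with \<open>c(t) c(-t) = 1\<close>\<close>

text \<open>This is \<open>F(-t)\<close> for \<open>F = F(t)\<close>.\<close>

definition fps_neg_arg :: "'b::comm_ring_1 fps \<Rightarrow> 'b fps"
  where "fps_neg_arg F = Abs_fps (\<lambda>n. (- 1) ^ n * fps_nth F n)"

lemma fps_neg_arg_nth [simp]: "fps_nth (fps_neg_arg F) n = (- 1) ^ n * fps_nth F n"
  by (simp add: fps_neg_arg_def)

lemma fps_neg_arg_one [simp]: "fps_neg_arg 1 = 1"
  by (rule fps_ext) simp

lemma fps_neg_arg_add: "fps_neg_arg (F + G) = fps_neg_arg F + fps_neg_arg G"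
  by (rule fps_ext) (simp add: distrib_left)

lemma fps_neg_arg_mult: "fps_neg_arg (F * G) = fps_neg_arg F * fps_neg_arg G"
proof (rule fps_ext)
  fix n
  have "(- 1) ^ n * (fps_nth F i * fps_nth G (n - i)) =
      ((- 1) ^ i * fps_nth F i) * ((- 1) ^ (n - i) * fps_nth G (n - i))" if "i \<in> {0..n}" for i
  proof -
    have "(- 1 :: 'a) ^ n = (- 1) ^ i * (- 1) ^ (n - i)"
      using that by (subst power_add[symmetric]) simp
    then show ?thesis by (simp only: mult_ac)
  qed
  then show "fps_nth (fps_neg_arg (F * G)) n = fps_nth (fps_neg_arg F * fps_neg_arg G) n"
    unfolding fps_neg_arg_nth fps_mult_nth sum_distrib_left by (intro sum.cong refl)
qed

lemma sum_around_middle: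
  fixes f :: "nat \<Rightarrow> 'b::comm_monoid_add"
  shows "(\<Sum>i = 0..2 * p. f i) = f p + (\<Sum>i = 1..p. f (p + i) + f (p - i))"
proof -
  have "(\<Sum>i = p - q..p + q. f i) = f p + (\<Sum>i = 1..q. f (p + i) + f (p - i))" if "q \<le> p" for q
    using that
  proof (induction q)
    case (Suc q)
    have "{p - Suc q..p + Suc q} = insert (p - Suc q) (insert (p + Suc q) {p - q..p + q})"
      using Suc.prems by auto
    moreover have "p - Suc q \<notin> insert (p + Suc q) {p - q..p + q}" "p + Suc q \<notin> {p - q..p + q}"
      using Suc.prems by auto
    ultimately show ?case
      using Suc by (simp add: add_ac)
  qed simp
  from this[of p] show ?thesis by (simp add: mult_2)
qed

lemma sum_antisymmetric:
  fixes f :: "nat \<Rightarrow> 'b::ab_group_add"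
  assumes "\<And>i. i \<le> 2 * p + 1 \<Longrightarrow> f (2 * p + 1 - i) = - f i"
  shows "(\<Sum>i = 0..2 * p + 1. f i) = 0"
proof -
  have "(\<Sum>i = 0..2 * p + 1. f i) = (\<Sum>i = 0..p. f i) + (\<Sum>i = p + 1..2 * p + 1. f i)"
    using sum.ub_add_nat[of 0 p f "p + 1"] by (simp add: mult_2)
  also have "(\<Sum>i = p + 1..2 * p + 1. f i) = (\<Sum>i = 0..p. f (2 * p + 1 - i))"
    by (rule sum.reindex_bij_witness[of _ "\<lambda>i. 2 * p + 1 - i" "\<lambda>i. 2 * p + 1 - i"]) auto
  also have "\<dots> = - (\<Sum>i = 0..p. f i)"
    unfolding sum_negf[symmetric] by (rule sum.cong[OF refl], rule assms) simp
  finally show ?thesis by simp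
qed

text \<open>
  Up to sign, the relation for \<open>p\<close> is the coefficient of \<open>t\<^bsup>2p\<^esup>\<close> in \<open>c(t) c(-t)\<close>. The odd
  coefficients vanish in every commutative ring, since interchanging the two factors changes their
  sign termwise.
\<close>

lemma gamma_point_iff_fps:
  assumes "c 0 = 1"
  shows "gamma_point c \<longleftrightarrow> Abs_fps c * fps_neg_arg (Abs_fps c) = 1"
proof -
  let ?C = "Abs_fps c * fps_neg_arg (Abs_fps c)"
  have nth: "fps_nth ?C n = (\<Sum>i = 0..n. (- 1) ^ (n - i) * (c i * c (n - i)))" for n
    by (simp only: fps_mult_nth fps_neg_arg_nth fps_nth_Abs_fps mult.left_commute)
  have odd: "fps_nth ?C (2 * p + 1) = 0" for p
    unfolding nth
  proof (rule sum_antisymmetric)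
    fix i assume i: "i \<le> 2 * p + 1"
    have "(- 1 :: 'a) ^ i = - ((- 1) ^ (2 * p + 1 - i))"
      using i by (cases "even i") (auto simp: uminus_power_if)
    moreover have "2 * p + 1 - (2 * p + 1 - i) = i"
      using i by simp
    ultimately show "(- 1) ^ (2 * p + 1 - (2 * p + 1 - i)) *
        (c (2 * p + 1 - i) * c (2 * p + 1 - (2 * p + 1 - i))) =
        - ((- 1) ^ (2 * p + 1 - i) * (c i * c (2 * p + 1 - i)))"
      by (simp only: mult_minus_left mult.commute[of "c i"])
  qed
  have even: "fps_nth ?C (2 * p) =
      (- 1) ^ p * ((c p)\<^sup>2 + 2 * (\<Sum>i = 1..p. (- 1) ^ i * c (p + i) * c (p - i)))" for p
  proof -
    define f where "f i = (- 1) ^ (2 * p - i) * (c i * c (2 * p - i))" for i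
    have "f (p + i) + f (p - i) = (- 1) ^ p * (2 * ((- 1) ^ i * c (p + i) * c (p - i)))"
      if "i \<in> {1..p}" for i
    proof -
      have "2 * p - (p + i) = p - i" "2 * p - (p - i) = p + i"
        using that by auto
      moreover have "(- 1 :: 'a) ^ (p - i) = (- 1) ^ (p + i)"
        using that by (simp add: uminus_power_if)
      ultimately show ?thesis
        by (simp only: f_def power_add mult_2 mult_ac distrib_left)
    qed
    then have "(\<Sum>i = 1..p. f (p + i) + f (p - i)) =
        (- 1) ^ p * (2 * (\<Sum>i = 1..p. (- 1) ^ i * c (p + i) * c (p - i)))"
      by (simp only: sum_distrib_left cong: sum.cong)
    moreover have "f p = (- 1) ^ p * (c p)\<^sup>2"
      by (simp add: f_def power2_eq_square mult_2)
    ultimately show ?thesis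
      unfolding nth f_def[symmetric] sum_around_middle by (simp only: distrib_left)
  qed
  show ?thesis
  proof
    assume c: "gamma_point c"
    show "?C = 1"
    proof (rule fps_ext)
      fix n
      show "fps_nth ?C n = fps_nth 1 n"
      proof (cases "even n")
        case True
        then obtain p where "n = 2 * p" by blast
        then show ?thesis
          using c assms even[of p] by (cases "p = 0") (simp_all add: gamma_point_def)
      next
        case False
        then obtain p where "n = 2 * p + 1" by (blast elim: oddE)
        then show ?thesis using odd[of p] by simp
      qed
    qed
  next
    assume "?C = 1"
    then have "(- 1) ^ p * ((- 1) ^ p * ((c p)\<^sup>2 +
        2 * (\<Sum>i = 1..p. (- 1) ^ i * c (p + i) * c (p - i)))) = 0" if "p \<ge> 1" for p
      using even[of p] that by simp
    then show "gamma_point c"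
      using assms by (simp add: gamma_point_def flip: mult.assoc power_add)
  qed
qed

text \<open>
  The series \<open>(1 + xt) / (1 - xt)\<close>, and the effect of multiplying \<open>c(t)\<close> by it. On the generators of
  \<open>\<Gamma>\<close>, \<open>s\<^sub>0\<close> is the twist by \<open>x\<^sub>1\<close>; the multiplicative form makes it evident that twists commute,
  that the twist by \<open>-x\<close> is inverse to the twist by \<open>x\<close>, and that twists preserve the relations.
\<close>

definition twist_fps :: "'b::comm_ring_1 \<Rightarrow> 'b fps"
  where "twist_fps x = Abs_fps (\<lambda>n. if n = 0 then 1 else 2 * x ^ n)"

definition twist :: "'b::comm_ring_1 \<Rightarrow> (nat \<Rightarrow> 'b) \<Rightarrow> nat \<Rightarrow> 'b"
  where "twist x c p = c p + 2 * (\<Sum>j = 1..p. x ^ j * c (p - j))"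

lemma fps_const_X_mult_nth:
  "fps_nth (fps_const x * fps_X * F) n = (if n = 0 then 0 else x * fps_nth F (n - 1))"
  for x :: "'b::comm_ring_1"
  by (subst mult.assoc, subst fps_mult_left_const_nth, subst fps_X_mult_nth) simp

lemma twist_fps_eq: "(1 - fps_const x * fps_X) * twist_fps x = 1 + fps_const x * fps_X"
proof (rule fps_ext)
  fix n
  show "fps_nth ((1 - fps_const x * fps_X) * twist_fps x) n = fps_nth (1 + fps_const x * fps_X) n"
    unfolding left_diff_distrib fps_sub_nth fps_const_X_mult_nth
    by (cases n) (auto simp: twist_fps_def)
qed

text \<open>The coefficients form an arbitrary commutative ring, where \<open>1 - xt\<close> is inverted by the
  geometric series.\<close>

lemma twist_fps_uminus: "twist_fps (- x) * twist_fps x = 1"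
proof -
  define G :: "'a \<Rightarrow> 'a fps" where "G y = Abs_fps (\<lambda>n. y ^ n)" for y
  have G: "(1 - fps_const y * fps_X) * G y = 1" for y
  proof (rule fps_ext)
    fix n
    show "fps_nth ((1 - fps_const y * fps_X) * G y) n = fps_nth 1 n"
      unfolding left_diff_distrib fps_sub_nth fps_const_X_mult_nth by (cases n) (auto simp: G_def)
  qed
  have V: "twist_fps y = G y * (1 - fps_const (- y) * fps_X)" for y
  proof -
    have "twist_fps y = ((1 - fps_const y * fps_X) * G y) * twist_fps y"
      by (simp add: G)
    also have "\<dots> = G y * ((1 - fps_const y * fps_X) * twist_fps y)"
      by (simp only: mult_ac)
    also have "\<dots> = G y * (1 - fps_const (- y) * fps_X)"
      by (simp only: twist_fps_eq fps_const_neg[symmetric] mult_minus_left diff_minus_eq_add)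
    finally show ?thesis .
  qed
  have "twist_fps (- x) * twist_fps x =
      ((1 - fps_const x * fps_X) * G x) * ((1 - fps_const (- x) * fps_X) * G (- x))"
    unfolding V by (simp only: minus_minus mult_ac)
  then show ?thesis by (simp only: G mult_1)
qed

lemma fps_neg_arg_twist_fps: "fps_neg_arg (twist_fps x) = twist_fps (- x)"
  by (rule fps_ext) (auto simp: twist_fps_def power_minus[of x])

lemma twist_zero [simp]: "twist x c 0 = c 0"
  by (simp add: twist_def)

lemma Abs_fps_twist: "Abs_fps (twist x c) = twist_fps x * Abs_fps c"
proof (rule fps_ext)
  fix p
  have "(\<Sum>i = 0..p. (if i = 0 then 1 else 2 * x ^ i) * c (p - i)) =
      c p + (\<Sum>i = 1..p. 2 * x ^ i * c (p - i))"
    by (simp add: sum.atLeast_Suc_atMost)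
  then show "fps_nth (Abs_fps (twist x c)) p = fps_nth (twist_fps x * Abs_fps c) p"
    by (simp only: fps_mult_nth twist_fps_def twist_def sum_distrib_left fps_nth_Abs_fps mult.assoc)
qed

lemma Abs_fps_inject_iff: "Abs_fps c = Abs_fps d \<longleftrightarrow> c = d"
  by (metis fps_nth_Abs_fps ext)

lemma twist_commute: "twist x (twist y c) = twist y (twist x c)"
  unfolding Abs_fps_inject_iff[symmetric] Abs_fps_twist by (simp only: mult_ac)

lemma twist_uminus_twist: "twist (- x) (twist x c) = c"
proof -
  have "Abs_fps (twist (- x) (twist x c)) = (twist_fps (- x) * twist_fps x) * Abs_fps c"
    unfolding Abs_fps_twist by (simp only: mult_ac)
  then show ?thesis
    unfolding twist_fps_uminus mult_1 Abs_fps_inject_iff .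
qed

lemma gamma_point_twist:
  assumes "gamma_point c"
  shows "gamma_point (twist x c)"
proof -
  have c: "c 0 = 1" using assms by (simp add: gamma_point_def)
  have "Abs_fps (twist x c) * fps_neg_arg (Abs_fps (twist x c)) =
      (twist_fps (- x) * twist_fps x) * (Abs_fps c * fps_neg_arg (Abs_fps c))"
    unfolding Abs_fps_twist fps_neg_arg_mult fps_neg_arg_twist_fps by (simp only: mult_ac)
  also have "\<dots> = 1"
    unfolding twist_fps_uminus using gamma_point_iff_fps[of c, OF c] assms by simp
  finally show ?thesis
    using gamma_point_iff_fps[of "twist x c"] c by simp
qed

lemma ring_hom_twist: "ring_hom \<phi> \<Longrightarrow> \<phi> (twist x c p) = twist (\<phi> x) (\<lambda>p. \<phi> (c p)) p"
  by (simp add: twist_def ring_hom_simps)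

section \<open>Complex points are products of twists\<close>

abbreviation trivial_point :: "nat \<Rightarrow> 'b::comm_ring_1"
  where "trivial_point \<equiv> (\<lambda>p. if p = 0 then 1 else 0)"

lemma gamma_point_trivial: "gamma_point (trivial_point :: nat \<Rightarrow> 'b::comm_ring_1)"
proof -
  have "Abs_fps trivial_point = (1 :: 'b fps)" by (rule fps_ext) simp
  then show ?thesis using gamma_point_iff_fps[of "trivial_point :: nat \<Rightarrow> 'b"] by simp
qed

text \<open>The normalisation \<open>q(0) = 1\<close> keeps the roots away from 0, so that linear factors can be
  written as \<open>1 + xt\<close> without a leading coefficient.\<close>

lemma complex_poly_split:
  fixes q :: "complex poly"
  assumes "coeff q 0 = 1"
  shows "\<exists>xs. q = prod_list (map (\<lambda>x. [:1, x:]) xs)"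
  using assms
proof (induction "degree q" arbitrary: q rule: less_induct)
  case less
  show ?case
  proof (cases "degree q = 0")
    case True
    then have "q = 1"
      using less.prems by (metis degree_eq_zeroE coeff_pCons_0 one_pCons)
    then show ?thesis by (intro exI[of _ "[]"]) simp
  next
    case False
    then obtain r where r: "poly q r = 0"
      using fundamental_theorem_of_algebra_alt[of q] by (metis degree_pCons_0)
    have "poly q 0 = 1" using less.prems by (simp add: poly_0_coeff_0)
    then have "r \<noteq> 0" using r by auto
    from r obtain s where s: "q = [:- r, 1:] * s"
      by (auto simp: poly_eq_0_iff_dvd dvd_def)
    define t where "t = smult (- r) s"
    have q: "q = [:1, - inverse r:] * t"
    proof -
      have "[:- r, 1:] = smult (- r) [:1, - inverse r:]" using \<open>r \<noteq> 0\<close> by simp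
      then show ?thesis by (simp only: s t_def mult_smult_left mult_smult_right)
    qed
    have "t \<noteq> 0" using q less.prems by auto
    then have "degree q = Suc (degree t)"
      unfolding q using \<open>r \<noteq> 0\<close> by (subst degree_mult_eq) auto
    moreover have "coeff t 0 = 1"
      using less.prems by (simp add: q)
    ultimately obtain xs where "t = prod_list (map (\<lambda>x. [:1, x:]) xs)"
      using less.hyps by auto
    then show ?thesis
      using q by (intro exI[of _ "- inverse r # xs"]) simp
  qed
qed

text \<open>For \<open>P(t) = \<Prod>(1 + x\<^sub>i t)\<close>, the product of the series \<open>(1 + x\<^sub>i t) / (1 - x\<^sub>i t)\<close> is
  \<open>P(t) / P(-t)\<close>; the denominator is cleared to stay in the ring of power series.\<close>

lemma foldr_twist_fps:
  "Abs_fps (foldr twist xs trivial_point) *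
      fps_neg_arg (fps_of_poly (prod_list (map (\<lambda>x. [:1, x:]) xs))) =
    fps_of_poly (prod_list (map (\<lambda>x. [:1, x:]) xs))"
proof (induction xs)
  case Nil
  have "Abs_fps trivial_point = (1 :: 'a fps)" by (rule fps_ext) simp
  then show ?case by simp
next
  case (Cons x xs)
  let ?P = "fps_of_poly (prod_list (map (\<lambda>x. [:1, x:]) xs))"
  have lin: "fps_of_poly [:1, x:] = 1 + fps_const x * fps_X"
    by (simp add: fps_of_poly_pCons mult.commute)
  have neg: "fps_neg_arg (1 + fps_const x * fps_X) = 1 - fps_const x * fps_X"
    by (rule fps_ext) (auto simp: le_Suc_eq)
  have "Abs_fps (foldr twist (x # xs) trivial_point) *
      fps_neg_arg (fps_of_poly (prod_list (map (\<lambda>x. [:1, x:]) (x # xs)))) =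
      ((1 - fps_const x * fps_X) * twist_fps x) *
      (Abs_fps (foldr twist xs trivial_point) * fps_neg_arg ?P)"
    unfolding foldr.simps o_apply list.map prod_list.Cons fps_of_poly_mult lin
      fps_neg_arg_mult neg Abs_fps_twist by (simp only: mult_ac)
  then show ?case
    unfolding twist_fps_eq Cons.IH by (simp add: fps_of_poly_mult lin)
qed

text \<open>
  Since \<open>c(-t) = 1 / c(t)\<close>, the series \<open>P = (1 + c) / 2\<close> satisfies \<open>c(t) = P(t) / P(-t)\<close> and
  \<open>P(0) = 1\<close>. Truncating \<open>P\<close> above degree \<open>N\<close> does not affect the quotient up to order \<open>N\<close>, and the
  truncation is a polynomial, which splits over the complex numbers.
\<close>

lemma complex_gamma_point_approx:
  fixes c :: "nat \<Rightarrow> complex"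
  assumes "gamma_point c"
  shows "\<exists>xs. \<forall>p\<le>N. c p = foldr twist xs trivial_point p"
proof -
  have c0: "c 0 = 1" using assms by (simp add: gamma_point_def)
  define P where "P = fps_const (1 / 2) * (1 + Abs_fps c)"
  have CP: "Abs_fps c * fps_neg_arg P = P"
  proof -
    have "Abs_fps c * fps_neg_arg (Abs_fps c) = 1"
      using assms gamma_point_iff_fps[of c, OF c0] by simp
    moreover have "fps_neg_arg (fps_const (1 / 2)) = (fps_const (1 / 2) :: complex fps)"
      by (rule fps_ext) simp
    ultimately show ?thesis
      by (simp add: P_def fps_neg_arg_mult fps_neg_arg_add algebra_simps)
  qed
  define q where "q = Poly (map (fps_nth P) [0..<Suc N])"
  have q: "coeff q i = (if i \<le> N then fps_nth P i else 0)" for i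
    by (auto simp: q_def nth_default_def simp del: upt_Suc)
  have P0: "fps_nth P 0 = 1" by (simp add: P_def c0)
  then obtain xs where xs: "q = prod_list (map (\<lambda>x. [:1, x:]) xs)"
    using complex_poly_split[of q] q by auto
  define d where "d = foldr twist xs trivial_point"
  have DQ: "Abs_fps d * fps_neg_arg (fps_of_poly q) = fps_of_poly q"
    unfolding d_def xs by (rule foldr_twist_fps)
  have "c p = d p" if "p \<le> N" for p
    using that
  proof (induction p rule: less_induct)
    case (less p)
    have c: "(\<Sum>i<p. c i * ((- 1) ^ (p - i) * fps_nth P (p - i))) + c p = fps_nth P p"
      using arg_cong[OF CP, of "\<lambda>F. fps_nth F p"] P0
      by (simp add: fps_mult_nth lessThan_atLeast0 sum.last_plus add.commute)
    have "(\<Sum>i<p. d i * ((- 1) ^ (p - i) * coeff q (p - i))) =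
        (\<Sum>i<p. d i * ((- 1) ^ (p - i) * fps_nth P (p - i)))"
      using less.prems by (intro sum.cong refl) (simp add: q)
    then have d: "(\<Sum>i<p. d i * ((- 1) ^ (p - i) * fps_nth P (p - i))) + d p = fps_nth P p"
      using arg_cong[OF DQ, of "\<lambda>F. fps_nth F p"] P0 less.prems
      by (simp add: fps_mult_nth lessThan_atLeast0 sum.last_plus add.commute q[of 0] q[of p])
    have "(\<Sum>i<p. c i * ((- 1) ^ (p - i) * fps_nth P (p - i))) =
        (\<Sum>i<p. d i * ((- 1) ^ (p - i) * fps_nth P (p - i)))"
      using less by (intro sum.cong refl) simp
    then show ?case
      using c d by (metis add_left_cancel)
  qed
  then show ?thesis unfolding d_def by blast
qed

section \<open>\<open>\<Gamma>\<close> has no 2-torsion\<close>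

lemma lookup_mult_single_add:
  fixes f :: "('v \<Rightarrow>\<^sub>0 nat) \<Rightarrow>\<^sub>0 'a::comm_ring_1"
  shows "Poly_Mapping.lookup (f * Poly_Mapping.single k 1) (m + k) = Poly_Mapping.lookup f m"
  by (induction f rule: poly_mapping_single_induct)
    (simp_all add: mult_single lookup_single when_def distrib_right lookup_add)

lemma lookup_mult_single_neq_zeroE:
  fixes f :: "('v \<Rightarrow>\<^sub>0 nat) \<Rightarrow>\<^sub>0 'a::comm_ring_1"
  assumes "Poly_Mapping.lookup (f * Poly_Mapping.single k 1) m \<noteq> 0"
  obtains m' where "m = m' + k"
proof -
  have "m \<in> Poly_Mapping.keys (f * Poly_Mapping.single k 1)"
    using assms by (simp add: in_keys_iff)
  then have "\<exists>a b. m = a + b \<and> b \<in> Poly_Mapping.keys (Poly_Mapping.single k (1::'a))"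
    using keys_mult by blast
  then show thesis using that by auto
qed

lemma lookup_two_times:
  fixes f :: "'m::monoid_add \<Rightarrow>\<^sub>0 'a::comm_ring_1"
  shows "Poly_Mapping.lookup (2 * f) m = 2 * Poly_Mapping.lookup f m"
  by (simp only: mult_2 lookup_add)

lemma pre_c_square:
  assumes "p \<ge> 1"
  shows "(pre_c p)\<^sup>2 = Poly_Mapping.single (Poly_Mapping.single (p - 1) 2) 1"
  using assms by (simp add: pre_c_def Var_def power2_eq_square mult_single numeral_2_eq_2 flip: single_add)

text \<open>
  Modulo 2 and modulo the squares \<open>c\<^sub>p\<^sup>2\<close>, \<open>p \<in> S\<close>, a polynomial vanishes iff each of its monomials
  with odd coefficient has an exponent at least 2 at some index in \<open>S\<close>. Multiplication by \<open>c\<^sub>q\<^sup>2\<close>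
  shifts monomials without touching these exponents when \<open>q \<notin> S\<close>. So the squares form a regular
  sequence modulo 2.
\<close>

lemma square_regular_mod_2:
  assumes S: "finite S" "S \<subseteq> {1..}" "q \<notin> S" "q \<ge> 1"
    and eq: "g * (pre_c q)\<^sup>2 = (\<Sum>p\<in>S. h p * (pre_c p)\<^sup>2) + 2 * k"
  shows "\<exists>a b. g = (\<Sum>p\<in>S. a p * (pre_c p)\<^sup>2) + 2 * b"
proof -
  define J where "J = {f. \<exists>a b. f = (\<Sum>p\<in>S. a p * (pre_c p)\<^sup>2) + 2 * b}"
  have J_add: "f + f' \<in> J" if "f \<in> J" "f' \<in> J" for f f'
  proof -
    from that obtain a b a' b' where "f = (\<Sum>p\<in>S. a p * (pre_c p)\<^sup>2) + 2 * b"
      "f' = (\<Sum>p\<in>S. a' p * (pre_c p)\<^sup>2) + 2 * b'"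
      by (auto simp: J_def)
    then have "f + f' = (\<Sum>p\<in>S. (a p + a' p) * (pre_c p)\<^sup>2) + 2 * (b + b')"
      by (simp add: distrib_left distrib_right sum.distrib)
    then show ?thesis
      unfolding J_def by (intro CollectI exI[of _ "\<lambda>p. a p + a' p"] exI[of _ "b + b'"])
  qed
  have zero: "0 \<in> J"
    unfolding J_def by (intro CollectI exI[of _ "\<lambda>_. 0"] exI[of _ 0]) simp
  have J_even: "2 * b \<in> J" for b
    unfolding J_def by (intro CollectI exI[of _ "\<lambda>_. 0"] exI[of _ b]) simp
  have J_square: "f * (pre_c p)\<^sup>2 \<in> J" if "p \<in> S" for f p
  proof -
    have "f * (pre_c p)\<^sup>2 = (\<Sum>i\<in>S. (if i = p then f else 0) * (pre_c i)\<^sup>2)"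
      using that S by (simp add: if_distrib[of "\<lambda>z. z * _"] cong: if_cong)
    then show ?thesis
      unfolding J_def by (intro CollectI exI[of _ "\<lambda>i. if i = p then f else 0"] exI[of _ 0]) simp
  qed
  have summand: "Poly_Mapping.single m (Poly_Mapping.lookup g m) \<in> J" for m
  proof (cases "even (Poly_Mapping.lookup g m)")
    case True
    then have "Poly_Mapping.single m (Poly_Mapping.lookup g m) =
        2 * Poly_Mapping.single m (Poly_Mapping.lookup g m div 2)"
      by (simp only: mult_2 flip: single_add) (simp flip: mult_2)
    then show ?thesis using J_even by metis
  next
    case False
    let ?m = "m + Poly_Mapping.single (q - 1) 2"
    have "odd (Poly_Mapping.lookup (g * (pre_c q)\<^sup>2) ?m)"
      using False S by (simp add: pre_c_square lookup_mult_single_add)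
    then have "odd (\<Sum>p\<in>S. Poly_Mapping.lookup (h p * (pre_c p)\<^sup>2) ?m)"
      unfolding eq by (simp add: lookup_add lookup_sum lookup_two_times)
    then obtain p where p: "p \<in> S" "odd (Poly_Mapping.lookup (h p * (pre_c p)\<^sup>2) ?m)"
      by (meson dvd_sum)
    moreover have "p \<ge> 1" using p S by auto
    ultimately obtain m' where "?m = m' + Poly_Mapping.single (p - 1) 2"
      by (metis lookup_mult_single_neq_zeroE pre_c_square even_zero)
    then have "Poly_Mapping.lookup ?m (p - 1) \<ge> 2"
      by (simp add: lookup_add)
    moreover have "p \<noteq> q" using p S by auto
    then have "p - 1 \<noteq> q - 1" using S \<open>p \<ge> 1\<close> by arith
    ultimately have "Poly_Mapping.lookup m (p - 1) \<ge> 2"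
      by (simp add: lookup_add lookup_single)
    then have "m = (m - Poly_Mapping.single (p - 1) 2) + Poly_Mapping.single (p - 1) 2"
      by (intro poly_mapping_eqI) (auto simp: lookup_add lookup_minus lookup_single when_def)
    then have "Poly_Mapping.single m (Poly_Mapping.lookup g m) =
        Poly_Mapping.single (m - Poly_Mapping.single (p - 1) 2) (Poly_Mapping.lookup g m) *
        (pre_c p)\<^sup>2"
      using \<open>p \<ge> 1\<close> by (simp add: pre_c_square mult_single)
    then show ?thesis using J_square[OF p(1)] by metis
  qed
  have J_sum: "(\<Sum>m\<in>M. Poly_Mapping.single m (Poly_Mapping.lookup g m)) \<in> J" if "finite M" for M
    using that by (induction M) (simp_all add: zero J_add summand)
  have "g \<in> J" by (subst poly_mapping_sum_single) (rule J_sum[OF finite_keys])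
  then show ?thesis by (simp add: J_def)
qed

lemma gamma_relator_in_ideal: "p \<ge> 1 \<Longrightarrow> gamma_relator p \<in> gamma_ideal"
  unfolding gamma_ideal_def by (rule ring_module.span_base) blast

text \<open>
  Modulo 2 the relators are the squares \<open>c\<^sub>p\<^sup>2\<close>, so the hypothesis is a syzygy of a regular sequence.
  By regularity the coefficient of the last relator is a combination of the other squares plus an
  even polynomial. Replacing these squares by the relators, which changes them by even
  polynomials, moves the last term into the coefficients of the others, and the statement follows by
  induction on \<open>S\<close>. This is the exactness of the Koszul complex in degree one.
\<close>

lemma even_relator_combination:
  assumes "finite S" "S \<subseteq> {1..}" "(\<Sum>p\<in>S. h p * (pre_c p)\<^sup>2) = 2 * k"
  shows "\<exists>i\<in>gamma_ideal. (\<Sum>p\<in>S. h p * gamma_relator p) = 2 * i"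
  using assms
proof (induction S arbitrary: h k rule: finite_induct)
  case empty
  then show ?case using gamma_ideal_zero by (intro bexI[of _ 0]) auto
next
  case (insert q S)
  define t where "t p = (\<Sum>i = 1..p. (- 1) ^ i * pre_c (p + i) * pre_c (p - i))" for p
  have rel: "gamma_relator p = (pre_c p)\<^sup>2 + 2 * t p" for p
    by (simp add: gamma_relator_def t_def)
  have hq: "h q * (pre_c q)\<^sup>2 = (\<Sum>p\<in>S. - h p * (pre_c p)\<^sup>2) + 2 * k"
    using insert by (simp add: sum_negf eq_diff_eq)
  obtain a b where ab: "h q = (\<Sum>p\<in>S. a p * (pre_c p)\<^sup>2) + 2 * b"
    using square_regular_mod_2[OF insert.hyps(1) _ insert.hyps(2) _ hq] insert.prems by auto
  \<comment> \<open>With \<open>r\<close> for the relators: \<open>\<Sum> h' r = \<Sum> h r + r\<^sub>q (\<Sum> a r)\<close>, and \<open>\<Sum> a r\<close> equals \<open>h\<^sub>q\<close> up to an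
    even polynomial.\<close>
  define h' where "h' p = h p + a p * gamma_relator q" for p
  have "(\<Sum>p\<in>S. h' p * (pre_c p)\<^sup>2) =
      (\<Sum>p\<in>S. h p * (pre_c p)\<^sup>2) + gamma_relator q * (\<Sum>p\<in>S. a p * (pre_c p)\<^sup>2)"
    unfolding h'_def distrib_right sum.distrib sum_distrib_left by (simp only: mult_ac)
  also have "(\<Sum>p\<in>S. a p * (pre_c p)\<^sup>2) = h q - 2 * b"
    using ab by simp
  also have "(\<Sum>p\<in>S. h p * (pre_c p)\<^sup>2) = 2 * k - h q * (pre_c q)\<^sup>2"
    using hq by (simp add: sum_negf)
  also have "2 * k - h q * (pre_c q)\<^sup>2 + gamma_relator q * (h q - 2 * b) =
      2 * (k + t q * h q - gamma_relator q * b)"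
    unfolding rel by (simp add: algebra_simps)
  finally obtain i where i: "i \<in> gamma_ideal" "(\<Sum>p\<in>S. h' p * gamma_relator p) = 2 * i"
    using insert.IH[of h'] insert.prems by blast
  have "(\<Sum>p\<in>insert q S. h p * gamma_relator p) =
      h q * gamma_relator q + (\<Sum>p\<in>S. h p * gamma_relator p)"
    using insert.hyps by simp
  also have "(\<Sum>p\<in>S. h p * gamma_relator p) =
      2 * i - gamma_relator q * (\<Sum>p\<in>S. a p * gamma_relator p)"
    unfolding i(2)[symmetric] h'_def distrib_right sum.distrib sum_distrib_left
    by (simp only: mult_ac add_diff_cancel_right')
  also have "(\<Sum>p\<in>S. a p * gamma_relator p) = (h q - 2 * b) + 2 * (\<Sum>p\<in>S. a p * t p)"
    unfolding ab rel distrib_left sum.distrib sum_distrib_left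
    by (simp only: add_diff_cancel_right' mult_ac)
  also have "h q * gamma_relator q +
      (2 * i - gamma_relator q * (h q - 2 * b + 2 * (\<Sum>p\<in>S. a p * t p))) =
      2 * (i + (b - (\<Sum>p\<in>S. a p * t p)) * gamma_relator q)"
    by (simp add: algebra_simps)
  finally have "(\<Sum>p\<in>insert q S. h p * gamma_relator p) =
      2 * (i + (b - (\<Sum>p\<in>S. a p * t p)) * gamma_relator q)" .
  moreover have "i + (b - (\<Sum>p\<in>S. a p * t p)) * gamma_relator q \<in> gamma_ideal"
    using insert.prems i(1) by (auto intro!: gamma_ideal_add gamma_ideal_mult gamma_relator_in_ideal)
  ultimately show ?case by blast
qed

lemma gamma_ideal_combination:
  assumes "a \<in> gamma_ideal"
  shows "\<exists>N h. a = (\<Sum>p = 1..N. h p * gamma_relator p)"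
proof -
  have "a \<in> module.span (*) {gamma_relator p | p. p \<ge> 1}"
    using assms by (simp only: gamma_ideal_def)
  then show ?thesis
  proof (induction rule: ring_module.span_induct_alt)
    case base
    show ?case by (intro exI[of _ 0]) simp
  next
    case (step r x y)
    then obtain p N h where p: "x = gamma_relator p" "p \<ge> 1"
      and y: "y = (\<Sum>p = 1..N. h p * gamma_relator p)" by blast
    define h' where "h' i = (if i = p then r else 0) + (if i \<le> N then h i else 0)" for i
    have "(\<Sum>i = 1..max N p. (if i \<le> N then h i else 0) * gamma_relator i) = y"
      unfolding y by (rule sum.mono_neutral_cong_right) auto
    moreover have "(\<Sum>i = 1..max N p. (if i = p then r else 0) * gamma_relator i) = r * x"
      using p by (simp add: if_distrib[of "\<lambda>z. z * _"] cong: if_cong)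
    ultimately have "r * x + y = (\<Sum>i = 1..max N p. h' i * gamma_relator i)"
      by (simp add: h'_def distrib_right sum.distrib)
    then show ?case by blast
  qed
qed

lemma int_poly_two_cancel:
  fixes f g :: "'m::monoid_add \<Rightarrow>\<^sub>0 int"
  assumes "2 * f = 2 * g"
  shows "f = g"
proof (rule poly_mapping_eqI)
  fix m
  show "Poly_Mapping.lookup f m = Poly_Mapping.lookup g m"
    using arg_cong[OF assms, of "\<lambda>f. Poly_Mapping.lookup f m"] by (simp add: lookup_two_times)
qed

lemma gamma_ideal_two_saturated:
  assumes "2 * g \<in> gamma_ideal"
  shows "g \<in> gamma_ideal"
proof -
  obtain N h where h: "2 * g = (\<Sum>p = 1..N. h p * gamma_relator p)"
    using gamma_ideal_combination[OF assms] by blast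
  let ?t = "\<lambda>p. \<Sum>i = 1..p. (- 1) ^ i * pre_c (p + i) * pre_c (p - i)"
  have "(\<Sum>p = 1..N. h p * (pre_c p)\<^sup>2) = 2 * (g - (\<Sum>p = 1..N. h p * ?t p))"
    unfolding right_diff_distrib h
    by (simp add: gamma_relator_def distrib_left sum.distrib sum_distrib_left mult_ac)
  from even_relator_combination[OF _ _ this] have "\<exists>i\<in>gamma_ideal. 2 * g = 2 * i"
    unfolding h by auto
  then show ?thesis using int_poly_two_cancel by blast
qed

theorem gamma_two_torsion_free:
  fixes g :: gamma
  assumes "2 * g = 0"
  shows "g = 0"
proof -
  obtain a where a: "g = abs_gamma a"
    by (metis Quotient3_abs_rep Quotient3_gamma)
  have eq: "abs_gamma x = 0 \<longleftrightarrow> x \<in> gamma_ideal" for x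
    using gamma.abs_eq_iff[of x 0] by (simp add: gamma_rel_def zero_gamma_def)
  have "abs_gamma (2 * a) = 0"
    using assms by (simp add: a ring_hom_simps[OF ring_hom_abs_gamma])
  then show ?thesis
    using gamma_ideal_two_saturated by (simp add: a eq)
qed

section \<open>Complex points separate the elements of \<open>\<Gamma>\<close>\<close>

text \<open>A polynomial function that vanishes identically has no coefficients: fix all variables but one
  and use that a polynomial in one variable over an infinite field has finitely many zeros.\<close>

lemma monomials_independent:
  fixes a :: "(nat \<Rightarrow>\<^sub>0 nat) \<Rightarrow> complex"
  assumes "finite S" "finite M"
    and "\<And>m m'. m \<in> M \<Longrightarrow> m' \<in> M \<Longrightarrow>
      (\<forall>k\<in>S. Poly_Mapping.lookup m k = Poly_Mapping.lookup m' k) \<Longrightarrow> m = m'"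
    and "\<And>z. (\<Sum>m\<in>M. a m * (\<Prod>k\<in>S. z k ^ Poly_Mapping.lookup m k)) = 0"
    and "m \<in> M"
  shows "a m = 0"
  using assms
proof (induction S arbitrary: M rule: finite_induct)
  case empty
  then have "M = {m}" by blast
  then show ?case using empty.prems(3) by simp
next
  case (insert q S)
  define N where "N = {m'\<in>M. Poly_Mapping.lookup m' q = Poly_Mapping.lookup m q}"
  have zero: "(\<Sum>m'\<in>N. a m' * (\<Prod>k\<in>S. z k ^ Poly_Mapping.lookup m' k)) = 0" for z
  proof -
    let ?b = "\<lambda>m'. a m' * (\<Prod>k\<in>S. z k ^ Poly_Mapping.lookup m' k)"
    define P where "P = (\<Sum>m'\<in>M. monom (?b m') (Poly_Mapping.lookup m' q))"
    have "poly P w = 0" for w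
    proof -
      have "(\<Prod>k\<in>S. (z(q := w)) k ^ Poly_Mapping.lookup m' k) =
          (\<Prod>k\<in>S. z k ^ Poly_Mapping.lookup m' k)" for m'
        using insert.hyps by (intro prod.cong) auto
      then show ?thesis
        using insert.prems(3)[of "z(q := w)"] insert.hyps
        by (simp add: P_def poly_sum poly_monom mult_ac)
    qed
    then have "P = 0" by (simp add: poly_all_0_iff_0[symmetric])
    then have "coeff P (Poly_Mapping.lookup m q) = 0" by simp
    then have "(\<Sum>m'\<in>M. if Poly_Mapping.lookup m' q = Poly_Mapping.lookup m q then ?b m' else 0) = 0"
      by (simp add: P_def coeff_sum)
    then show ?thesis
      unfolding N_def sum.inter_filter[OF insert.prems(1)] .
  qed
  show ?case
  proof (rule insert.IH)
    show "finite N" "m \<in> N" using insert.prems by (auto simp: N_def)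
    show "m1 = m2" if "m1 \<in> N" "m2 \<in> N"
      "\<forall>k\<in>S. Poly_Mapping.lookup m1 k = Poly_Mapping.lookup m2 k" for m1 m2
      using that by (intro insert.prems(2)) (auto simp: N_def)
  qed (rule zero)
qed

text \<open>Polynomials in the generators with odd subscript; these are the variables of even index.\<close>

definition odd_poly :: "((nat \<Rightarrow>\<^sub>0 nat) \<Rightarrow>\<^sub>0 int) \<Rightarrow> bool"
  where "odd_poly Q \<longleftrightarrow> (\<forall>m\<in>Poly_Mapping.keys Q. \<forall>v\<in>Poly_Mapping.keys m. even v)"

lemma odd_poly_of_int: "odd_poly (of_int k)"
  by (auto simp: odd_poly_def in_keys_iff lookup_of_int when_def split: if_splits)

lemma odd_poly_Var: "even v \<Longrightarrow> odd_poly (Var v)"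
  by (simp add: odd_poly_def Var_def)

lemma odd_poly_add: "odd_poly P \<Longrightarrow> odd_poly Q \<Longrightarrow> odd_poly (P + Q)"
  using keys_add[of P Q] by (auto simp: odd_poly_def)

lemma odd_poly_mult: "odd_poly P \<Longrightarrow> odd_poly Q \<Longrightarrow> odd_poly (P * Q)"
  unfolding odd_poly_def
proof (intro ballI)
  fix m v
  assume odd: "\<forall>m\<in>Poly_Mapping.keys P. \<forall>v\<in>Poly_Mapping.keys m. even v"
    "\<forall>m\<in>Poly_Mapping.keys Q. \<forall>v\<in>Poly_Mapping.keys m. even v"
    and m: "m \<in> Poly_Mapping.keys (P * Q)" and v: "v \<in> Poly_Mapping.keys m"
  obtain a b where "m = a + b" "a \<in> Poly_Mapping.keys P" "b \<in> Poly_Mapping.keys Q"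
    using m keys_mult[of P Q] by blast
  then show "even v"
    using odd v keys_add[of a b] by blast
qed

lemma gamma_point_abs_gamma: "gamma_point (\<lambda>p. abs_gamma (pre_c p))"
proof -
  note hom = ring_hom_simps[OF ring_hom_abs_gamma]
  have "abs_gamma (gamma_relator p) = 0" if "p \<ge> 1" for p
    using gamma.abs_eq_iff[of "gamma_relator p" 0] gamma_relator_in_ideal[OF that]
    by (simp add: gamma_rel_def zero_gamma_def)
  then show ?thesis
    by (simp add: gamma_point_def gamma_relator_def hom pre_c_def[of 0])
qed

text \<open>In the relation for \<open>p\<close> the generator with subscript \<open>2p\<close> has coefficient \<open>\<plusminus>2\<close>. Once 2 is
  inverted, the generators with even subscript can therefore be eliminated recursively.\<close>

lemma gamma_odd_generators: "\<exists>k Q. odd_poly Q \<and> 2 ^ k * g = abs_gamma Q"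
proof -
  note hom = ring_hom_simps[OF ring_hom_abs_gamma] ring_hom_of_int[OF ring_hom_abs_gamma]
  define R where "R = abs_gamma ` Collect odd_poly"
  have R_int: "of_int k \<in> R" for k
    unfolding R_def using odd_poly_of_int[of k]
    by (intro image_eqI[of _ _ "of_int k"]) (simp_all add: hom)
  have R_add: "f + h \<in> R" and R_mult: "f * h \<in> R" if "f \<in> R" "h \<in> R" for f h
  proof -
    from that obtain P Q where "f = abs_gamma P" "h = abs_gamma Q" "odd_poly P" "odd_poly Q"
      unfolding R_def by blast
    then show "f + h \<in> R" "f * h \<in> R"
      unfolding R_def
      by (metis hom(3) imageI mem_Collect_eq odd_poly_add,
          metis hom(4) imageI mem_Collect_eq odd_poly_mult)
  qed
  have R_two: "2 ^ k \<in> R" for k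
    using R_int[of "2 ^ k"] by simp
  define D where "D = {f. \<exists>k. 2 ^ k * f \<in> R}"
  have RD: "f \<in> D" if "f \<in> R" for f
    using that unfolding D_def by (intro CollectI exI[of _ 0]) simp
  have D_add: "f + h \<in> D" and D_mult: "f * h \<in> D" if "f \<in> D" "h \<in> D" for f h
  proof -
    from that obtain k l where kl: "2 ^ k * f \<in> R" "2 ^ l * h \<in> R"
      unfolding D_def by blast
    have "2 ^ (k + l) * (f + h) = 2 ^ l * (2 ^ k * f) + 2 ^ k * (2 ^ l * h)"
      "2 ^ (k + l) * (f * h) = (2 ^ k * f) * (2 ^ l * h)"
      by (simp_all add: power_add algebra_simps)
    then show "f + h \<in> D" "f * h \<in> D"
      unfolding D_def using kl R_add R_mult R_two by (metis (mono_tags) mem_Collect_eq)+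
  qed
  have D_half: "f \<in> D" if "2 * f \<in> D" for f
  proof -
    from that obtain k where "2 ^ k * (2 * f) \<in> R" unfolding D_def by blast
    then have "2 ^ Suc k * f \<in> R" by (simp add: mult_ac)
    then show ?thesis unfolding D_def by blast
  qed
  have D_uminus: "- f \<in> D" if "f \<in> D" for f
    using D_mult[OF RD[OF R_int[of "- 1"]] that] by simp
  have D_sum: "(\<Sum>i\<in>A. F i) \<in> D" if "\<And>i. i \<in> A \<Longrightarrow> F i \<in> D" for A :: "nat set" and F
    using that RD[OF R_int[of 0]]
    by (induction A rule: infinite_finite_induct) (simp_all add: D_add)
  define c where "c p = abs_gamma (pre_c p)" for p
  have c: "c p \<in> D" for p
  proof (induction p rule: less_induct)
    case (less p)
    consider "p = 0" | "odd p" | m where "p = 2 * m" "m \<ge> 1"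
      by (cases "p = 0"; cases "odd p") (auto elim!: evenE)
    then show ?case
    proof cases
      case 1
      then show ?thesis using RD[OF R_int[of 1]] by (simp add: c_def pre_c_def hom)
    next
      case 2
      then have "c p = abs_gamma (Var (p - 1))" "odd_poly (Var (p - 1))"
        by (auto simp: c_def pre_c_def odd_poly_Var odd_pos)
      then show ?thesis using RD unfolding R_def by blast
    next
      case 3
      have "(c m)\<^sup>2 + 2 * (\<Sum>i = 1..m. (- 1) ^ i * c (m + i) * c (m - i)) = 0"
        using gamma_point_abs_gamma 3 unfolding gamma_point_def c_def by blast
      moreover have "(\<Sum>i = 1..m. (- 1) ^ i * c (m + i) * c (m - i)) =
          (\<Sum>i = 1..<m. (- 1) ^ i * c (m + i) * c (m - i)) + (- 1) ^ m * c p"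
      proof -
        have "{1..m} = insert m {1..<m}" using 3 by auto
        moreover have "c (m - m) = 1" by (simp add: c_def pre_c_def hom)
        ultimately show ?thesis using 3 by (simp add: mult_2)
      qed
      ultimately have "(- 1) ^ m * (2 * c p) =
          - (c m * c m + 2 * (\<Sum>i = 1..<m. (- 1) ^ i * c (m + i) * c (m - i)))"
        by (simp add: eq_neg_iff_add_eq_0 algebra_simps power2_eq_square)
      then have "2 * c p = (- 1) ^ m *
          - (c m * c m + 2 * (\<Sum>i = 1..<m. (- 1) ^ i * c (m + i) * c (m - i)))"
        by (metis (no_types) left_minus_one_mult_self)
      moreover have "(- 1) ^ k \<in> D" for k
        using RD[OF R_int[of "(- 1) ^ k"]] by simp
      moreover have "2 \<in> D"
        using RD[OF R_int[of 2]] by simp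
      moreover have "c (m + i) \<in> D" "c (m - i) \<in> D" if "i \<in> {1..<m}" for i
        using that 3 by (auto intro: less)
      moreover have "c m \<in> D"
        using 3 by (auto intro: less)
      ultimately have "2 * c p \<in> D"
        by (simp only: D_mult D_uminus D_add D_sum)
      then show ?thesis by (rule D_half)
    qed
  qed
  have "g \<in> D"
    using c RD[OF R_int] by (induction g rule: gamma_induct) (auto simp: c_def D_add D_mult)
  then show ?thesis unfolding D_def R_def by auto
qed

text \<open>The same elimination over the complex numbers: the coordinates of odd subscript can be chosen
  freely, and the relations then determine the others.\<close>

function complete_point :: "(nat \<Rightarrow> complex) \<Rightarrow> nat \<Rightarrow> complex" where
  "complete_point z n = (if n = 0 then 1 else if odd n then z n else
    - ((- 1) ^ (n div 2)) * ((complete_point z (n div 2))\<^sup>2 / 2 +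
      (\<Sum>i\<in>{1..<n div 2}.
        (- 1) ^ i * complete_point z (n div 2 + i) * complete_point z (n div 2 - i))))"
  by auto
termination
  by (relation "measure snd") auto

declare complete_point.simps [simp del]

lemma gamma_point_complete_point: "gamma_point (complete_point z)"
  unfolding gamma_point_def
proof (intro conjI allI impI)
  let ?c = "complete_point z"
  show "?c 0 = 1" by (simp add: complete_point.simps)
  fix p :: nat assume p: "p \<ge> 1"
  define s where "s = (?c p)\<^sup>2 / 2 + (\<Sum>i\<in>{1..<p}. (- 1) ^ i * ?c (p + i) * ?c (p - i))"
  have "{1..p} = insert p {1..<p}" using p by auto
  then have "(\<Sum>i = 1..p. (- 1) ^ i * ?c (p + i) * ?c (p - i)) =
      (- 1) ^ p * ?c (2 * p) + (s - (?c p)\<^sup>2 / 2)"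
    using complete_point.simps[of z 0] by (simp add: s_def mult_2)
  moreover have "?c (2 * p) = - ((- 1) ^ p) * s"
    using p by (subst complete_point.simps) (simp add: s_def)
  ultimately show "(?c p)\<^sup>2 + 2 * (\<Sum>i = 1..p. (- 1) ^ i * ?c (p + i) * ?c (p - i)) = 0"
    by simp
qed

text \<open>
  A power of 2 times \<open>g\<close> is a polynomial in the generators of odd subscript. These take arbitrary
  values at complex points, so the polynomial is 0, and \<open>g = 0\<close> because 2 is a nonzerodivisor.
\<close>

theorem gamma_eq_zeroI:
  fixes g :: gamma
  assumes "\<And>c :: nat \<Rightarrow> complex. gamma_point c \<Longrightarrow> gamma_hom c g = 0"
  shows "g = 0"
proof -
  obtain k Q where Q: "odd_poly Q" "2 ^ k * g = abs_gamma Q"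
    using gamma_odd_generators by blast
  define S where "S = (\<Union>m\<in>Poly_Mapping.keys Q. Poly_Mapping.keys m)"
  have S: "finite S" "Poly_Mapping.keys m \<subseteq> S" if "m \<in> Poly_Mapping.keys Q" for m
    using that by (auto simp: S_def)
  have "(of_int (Poly_Mapping.lookup Q m) :: complex) = 0" if m: "m \<in> Poly_Mapping.keys Q" for m
  proof (rule monomials_independent[of S "Poly_Mapping.keys Q"
        "\<lambda>m. of_int (Poly_Mapping.lookup Q m)"])
    show "m1 = m2" if "m1 \<in> Poly_Mapping.keys Q" "m2 \<in> Poly_Mapping.keys Q"
      "\<forall>k\<in>S. Poly_Mapping.lookup m1 k = Poly_Mapping.lookup m2 k" for m1 m2
    proof (rule poly_mapping_eqI)
      fix v
      show "Poly_Mapping.lookup m1 v = Poly_Mapping.lookup m2 v"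
      proof (cases "v \<in> S")
        case False
        then have "v \<notin> Poly_Mapping.keys m1" "v \<notin> Poly_Mapping.keys m2" using S that by auto
        then show ?thesis by (simp add: in_keys_iff)
      qed (use that in auto)
    qed
  next
    fix z :: "nat \<Rightarrow> complex"
    define c where "c = complete_point (\<lambda>n. z (n - 1))"
    have c: "gamma_point c" unfolding c_def by (rule gamma_point_complete_point)
    have "int_eval c Q = gamma_hom c (2 ^ k * g)"
      unfolding Q using gamma_hom_abs_gamma[OF c] by simp
    also have "\<dots> = 0"
      using assms[OF c] by (simp add: ring_hom_simps[OF ring_hom_gamma_hom[OF c]])
    finally have "int_eval c Q = 0" .
    moreover have "monom_eval (\<lambda>k. c (Suc k)) m = (\<Prod>v\<in>S. z v ^ Poly_Mapping.lookup m v)"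
      if m: "m \<in> Poly_Mapping.keys Q" for m
    proof -
      have "c (Suc v) = z v" if "v \<in> Poly_Mapping.keys m" for v
        using Q(1) m that by (subst c_def, subst complete_point.simps) (simp add: odd_poly_def)
      then have "monom_eval (\<lambda>k. c (Suc k)) m = monom_eval z m"
        by (simp add: monom_eval_def)
      then show ?thesis using monom_eval_superset S[OF m] by metis
    qed
    ultimately show "(\<Sum>m\<in>Poly_Mapping.keys Q. of_int (Poly_Mapping.lookup Q m) *
        (\<Prod>v\<in>S. z v ^ Poly_Mapping.lookup m v)) = 0"
      by (simp add: int_eval_def poly_eval_def)
  qed (use S m in auto)
  then have "Q = 0"
    by (intro poly_mapping_eqI) (auto simp: in_keys_iff)
  then have "2 ^ k * g = 0"
    using Q by (simp add: ring_hom_zero[OF ring_hom_abs_gamma])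
  then show ?thesis
    by (induction k) (use gamma_two_torsion_free in \<open>auto simp: mult.assoc\<close>)
qed

lemma gamma_hom_gen:
  assumes "gamma_point c"
  shows "gamma_hom c (abs_gamma (pre_c p)) = c p"
  using assms by (simp add: gamma_hom_abs_gamma int_eval_pre_c gamma_point_def)

lemma gamma_hom_finite_dependence:
  "\<exists>N. \<forall>c d :: nat \<Rightarrow> 'b::comm_ring_1. gamma_point c \<longrightarrow> gamma_point d \<longrightarrow>
    (\<forall>p\<le>N. c p = d p) \<longrightarrow> gamma_hom c g = gamma_hom d g"
proof (induction g rule: gamma_induct)
  case (int k)
  then show ?case by (simp add: ring_hom_of_int ring_hom_gamma_hom)
next
  case (gen p)
  then show ?case by (intro exI[of _ p]) (simp add: gamma_hom_gen)
next
  case (add f g)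
  then obtain M N where
    "\<And>c d :: nat \<Rightarrow> 'b. gamma_point c \<Longrightarrow> gamma_point d \<Longrightarrow> (\<forall>p\<le>M. c p = d p) \<Longrightarrow>
      gamma_hom c f = gamma_hom d f"
    "\<And>c d :: nat \<Rightarrow> 'b. gamma_point c \<Longrightarrow> gamma_point d \<Longrightarrow> (\<forall>p\<le>N. c p = d p) \<Longrightarrow>
      gamma_hom c g = gamma_hom d g" by blast
  then have "gamma_hom c f = gamma_hom d f \<and> gamma_hom c g = gamma_hom d g"
    if "gamma_point c" "gamma_point d" "\<forall>p\<le>max M N. c p = d p" for c d :: "nat \<Rightarrow> 'b"
    using that by (metis max.coboundedI1 max.coboundedI2)
  then show ?case
    by (intro exI[of _ "max M N"] allI impI) (simp only: ring_hom_add[OF ring_hom_gamma_hom])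
next
  case (mult f g)
  then obtain M N where
    "\<And>c d :: nat \<Rightarrow> 'b. gamma_point c \<Longrightarrow> gamma_point d \<Longrightarrow> (\<forall>p\<le>M. c p = d p) \<Longrightarrow>
      gamma_hom c f = gamma_hom d f"
    "\<And>c d :: nat \<Rightarrow> 'b. gamma_point c \<Longrightarrow> gamma_point d \<Longrightarrow> (\<forall>p\<le>N. c p = d p) \<Longrightarrow>
      gamma_hom c g = gamma_hom d g" by blast
  then have "gamma_hom c f = gamma_hom d f \<and> gamma_hom c g = gamma_hom d g"
    if "gamma_point c" "gamma_point d" "\<forall>p\<le>max M N. c p = d p" for c d :: "nat \<Rightarrow> 'b"
    using that by (metis max.coboundedI1 max.coboundedI2)
  then show ?case
    by (intro exI[of _ "max M N"] allI impI) (simp only: ring_hom_mult[OF ring_hom_gamma_hom])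
qed

text \<open>
  The value of \<open>f\<close> at a point depends on finitely many coordinates only, and up to any finite order
  every complex point arises from the trivial one by twists. So \<open>f\<close> takes the same value at all
  complex points.
\<close>

theorem twist_invariant_constant:
  fixes f :: gamma
  assumes inv: "\<And>(c :: nat \<Rightarrow> complex) x. gamma_point c \<Longrightarrow> gamma_hom (twist x c) f = gamma_hom c f"
  shows "f = of_int (gamma_hom trivial_point f)"
proof -
  let ?k = "gamma_hom trivial_point f :: int"
  have triv: "gamma_hom trivial_point f = (of_int ?k :: complex)"
    by (induction f rule: gamma_induct)
      (simp_all add: ring_hom_of_int ring_hom_add ring_hom_mult ring_hom_gamma_hom
        gamma_point_trivial gamma_hom_gen)
  have "gamma_hom c (f - of_int ?k) = 0" if c: "gamma_point c" for c :: "nat \<Rightarrow> complex"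
  proof -
    obtain N where N: "\<And>c d :: nat \<Rightarrow> complex. gamma_point c \<Longrightarrow> gamma_point d \<Longrightarrow>
        (\<forall>p\<le>N. c p = d p) \<Longrightarrow> gamma_hom c f = gamma_hom d f"
      using gamma_hom_finite_dependence by blast
    obtain xs where xs: "\<forall>p\<le>N. c p = foldr twist xs trivial_point p"
      using complex_gamma_point_approx[OF c] by blast
    have pt: "gamma_point (foldr twist xs trivial_point)" for xs :: "complex list"
      by (induction xs) (simp_all add: gamma_point_trivial gamma_point_twist)
    have "gamma_hom (foldr twist xs trivial_point) f = gamma_hom trivial_point f" for xs :: "complex list"
      by (induction xs) (simp_all add: inv pt)
    then have "gamma_hom c f = gamma_hom trivial_point f"
      using N[OF c pt xs] by simp
    then show ?thesis
      using triv by (simp add: ring_hom_diff ring_hom_of_int ring_hom_gamma_hom c)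
  qed
  then have "f - of_int ?k = 0" by (rule gamma_eq_zeroI)
  then show ?thesis by simp
qed

section \<open>Simple reflections and divided differences\<close>

lemma gamma_point_cgen: "gamma_point cgen"
  using gamma_point_hom[OF ring_hom_Const gamma_point_abs_gamma]
  by (simp add: cgen_def[abs_def])

lemma cgen_0: "cgen 0 = 1"
  using gamma_point_cgen by (simp add: gamma_point_def)

lemma cgen_upd_0: "cgen(0 := 1) = cgen"
  by (simp add: cgen_0 fun_upd_idem)

lemma s_act_0_eq:
  "s_act 0 = gamma_xy_hom (twist (xvar 1) cgen) (\<lambda>j. if j = 1 then - xvar 1 else xvar j) yvar"
  by (simp add: s_act_def twist_def[abs_def])

lemma twist_cgen_upd_0: "(twist x cgen)(0 := 1) = twist x cgen"
  by (simp add: cgen_0 fun_upd_idem)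

lemma ring_hom_s_act: "ring_hom (s_act i)"
proof (cases "i = 0")
  case True
  then show ?thesis
    unfolding True s_act_0_eq
    by (intro ring_hom_gamma_xy_hom) (simp add: twist_cgen_upd_0 gamma_point_twist gamma_point_cgen)
next
  case False
  then show ?thesis
    by (simp add: s_act_def ring_hom_gamma_xy_hom cgen_upd_0 gamma_point_cgen)
qed

lemma s_act_0_c: "s_act 0 (cgen p) = twist (xvar 1) cgen p"
proof (cases "p = 0")
  case True
  then show ?thesis by (simp add: cgen_0 ring_hom_one[OF ring_hom_s_act])
next
  case False
  then show ?thesis
    unfolding s_act_0_eq
    by (subst gamma_xy_hom_c) (simp_all add: twist_cgen_upd_0 gamma_point_twist gamma_point_cgen)
qed

lemma s_act_c: "i \<ge> 1 \<Longrightarrow> s_act i (cgen p) = cgen p"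
  by (cases "p = 0") (simp_all add: cgen_0 ring_hom_one[OF ring_hom_s_act],
      simp add: s_act_def gamma_xy_hom_c cgen_upd_0 gamma_point_cgen)

lemma s_act_0_x: "j \<ge> 1 \<Longrightarrow> s_act 0 (xvar j) = (if j = 1 then - xvar 1 else xvar j)"
  unfolding s_act_0_eq
  by (subst gamma_xy_hom_x) (simp_all add: twist_cgen_upd_0 gamma_point_twist gamma_point_cgen)

lemma s_act_x: "i \<ge> 1 \<Longrightarrow> j \<ge> 1 \<Longrightarrow> s_act i (xvar j) = xvar (transpose i (i + 1) j)"
  by (simp add: s_act_def gamma_xy_hom_x cgen_upd_0 gamma_point_cgen)

lemma s_act_y: "j \<ge> 1 \<Longrightarrow> s_act i (yvar j) = yvar j"
proof (cases "i = 0")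
  case True
  assume "j \<ge> 1"
  then show ?thesis
    unfolding True s_act_0_eq
    by (subst gamma_xy_hom_y) (simp_all add: twist_cgen_upd_0 gamma_point_twist gamma_point_cgen)
next
  case False
  assume "j \<ge> 1"
  then show ?thesis using False
    by (simp add: s_act_def gamma_xy_hom_y cgen_upd_0 gamma_point_cgen)
qed

lemmas s_act_simps = ring_hom_simps[OF ring_hom_s_act]
lemmas s_act_gen = s_act_0_c s_act_c s_act_0_x s_act_x s_act_y

lemma s_act_twist: "s_act i (twist x c p) = twist (s_act i x) (\<lambda>p. s_act i (c p)) p"
  by (rule ring_hom_twist[OF ring_hom_s_act])

lemma s_act_twist_cgen: "(\<lambda>p. s_act 0 (cgen p)) = twist (xvar 1) cgen"
  by (simp add: s_act_0_c fun_eq_iff)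

lemma transpose_ge_1: "i \<ge> 1 \<Longrightarrow> j \<ge> 1 \<Longrightarrow> transpose i (i + 1) j \<ge> (1::nat)"
  by (simp add: transpose_def)

lemma s_act_s_act: "s_act i (s_act i f) = f"
proof (rule gamma_xy_hom_eqI[OF ring_hom_comp[OF ring_hom_s_act ring_hom_s_act] ring_hom_id])
  fix p :: nat assume "p \<ge> 1"
  show "s_act i (s_act i (cgen p)) = cgen p"
  proof (cases "i = 0")
    case True
    then show ?thesis
      by (simp add: s_act_0_c s_act_twist s_act_twist_cgen s_act_0_x twist_uminus_twist)
  next
    case False
    then show ?thesis by (simp add: s_act_c)
  qed
next
  fix j :: nat assume j: "j \<ge> 1"
  show "s_act i (s_act i (xvar j)) = xvar j"
  proof (cases "i = 0")
    case True
    then show ?thesis using j by (simp add: s_act_0_x s_act_simps)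
  next
    case False
    then have i: "i \<ge> 1" by simp
    show ?thesis
      using s_act_x[OF i j] s_act_x[OF i transpose_ge_1[OF i j]] by simp
  qed
  show "s_act i (s_act i (yvar j)) = yvar j"
    using j by (simp add: s_act_y)
qed

text \<open>The denominators of the divided differences; up to normalisation they are the simple roots of
  type C.\<close>

definition simple_root :: "nat \<Rightarrow> gamma_xy"
  where "simple_root i = (if i = 0 then - 2 * xvar 1 else xvar i - xvar (i + 1))"

lemma s_act_root: "s_act i (simple_root i) = - simple_root i"
  by (cases "i = 0") (simp_all add: simple_root_def s_act_simps s_act_0_x s_act_x)

definition nonzerodivisor :: "'r::comm_ring_1 \<Rightarrow> bool"
  where "nonzerodivisor a \<longleftrightarrow> (\<forall>z. a * z = 0 \<longrightarrow> z = 0)"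

lemma nonzerodivisor_mult: "nonzerodivisor a \<Longrightarrow> nonzerodivisor b \<Longrightarrow> nonzerodivisor (a * b)"
  unfolding nonzerodivisor_def mult.assoc by blast

lemma nonzerodivisor_uminus: "nonzerodivisor a \<Longrightarrow> nonzerodivisor (- a)"
  by (simp add: nonzerodivisor_def)

lemma nonzerodivisor_cancel: "nonzerodivisor a \<Longrightarrow> a * f = a * g \<Longrightarrow> f = g"
  by (metis nonzerodivisor_def right_diff_distrib right_minus_eq)

lemma nonzerodivisor_hom:
  assumes "ring_hom \<phi>" "ring_hom \<psi>" "\<And>f. \<psi> (\<phi> f) = f" "nonzerodivisor (\<phi> a)"
  shows "nonzerodivisor a"
  unfolding nonzerodivisor_def
proof (intro allI impI)
  fix z assume "a * z = 0"
  then have "\<phi> a * \<phi> z = 0" using assms(1) by (metis ring_hom_mult ring_hom_zero)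
  then have "\<phi> z = 0" using assms(4) by (simp add: nonzerodivisor_def)
  then show "z = 0" using assms(2,3) by (metis ring_hom_zero)
qed

lemma nonzerodivisor_Var: "nonzerodivisor (Var v :: ('v \<Rightarrow>\<^sub>0 nat) \<Rightarrow>\<^sub>0 'a::comm_ring_1)"
  unfolding nonzerodivisor_def
proof (intro allI impI poly_mapping_eqI)
  fix z :: "('v \<Rightarrow>\<^sub>0 nat) \<Rightarrow>\<^sub>0 'a" and m
  assume "Var v * z = 0"
  then have "z * Poly_Mapping.single (Poly_Mapping.single v 1) 1 = 0"
    by (simp add: Var_def mult.commute)
  then show "Poly_Mapping.lookup z m = Poly_Mapping.lookup 0 m"
    using lookup_mult_single_add[of z "Poly_Mapping.single v 1" m] by simp
qed

lemma nonzerodivisor_two: "nonzerodivisor (2 :: gamma_xy)"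
  unfolding nonzerodivisor_def
proof (intro allI impI poly_mapping_eqI)
  fix z :: gamma_xy and m
  assume "2 * z = 0"
  then have "2 * Poly_Mapping.lookup z m = 0"
    using lookup_two_times[of z m] by simp
  then show "Poly_Mapping.lookup z m = Poly_Mapping.lookup 0 m"
    using gamma_two_torsion_free by simp
qed

text \<open>The automorphism \<open>x\<^sub>i \<mapsto> x\<^sub>i + x\<^bsub>i+1\<^esub>\<close> turns \<open>x\<^sub>i - x\<^bsub>i+1\<^esub>\<close> into the variable \<open>x\<^sub>i\<close>. For
  \<open>2 x\<^sub>1\<close> the claim comes from the absence of 2-torsion in \<open>\<Gamma>\<close>.\<close>

lemma nonzerodivisor_root: "nonzerodivisor (simple_root i)"
proof (cases "i = 0")
  case True
  have "nonzerodivisor (2 * xvar 1)"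
    unfolding xvar_def by (intro nonzerodivisor_mult nonzerodivisor_two nonzerodivisor_Var)
  then show ?thesis
    using True nonzerodivisor_uminus by (fastforce simp: simple_root_def)
next
  case False
  \<comment> \<open>The parameter \<open>e\<close> is 1 for the automorphism and \<open>-1\<close> for its inverse.\<close>
  define \<phi> where "\<phi> e = gamma_xy_hom cgen (\<lambda>j. if j = i then xvar i + e * xvar (i + 1) else xvar j) yvar"
    for e :: gamma_xy
  have hom: "ring_hom (\<phi> e)" for e
    unfolding \<phi>_def by (intro ring_hom_gamma_xy_hom) (simp add: cgen_upd_0 gamma_point_cgen)
  have c: "\<phi> e (cgen p) = cgen p" if "p \<ge> 1" for e p
    using that unfolding \<phi>_def
    by (subst gamma_xy_hom_c) (simp_all add: cgen_upd_0 gamma_point_cgen)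
  have x: "\<phi> e (xvar j) = (if j = i then xvar i + e * xvar (i + 1) else xvar j)" if "j \<ge> 1" for e j
    using that unfolding \<phi>_def
    by (subst gamma_xy_hom_x) (simp_all add: cgen_upd_0 gamma_point_cgen)
  have y: "\<phi> e (yvar j) = yvar j" if "j \<ge> 1" for e j
    using that unfolding \<phi>_def
    by (subst gamma_xy_hom_y) (simp_all add: cgen_upd_0 gamma_point_cgen)
  have "\<phi> (- 1) (\<phi> 1 f) = f" for f
    by (rule gamma_xy_hom_eqI[OF ring_hom_comp[OF hom hom] ring_hom_id])
      (use False in \<open>simp_all add: c x y ring_hom_simps[OF hom]\<close>)
  moreover have "\<phi> 1 (simple_root i) = Var (XVar (i - 1))"
    using False by (simp add: simple_root_def x ring_hom_simps[OF hom]) (simp add: xvar_def)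
  ultimately show ?thesis
    using nonzerodivisor_hom[OF hom hom, of "- 1" 1 "simple_root i"] nonzerodivisor_Var by metis
qed

text \<open>The elements \<open>f\<close> with divisible difference form a subring by the Leibniz rule, so it suffices
  to look at generators.\<close>

lemma root_dvd: "simple_root i dvd f - s_act i f"
proof (induction f rule: gamma_xy_induct)
  case (int k)
  then show ?case by (simp add: ring_hom_of_int[OF ring_hom_s_act])
next
  case (c p)
  show ?case
  proof (cases "i = 0")
    case True
    have "(\<Sum>j = 1..p. xvar 1 ^ j * cgen (p - j)) =
        xvar 1 * (\<Sum>j = 1..p. xvar 1 ^ (j - 1) * cgen (p - j))"
      unfolding sum_distrib_left
    proof (rule sum.cong[OF refl])
      fix j assume "j \<in> {1..p}"
      then have "xvar 1 ^ j = xvar 1 * xvar 1 ^ (j - 1)"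
        by (cases j) simp_all
      then show "xvar 1 ^ j * cgen (p - j) = xvar 1 * (xvar 1 ^ (j - 1) * cgen (p - j))"
        by (simp add: mult.assoc)
    qed
    then have "cgen p - s_act i (cgen p) =
        simple_root i * (\<Sum>j = 1..p. xvar 1 ^ (j - 1) * cgen (p - j))"
      by (simp add: True s_act_0_c twist_def simple_root_def mult.assoc)
    then show ?thesis by simp
  qed (simp add: s_act_c)
next
  case (x j)
  then have "xvar j - s_act i (xvar j) \<in> {0, simple_root i, simple_root i * - 1}"
    by (cases "i = 0") (auto simp: s_act_0_x s_act_x simple_root_def transpose_def)
  then show ?case
    by (metis dvd_0_right dvd_refl dvd_triv_left insertE singletonD)
next
  case (y j)
  then show ?case by (simp add: s_act_y)
next
  case (add f g)
  have "f + g - s_act i (f + g) = (f - s_act i f) + (g - s_act i g)"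
    by (simp add: s_act_simps)
  then show ?case using add by (simp only: dvd_add)
next
  case (mult f g)
  have "f * g - s_act i (f * g) = (f - s_act i f) * g + s_act i f * (g - s_act i g)"
    by (simp add: s_act_simps algebra_simps)
  then show ?case using mult by (simp only: dvd_add dvd_mult dvd_mult2)
qed

text \<open>Existence and uniqueness of the quotient, so that the definite description in \<open>dd_x\<close> can be
  used through its defining equation.\<close>

lemma dd_x_eqI: "simple_root i * g = f - s_act i f \<Longrightarrow> dd_x i f = g"
  and root_dd_x: "simple_root i * dd_x i f = f - s_act i f"
proof -
  have dd: "dd_x i f = (THE g. simple_root i * g = f - s_act i f)"
    by (simp add: dd_x_def simple_root_def)
  have ex1: "\<exists>!g. simple_root i * g = f - s_act i f"
    using root_dvd[of i f] nonzerodivisor_cancel[OF nonzerodivisor_root[of i]]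
    unfolding dvd_def by metis
  show "simple_root i * dd_x i f = f - s_act i f"
    unfolding dd by (rule theI'[OF ex1])
  then show "dd_x i f = g" if "simple_root i * g = f - s_act i f"
    using that ex1 by blast
qed

lemma s_act_dd_x: "s_act i (dd_x i f) = dd_x i f"
proof -
  have "s_act i (simple_root i * dd_x i f) = - (simple_root i * dd_x i f)"
    unfolding root_dd_x by (simp add: s_act_simps s_act_s_act)
  then show ?thesis
    using nonzerodivisor_cancel[OF nonzerodivisor_root[of i]]
    by (simp add: s_act_simps s_act_root)
qed

lemma dd_x_zero: "dd_x i 0 = 0"
  by (rule dd_x_eqI) (simp add: s_act_simps)

lemma dd_x_eq_zero_iff: "dd_x i f = 0 \<longleftrightarrow> s_act i f = f"
  using root_dd_x[of i f] dd_x_eqI[of i 0 f] by auto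

lemma dd_x_mult_invariant: "s_act i f = f \<Longrightarrow> dd_x i (f * g) = f * dd_x i g"
  by (rule dd_x_eqI) (simp add: s_act_simps root_dd_x mult.left_commute[of "simple_root i"] right_diff_distrib)

text \<open>Both sides equal \<open>\<partial>\<^sub>i f \<cdot> \<partial>\<^sub>i g\<close>, because divided differences are invariant under \<open>s\<^sub>i\<close> and
  \<open>\<partial>\<^sub>i\<close> is linear over invariants.\<close>

lemma dd_x_adjoint: "dd_x i (dd_x i f * g) = dd_x i (f * dd_x i g)"
  using dd_x_mult_invariant[OF s_act_dd_x, of i f g] dd_x_mult_invariant[OF s_act_dd_x, of i g f]
  by (simp add: mult.commute)

section \<open>Braid relations\<close>

lemma s_act_commute:
  assumes "i + 2 \<le> j"
  shows "s_act i (s_act j f) = s_act j (s_act i f)"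
proof (rule gamma_xy_hom_eqI[OF ring_hom_comp[OF ring_hom_s_act ring_hom_s_act]
      ring_hom_comp[OF ring_hom_s_act ring_hom_s_act]])
  fix p :: nat assume "p \<ge> 1"
  show "s_act i (s_act j (cgen p)) = s_act j (s_act i (cgen p))"
    using assms
    by (cases "i = 0") (simp_all add: s_act_0_c s_act_c s_act_twist s_act_x)
next
  fix k :: nat assume k: "k \<ge> 1"
  have j: "j \<ge> 1" using assms by simp
  show "s_act i (s_act j (xvar k)) = s_act j (s_act i (xvar k))"
  proof (cases "i = 0")
    case True
    then show ?thesis
      using k assms by (auto simp: s_act_0_x s_act_x s_act_simps transpose_def)
  next
    case False
    then show ?thesis
      using k assms by (auto simp: s_act_x s_act_simps transpose_def)
  qed
  show "s_act i (s_act j (yvar k)) = s_act j (s_act i (yvar k))"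
    using k by (simp add: s_act_y)
qed

lemma s_act_braid3:
  assumes "i \<ge> 1"
  shows "s_act i (s_act (i + 1) (s_act i f)) = s_act (i + 1) (s_act i (s_act (i + 1) f))"
proof (rule gamma_xy_hom_eqI[OF ring_hom_comp[OF ring_hom_s_act ring_hom_comp[OF ring_hom_s_act
        ring_hom_s_act]] ring_hom_comp[OF ring_hom_s_act ring_hom_comp[OF ring_hom_s_act ring_hom_s_act]]])
  fix k :: nat assume k: "k \<ge> 1"
  show "s_act i (s_act (i + 1) (s_act i (xvar k))) =
      s_act (i + 1) (s_act i (s_act (i + 1) (xvar k)))"
    using k assms by (auto simp: s_act_x transpose_def)
qed (use assms in \<open>simp_all add: s_act_c s_act_y\<close>)

text \<open>On \<open>\<Gamma>\<close> both sides twist by \<open>x\<^sub>1\<close> and by \<open>x\<^sub>2\<close>, in different orders.\<close>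

lemma s_act_braid4:
  "s_act 0 (s_act 1 (s_act 0 (s_act 1 f))) = s_act 1 (s_act 0 (s_act 1 (s_act 0 f)))"
proof (rule gamma_xy_hom_eqI[OF
      ring_hom_comp[OF ring_hom_s_act ring_hom_comp[OF ring_hom_s_act
        ring_hom_comp[OF ring_hom_s_act ring_hom_s_act]]]
      ring_hom_comp[OF ring_hom_s_act ring_hom_comp[OF ring_hom_s_act
        ring_hom_comp[OF ring_hom_s_act ring_hom_s_act]]]])
  fix p :: nat assume p: "p \<ge> 1"
  have x: "s_act 0 (xvar 1) = - xvar 1" "s_act 0 (xvar 2) = xvar 2"
    "s_act 1 (xvar 1) = xvar 2" "s_act 1 (xvar 2) = xvar 1"
    by (simp_all add: s_act_0_x s_act_x transpose_def numeral_2_eq_2)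
  have c: "(\<lambda>p. s_act 1 (cgen p)) = cgen"
    by (simp add: s_act_c)
  have tw: "(\<lambda>p. s_act i (twist x c p)) = twist (s_act i x) (\<lambda>p. s_act i (c p))" for i x c
    by (simp add: s_act_twist)
  show "s_act 0 (s_act 1 (s_act 0 (s_act 1 (cgen p)))) =
      s_act 1 (s_act 0 (s_act 1 (s_act 0 (cgen p))))"
    by (simp only: s_act_c[OF order_refl] s_act_0_c s_act_twist tw c s_act_twist_cgen x
        twist_commute[of "xvar 2"])
next
  fix k :: nat assume k: "k \<ge> 1"
  then consider "k = 1" | "k = 2" | "k > 2" by linarith
  then show "s_act 0 (s_act 1 (s_act 0 (s_act 1 (xvar k)))) =
      s_act 1 (s_act 0 (s_act 1 (s_act 0 (xvar k))))"
    by cases (auto simp: s_act_0_x s_act_x s_act_simps transpose_def)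
qed (simp_all add: s_act_y)

text \<open>
  After clearing denominators, \<open>D E D\<close> is an alternating sum over the dihedral group generated by
  \<open>s\<close> and \<open>t\<close>. If \<open>s\<close> and \<open>t\<close> satisfy the braid relation, this sum and the product of denominators are
  symmetric in the two reflections, whence the braid relation for \<open>D\<close> and \<open>E\<close>. The elements \<open>\<alpha>\<close>,
  \<open>\<beta>\<close>, \<open>\<alpha> + \<beta>\<close> are the positive roots of a root system of type \<open>A\<^sub>2\<close>.
\<close>

lemma divided_difference_braid3:
  fixes s t D E :: "'r::comm_ring_1 \<Rightarrow> 'r"
  assumes hom: "ring_hom s" "ring_hom t"
    and D: "\<And>f. \<alpha> * D f = f - s f" and E: "\<And>f. \<beta> * E f = f - t f"
    and sD: "\<And>f. s (D f) = D f"
    and s: "s \<alpha> = - \<alpha>" "s \<beta> = \<alpha> + \<beta>" and t: "t \<alpha> = \<alpha> + \<beta>"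
  shows "\<alpha> * \<beta> * (\<alpha> + \<beta>) * D (E (D f)) = f - s f - t f + s (t f) + t (s f) - s (t (s f))"
proof -
  define g where "g = D f"
  have s_h: "(\<alpha> + \<beta>) * s (E g) = g - s (t g)"
    using arg_cong[OF E[of g], of s] by (simp add: ring_hom_simps[OF hom(1)] s g_def sD)
  have t_g: "(\<alpha> + \<beta>) * t g = t f - t (s f)"
    using arg_cong[OF D[of f], of t] by (simp add: ring_hom_simps[OF hom(2)] t g_def)
  have st_g: "\<beta> * s (t g) = s (t f) - s (t (s f))"
    using arg_cong[OF t_g, of s] by (simp add: ring_hom_simps[OF hom(1)] s)
  have "\<alpha> * \<beta> * (\<alpha> + \<beta>) * D (E g) = \<beta> * (\<alpha> + \<beta>) * (\<alpha> * D (E g))"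
    by (simp add: mult_ac)
  also have "\<dots> = (\<alpha> + \<beta>) * (\<beta> * E g) - \<beta> * ((\<alpha> + \<beta>) * s (E g))"
    unfolding D by (simp add: algebra_simps)
  also have "\<dots> = \<alpha> * g - (\<alpha> + \<beta>) * t g + \<beta> * s (t g)"
    unfolding E s_h by (simp add: algebra_simps)
  also have "\<dots> = (f - s f) - (t f - t (s f)) + (s (t f) - s (t (s f)))"
    unfolding t_g st_g by (simp add: g_def D)
  finally show ?thesis
    unfolding g_def by (simp add: algebra_simps)
qed

text \<open>
  The analogue for the dihedral group of order 8. The hypothesis \<open>p q = 2\<close> on the off-diagonal Cartan
  numbers leaves open which of the two roots is the long one, so the lemma applies with the roles
  of the two reflections interchanged. The elements \<open>\<alpha>\<close>, \<open>\<beta>\<close>, \<open>\<beta> + p \<alpha>\<close>, \<open>\<alpha> + q \<beta>\<close> are the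
  positive roots.
\<close>

lemma divided_difference_braid4:
  fixes s t D E :: "'r::comm_ring_1 \<Rightarrow> 'r"
  assumes hom: "ring_hom s" "ring_hom t"
    and ss: "\<And>f. s (s f) = f"
    and D: "\<And>f. \<alpha> * D f = f - s f" and E: "\<And>f. \<beta> * E f = f - t f"
    and sD: "\<And>f. s (D f) = D f" and tE: "\<And>f. t (E f) = E f"
    and s: "s \<alpha> = - \<alpha>" "s \<beta> = \<beta> + p * \<alpha>" "s q = q"
    and t: "t \<beta> = - \<beta>" "t \<alpha> = \<alpha> + q * \<beta>" "t p = p" and pq: "p * q = 2"
  shows "\<alpha> * \<beta> * (\<beta> + p * \<alpha>) * (\<alpha> + q * \<beta>) * D (E (D (E f))) =
    f - s f - t f + s (t f) + t (s f) - s (t (s f)) - t (s (t f)) + s (t (s (t f)))"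
proof -
  note homs = ring_hom_simps[OF hom(1)] ring_hom_simps[OF hom(2)]
  define \<gamma> where "\<gamma> = \<beta> + p * \<alpha>"
  define \<delta> where "\<delta> = \<alpha> + q * \<beta>"
  have qp: "q * (p * z) = 2 * z" for z
    using pq by (simp add: mult.assoc[symmetric] mult.commute)
  have pq': "p * (q * z) = 2 * z" for z
    using pq by (simp add: mult.assoc[symmetric])
  have s_beta: "s \<beta> = \<gamma>" and t_alpha: "t \<alpha> = \<delta>"
    by (simp_all add: \<gamma>_def \<delta>_def s t)
  have s_delta: "s \<delta> = \<delta>" 
    by (simp add: \<delta>_def homs s distrib_left qp)
  have t_gamma: "t \<gamma> = \<gamma>"
    by (simp add: \<gamma>_def homs t distrib_left pq')
  have s_gamma: "s \<gamma> = \<beta>"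
    using s_beta ss by metis
  define g1 where "g1 = E f"
  define g2 where "g2 = D g1"
  define g3 where "g3 = E g2"
  have s_g3: "\<gamma> * s g3 = g2 - s (t g2)"
    using arg_cong[OF E[of g2], of s] by (simp add: homs s_beta g3_def) (simp add: g2_def sD)
  have t_g2: "\<delta> * t g2 = g1 - t (s g1)"
    using arg_cong[OF D[of g1], of t] by (simp add: homs t_alpha g2_def) (simp add: g1_def tE)
  have st_g2: "\<delta> * s (t g2) = s g1 - s (t (s g1))"
    using arg_cong[OF t_g2, of s] by (simp add: homs s_delta)
  have s_g1: "\<gamma> * s g1 = s f - s (t f)"
    using arg_cong[OF E[of f], of s] by (simp add: homs s_beta g1_def)
  have ts_g1: "\<gamma> * t (s g1) = t (s f) - t (s (t f))"
    using arg_cong[OF s_g1, of t] by (simp add: homs t_gamma)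
  have sts_g1: "\<beta> * s (t (s g1)) = s (t (s f)) - s (t (s (t f)))"
    using arg_cong[OF ts_g1, of s] by (simp add: homs s_gamma)
  have pd: "p * \<delta> = \<beta> + \<gamma>"
    unfolding \<gamma>_def \<delta>_def distrib_left pq' mult_2 by (simp only: add_ac)
  have "\<alpha> * \<beta> * \<gamma> * \<delta> * D g3 = \<beta> * \<gamma> * \<delta> * (\<alpha> * D g3)"
    by (simp add: mult_ac)
  also have "\<dots> = \<gamma> * \<delta> * (\<beta> * g3) - \<beta> * \<delta> * (\<gamma> * s g3)"
    unfolding D by (simp add: algebra_simps)
  also have "\<dots> = (\<gamma> - \<beta>) * \<delta> * g2 - \<gamma> * (\<delta> * t g2) + \<beta> * (\<delta> * s (t g2))"
    unfolding s_g3 unfolding g3_def E by (simp add: algebra_simps)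
  also have "(\<gamma> - \<beta>) * \<delta> * g2 = p * \<delta> * (\<alpha> * g2)"
    by (simp add: \<gamma>_def mult_ac)
  also have "p * \<delta> * (\<alpha> * g2) = (\<beta> + \<gamma>) * (g1 - s g1)"
    unfolding pd g2_def D ..
  also have "(\<beta> + \<gamma>) * (g1 - s g1) - \<gamma> * (\<delta> * t g2) + \<beta> * (\<delta> * s (t g2)) =
      \<beta> * g1 - \<gamma> * s g1 + \<gamma> * t (s g1) - \<beta> * s (t (s g1))"
    unfolding t_g2 st_g2 by (simp add: algebra_simps)
  also have "\<dots> = (f - t f) - (s f - s (t f)) + (t (s f) - t (s (t f))) -
      (s (t (s f)) - s (t (s (t f))))"
    unfolding s_g1 ts_g1 sts_g1 by (simp add: g1_def E)
  finally show ?thesis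
    unfolding g1_def g2_def g3_def \<gamma>_def \<delta>_def by (simp add: algebra_simps)
qed

lemma nonzerodivisor_s_act: "nonzerodivisor a \<Longrightarrow> nonzerodivisor (s_act i a)"
  by (rule nonzerodivisor_hom[OF ring_hom_s_act ring_hom_s_act, of i i]) (simp_all add: s_act_s_act)

lemma dd_x_commute:
  assumes "i + 2 \<le> j"
  shows "dd_x i (dd_x j f) = dd_x j (dd_x i f)"
proof -
  have root: "s_act i (simple_root j) = simple_root j" "s_act j (simple_root i) = simple_root i"
    using assms by (cases "i = 0"; auto simp: simple_root_def s_act_simps s_act_0_x s_act_x transpose_def)+
  have exp: "simple_root i * simple_root j * dd_x i (dd_x j f) = f - s_act j f - s_act i f + s_act i (s_act j f)"
    if root: "s_act i (simple_root j) = simple_root j" for i j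
  proof -
    have "simple_root i * simple_root j * dd_x i (dd_x j f) = simple_root j * (simple_root i * dd_x i (dd_x j f))"
      by (simp add: mult_ac)
    also have "\<dots> = simple_root j * dd_x j f - s_act i (simple_root j * dd_x j f)"
      unfolding root_dd_x[of i] by (simp add: s_act_simps root right_diff_distrib)
    finally show ?thesis
      unfolding root_dd_x by (simp add: s_act_simps)
  qed
  have "simple_root i * simple_root j * dd_x i (dd_x j f) = simple_root i * simple_root j * dd_x j (dd_x i f)"
    using exp[of i j, OF root(1)] exp[of j i, OF root(2)] s_act_commute[OF assms, of f]
    by (simp add: mult.commute[of "simple_root j" "simple_root i"])
  then show ?thesis
    using nonzerodivisor_cancel[OF nonzerodivisor_mult[OF nonzerodivisor_root nonzerodivisor_root]]
    by blast
qed

lemma dd_x_braid3: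
  assumes "i \<ge> 1"
  shows "dd_x i (dd_x (i + 1) (dd_x i f)) = dd_x (i + 1) (dd_x i (dd_x (i + 1) f))"
proof -
  let ?a = "simple_root i" and ?b = "simple_root (i + 1)"
  have ab: "s_act i ?b = ?a + ?b" "s_act (i + 1) ?a = ?b + ?a"
    using assms by (auto simp: simple_root_def s_act_simps s_act_x transpose_def)
  have "?a * ?b * (?a + ?b) * dd_x i (dd_x (i + 1) (dd_x i f)) =
      ?b * ?a * (?b + ?a) * dd_x (i + 1) (dd_x i (dd_x (i + 1) f))"
    unfolding divided_difference_braid3[where s = "s_act i" and t = "s_act (i + 1)", OF
        ring_hom_s_act ring_hom_s_act root_dd_x root_dd_x s_act_dd_x s_act_root ab(1)
        ab(2)[unfolded add.commute[of ?b ?a]]]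
      divided_difference_braid3[where s = "s_act (i + 1)" and t = "s_act i", OF
        ring_hom_s_act ring_hom_s_act root_dd_x root_dd_x s_act_dd_x s_act_root ab(2)
        ab(1)[unfolded add.commute[of ?a ?b]]]
    using s_act_braid3[OF assms, of f] by (simp add: algebra_simps)
  then have "?a * ?b * (?a + ?b) * dd_x i (dd_x (i + 1) (dd_x i f)) =
      ?a * ?b * (?a + ?b) * dd_x (i + 1) (dd_x i (dd_x (i + 1) f))"
    by (simp only: mult_ac add_ac)
  moreover have "nonzerodivisor (?a * ?b * (?a + ?b))"
    unfolding ab(1)[symmetric]
    by (intro nonzerodivisor_mult nonzerodivisor_s_act nonzerodivisor_root)
  ultimately show ?thesis by (rule nonzerodivisor_cancel[rotated])
qed

lemma dd_x_braid4:
  "dd_x 0 (dd_x 1 (dd_x 0 (dd_x 1 f))) = dd_x 1 (dd_x 0 (dd_x 1 (dd_x 0 f)))"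
proof -
  let ?a = "simple_root 0" and ?b = "simple_root 1"
  have ab: "s_act 0 ?b = ?b + 1 * ?a" "s_act 1 ?a = ?a + 2 * ?b"
    by (auto simp: simple_root_def s_act_simps s_act_0_x s_act_x transpose_def algebra_simps)
  have const: "s_act i 1 = 1" "s_act i 2 = 2" for i by (simp_all add: s_act_simps)
  have "?a * ?b * (?b + 1 * ?a) * (?a + 2 * ?b) * dd_x 0 (dd_x 1 (dd_x 0 (dd_x 1 f))) =
      ?b * ?a * (?a + 2 * ?b) * (?b + 1 * ?a) * dd_x 1 (dd_x 0 (dd_x 1 (dd_x 0 f)))"
    unfolding divided_difference_braid4[where s = "s_act 0" and t = "s_act 1", OF
        ring_hom_s_act ring_hom_s_act s_act_s_act root_dd_x root_dd_x s_act_dd_x s_act_dd_x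
        s_act_root ab(1) const(2) s_act_root ab(2) const(1) mult_1]
      divided_difference_braid4[where s = "s_act 1" and t = "s_act 0", OF
        ring_hom_s_act ring_hom_s_act s_act_s_act root_dd_x root_dd_x s_act_dd_x s_act_dd_x
        s_act_root ab(2) const(1) s_act_root ab(1) const(2) mult_1_right]
    using s_act_braid4[of f] by (simp add: algebra_simps)
  then have "?a * ?b * (?b + 1 * ?a) * (?a + 2 * ?b) * dd_x 0 (dd_x 1 (dd_x 0 (dd_x 1 f))) =
      ?a * ?b * (?b + 1 * ?a) * (?a + 2 * ?b) * dd_x 1 (dd_x 0 (dd_x 1 (dd_x 0 f)))"
    by (simp only: mult_ac)
  moreover have "nonzerodivisor (?a * ?b * (?b + 1 * ?a) * (?a + 2 * ?b))"
    unfolding ab[symmetric]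
    by (intro nonzerodivisor_mult nonzerodivisor_s_act nonzerodivisor_root)
  ultimately show ?thesis by (rule nonzerodivisor_cancel[rotated])
qed

section \<open>Setting the variables \<open>Y\<close> to zero\<close>

lemma ring_hom_set_Y_zero: "ring_hom set_Y_zero"
  unfolding set_Y_zero_def by (intro ring_hom_gamma_xy_hom) (simp add: cgen_upd_0 gamma_point_cgen)

lemma set_Y_zero_c: "set_Y_zero (cgen p) = cgen p"
  by (cases "p = 0") (simp_all add: cgen_0 ring_hom_one[OF ring_hom_set_Y_zero],
      simp add: set_Y_zero_def gamma_xy_hom_c cgen_upd_0 gamma_point_cgen)

lemma set_Y_zero_x: "j \<ge> 1 \<Longrightarrow> set_Y_zero (xvar j) = xvar j"
  and set_Y_zero_y: "j \<ge> 1 \<Longrightarrow> set_Y_zero (yvar j) = 0"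
  by (simp_all add: set_Y_zero_def gamma_xy_hom_x gamma_xy_hom_y cgen_upd_0 gamma_point_cgen)

lemma set_Y_zero_s_act: "set_Y_zero (s_act i f) = s_act i (set_Y_zero f)"
proof (rule gamma_xy_hom_eqI[OF ring_hom_comp[OF ring_hom_set_Y_zero ring_hom_s_act]
      ring_hom_comp[OF ring_hom_s_act ring_hom_set_Y_zero]])
  fix p :: nat assume "p \<ge> 1"
  show "set_Y_zero (s_act i (cgen p)) = s_act i (set_Y_zero (cgen p))"
    by (cases "i = 0") (simp_all add: s_act_0_c s_act_c set_Y_zero_c set_Y_zero_x
        ring_hom_twist[OF ring_hom_set_Y_zero])
next
  fix j :: nat assume j: "j \<ge> 1"
  show "set_Y_zero (s_act i (xvar j)) = s_act i (set_Y_zero (xvar j))"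
    using j transpose_ge_1[of i j]
    by (cases "i = 0") (simp_all add: s_act_0_x s_act_x set_Y_zero_x
        ring_hom_minus[OF ring_hom_set_Y_zero])
  show "set_Y_zero (s_act i (yvar j)) = s_act i (set_Y_zero (yvar j))"
    using j by (simp add: s_act_y set_Y_zero_y s_act_simps)
qed

text \<open>The reflections and the simple roots do not involve \<open>Y\<close>.\<close>

lemma set_Y_zero_dd_x: "set_Y_zero (dd_x i f) = dd_x i (set_Y_zero f)"
proof -
  have "set_Y_zero (simple_root i) = simple_root i"
    by (simp add: simple_root_def set_Y_zero_x ring_hom_simps[OF ring_hom_set_Y_zero])
  then show ?thesis
    using arg_cong[OF root_dd_x[of i f], of set_Y_zero]
    by (intro dd_x_eqI[symmetric])
      (simp add: ring_hom_simps[OF ring_hom_set_Y_zero] set_Y_zero_s_act)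
qed

lemma gamma_point_zero_upd: "gamma_point ((\<lambda>p. 0)(0 := 1) :: nat \<Rightarrow> 'b::comm_ring_1)"
proof -
  have "((\<lambda>p. 0)(0 := 1) :: nat \<Rightarrow> 'b) = trivial_point" by auto
  then show ?thesis using gamma_point_trivial by simp
qed

lemma ring_hom_constant_term: "ring_hom constant_term"
  unfolding constant_term_def by (intro ring_hom_gamma_xy_hom gamma_point_zero_upd)

lemma constant_term_gen:
  "p \<ge> 1 \<Longrightarrow> constant_term (cgen p) = 0" "j \<ge> 1 \<Longrightarrow> constant_term (xvar j) = 0"
  "j \<ge> 1 \<Longrightarrow> constant_term (yvar j) = 0"
  by (simp_all add: constant_term_def gamma_xy_hom_c gamma_xy_hom_x gamma_xy_hom_y gamma_point_zero_upd)

lemma constant_term_set_Y_zero: "constant_term (set_Y_zero f) = constant_term f"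
  by (rule gamma_xy_hom_eqI[OF ring_hom_comp[OF ring_hom_constant_term ring_hom_set_Y_zero]
        ring_hom_constant_term])
    (simp_all add: set_Y_zero_c set_Y_zero_x set_Y_zero_y constant_term_gen
      ring_hom_zero[OF ring_hom_constant_term])

section \<open>Lengths of signed permutations\<close>

lemma signed_permsD:
  assumes "w \<in> signed_perms k"
  shows signed_perms_inj: "w a = w b \<longleftrightarrow> a = b"
    and signed_perms_minus: "w (- a) = - w a"
    and signed_perms_zero: "w 0 = 0"
    and signed_perms_fix: "\<bar>a\<bar> > int k \<Longrightarrow> w a = a"
proof -
  show "w a = w b \<longleftrightarrow> a = b"
    using assms by (simp add: signed_perms_def bij_is_inj inj_eq)
  show "w (- a) = - w a" "\<bar>a\<bar> > int k \<Longrightarrow> w a = a"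
    using assms unfolding signed_perms_def by blast+
  have "w (- 0) = - w 0"
    using assms unfolding signed_perms_def by blast
  then show "w 0 = 0" by simp
qed

lemma signed_perms_bound:
  assumes "w \<in> signed_perms k" "\<bar>a\<bar> \<le> int k"
  shows "\<bar>w a\<bar> \<le> int k"
proof (rule ccontr)
  assume "\<not> \<bar>w a\<bar> \<le> int k"
  then have "w (w a) = w a" using signed_perms_fix[OF assms(1)] by simp
  then have "w a = a" using signed_perms_inj[OF assms(1)] by simp
  then show False using assms(2) \<open>\<not> \<bar>w a\<bar> \<le> int k\<close> by simp
qed

lemma signed_perms_comp:
  assumes "v \<in> signed_perms k" "w \<in> signed_perms k"
  shows "v \<circ> w \<in> signed_perms k"
  using assms by (auto simp: signed_perms_def bij_comp)

lemma signed_perms_mono: "k \<le> l \<Longrightarrow> signed_perms k \<subseteq> signed_perms l"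
  by (auto simp: signed_perms_def)

lemma signed_perms_inf_comp:
  assumes "v \<in> signed_perms_inf" "w \<in> signed_perms_inf"
  shows "v \<circ> w \<in> signed_perms_inf"
proof -
  from assms obtain k l where "v \<in> signed_perms k" "w \<in> signed_perms l"
    by (auto simp: signed_perms_inf_def)
  then have "v \<in> signed_perms (max k l)" "w \<in> signed_perms (max k l)"
    using signed_perms_mono[of k "max k l"] signed_perms_mono[of l "max k l"] by auto
  then show ?thesis
    using signed_perms_comp unfolding signed_perms_inf_def by blast
qed

lemma signed_perms_imp_inf: "w \<in> signed_perms k \<Longrightarrow> w \<in> signed_perms_inf"
  by (auto simp: signed_perms_inf_def)

lemma sgen_0_apply: "sgen 0 a = (if a = 1 then - 1 else if a = - 1 then 1 else a)"
  by (simp add: sgen_def transpose_def)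

lemma sgen_apply:
  "i \<ge> 1 \<Longrightarrow> sgen i a = (if a = int i then int i + 1 else if a = int i + 1 then int i
    else if a = - int i then - int i - 1 else if a = - int i - 1 then - int i else a)"
  by (auto simp: sgen_def transpose_def)

lemma sgen_sgen: "sgen i (sgen i a) = a"
  by (cases "i = 0") (auto simp: sgen_0_apply sgen_apply)

lemma sgen_comp_sgen: "sgen i \<circ> sgen i = id"
  by (simp add: fun_eq_iff sgen_sgen)

lemma comp_sgen_sgen: "w \<circ> sgen i \<circ> sgen i = w"
  by (simp add: fun_eq_iff sgen_sgen)

lemma sgen_signed_perms: "i < k \<Longrightarrow> sgen i \<in> signed_perms k"
  unfolding signed_perms_def
proof (intro CollectI conjI allI impI)
  show "bij (sgen i)"
    by (rule o_bij[of "sgen i"]) (simp_all add: sgen_comp_sgen)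
  show "sgen i (- a) = - sgen i a" for a
    by (cases "i = 0") (auto simp: sgen_0_apply sgen_apply)
  show "sgen i a = a" if "i < k" "int k < \<bar>a\<bar>" for a
    using that by (cases "i = 0") (auto simp: sgen_0_apply sgen_apply)
qed

lemma sgen_signed_perms_inf: "sgen i \<in> signed_perms_inf"
  using sgen_signed_perms[of i "Suc i"] by (auto simp: signed_perms_inf_def)

lemma id_signed_perms: "id \<in> signed_perms k"
  by (simp add: signed_perms_def)

lemma comp_sgen_inf: "w \<in> signed_perms_inf \<Longrightarrow> w \<circ> sgen i \<in> signed_perms_inf"
  by (intro signed_perms_inf_comp sgen_signed_perms_inf)

lemma word_prod_Nil: "word_prod [] = id"
  and word_prod_append: "word_prod (a @ b) = word_prod a \<circ> word_prod b"
  and word_prod_single: "word_prod [i] = sgen i"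
proof -
  show "word_prod (a @ b) = word_prod a \<circ> word_prod b"
    by (induction a) (simp_all add: word_prod_def comp_assoc)
qed (simp_all add: word_prod_def)

lemma word_prod_inf: "word_prod a \<in> signed_perms_inf"
proof (induction a rule: rev_induct)
  case Nil
  show ?case
    unfolding word_prod_Nil by (rule signed_perms_imp_inf[OF id_signed_perms])
next
  case (snoc i a)
  then show ?case
    unfolding word_prod_append word_prod_single by (rule comp_sgen_inf)
qed

text \<open>
  Inversions are counted among all nonzero integers. An odd permutation inverts \<open>(a, b)\<close> iff it
  inverts \<open>(-b, -a)\<close>, so every inversion in the usual sense is counted twice, except for the fixed
  pairs \<open>(-a, a)\<close>, which stand for the sign changes and are counted once. Adding the number of sign
  changes once more gives twice the length. The advantage over a count by representatives is that
  composition with a generator acts on all inversions by one formula.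
\<close>

definition inv_pairs :: "sperm \<Rightarrow> (int \<times> int) set"
  where "inv_pairs w = {(a, b). a \<noteq> 0 \<and> b \<noteq> 0 \<and> a < b \<and> w a > w b}"

definition sign_changes :: "sperm \<Rightarrow> int set"
  where "sign_changes w = {a. a > 0 \<and> w a < 0}"

definition double_length :: "sperm \<Rightarrow> nat"
  where "double_length w = card (inv_pairs w) + card (sign_changes w)"

definition descent :: "sperm \<Rightarrow> nat \<Rightarrow> bool"
  where "descent w i \<longleftrightarrow> (if i = 0 then w 1 < 0 else w (int i) > w (int i + 1))"

lemma inv_pairs_bound:
  assumes "w \<in> signed_perms k"
  shows "inv_pairs w \<subseteq> {- int k..int k} \<times> {- int k..int k}"
proof -
  have "b \<le> int k" "- int k \<le> a" if "a < b" "w a > w b" for a b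
  proof -
    show "b \<le> int k"
    proof (rule ccontr)
      assume "\<not> b \<le> int k"
      then have "w b = b" using signed_perms_fix[OF assms] by simp
      moreover have "w a = a" if "w a > int k"
        using that signed_perms_fix[OF assms, of "w a"] signed_perms_inj[OF assms] by simp
      ultimately show False using that \<open>\<not> b \<le> int k\<close> by simp
    qed
    show "- int k \<le> a"
    proof (rule ccontr)
      assume "\<not> - int k \<le> a"
      then have "w a = a" using signed_perms_fix[OF assms] by simp
      moreover have "w b = b" if "w b < - int k"
        using that signed_perms_fix[OF assms, of "w b"] signed_perms_inj[OF assms] by simp
      ultimately show False using that \<open>\<not> - int k \<le> a\<close> by simp
    qed
  qed
  then show ?thesis by (fastforce simp: inv_pairs_def)
qed

lemma sign_changes_bound:
  assumes "w \<in> signed_perms k"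
  shows "sign_changes w \<subseteq> {1..int k}"
proof
  fix a assume a: "a \<in> sign_changes w"
  show "a \<in> {1..int k}"
    using a signed_perms_fix[OF assms, of a] by (cases "a > int k") (auto simp: sign_changes_def)
qed

lemma
  assumes "w \<in> signed_perms_inf"
  shows finite_inv_pairs: "finite (inv_pairs w)"
    and finite_sign_changes: "finite (sign_changes w)"
proof -
  obtain k where k: "w \<in> signed_perms k" using assms by (auto simp: signed_perms_inf_def)
  show "finite (inv_pairs w)"
    by (rule finite_subset[OF inv_pairs_bound[OF k]]) simp
  show "finite (sign_changes w)"
    by (rule finite_subset[OF sign_changes_bound[OF k]]) simp
qed

lemma inv_pairs_sgen:
  "inv_pairs (sgen i) = (if i = 0 then {(- 1, 1)} else {(int i, int i + 1), (- int i - 1, - int i)})"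
proof (cases "i = 0")
  case True
  have "(a, b) \<in> inv_pairs (sgen i) \<longleftrightarrow> a = - 1 \<and> b = 1" for a b
    unfolding inv_pairs_def True sgen_0_apply by (simp split: if_splits) presburger
  then show ?thesis using True by auto
next
  case False
  define m where "m = int i"
  have m: "m \<ge> 1" using False by (simp add: m_def)
  have "(a, b) \<in> inv_pairs (sgen i) \<longleftrightarrow> a = m \<and> b = m + 1 \<or> a = - m - 1 \<and> b = - m" for a b
    using False m unfolding inv_pairs_def m_def[symmetric] mem_Collect_eq case_prod_conv
    by (subst (1 2) sgen_apply; simp flip: m_def; smt (verit))
  then show ?thesis using False by (auto simp: m_def)
qed

text \<open>A generator \<open>s\<close> preserves the order of all pairs of nonzero integers but its own inversions, so
  it carries the inversions of \<open>w s\<close> to those of \<open>w\<close> that are not inversions of \<open>s\<close>.\<close>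

lemma double_length_descent:
  assumes w: "w \<in> signed_perms_inf" and desc: "descent w i"
  shows "double_length w = double_length (w \<circ> sgen i) + 2"
proof -
  let ?s = "sgen i" and ?w = "w \<circ> sgen i"
  obtain k where k: "w \<in> signed_perms k" using w by (auto simp: signed_perms_inf_def)
  have minus: "w (- a) = - w a" for a using signed_perms_minus[OF k] .
  have sub: "inv_pairs ?s \<subseteq> inv_pairs w"
    using desc minus[of "int i"] minus[of "int i + 1"] minus[of 1]
    by (auto simp: inv_pairs_sgen descent_def) (auto simp: inv_pairs_def)
  have s_zero: "?s a = 0 \<longleftrightarrow> a = 0" for a
    by (cases "i = 0") (auto simp: sgen_0_apply sgen_apply)
  have disj: "(a, b) \<notin> inv_pairs ?w" if "(a, b) \<in> inv_pairs ?s" for a b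
  proof -
    have "(?s b, ?s a) \<in> inv_pairs ?s"
      using that by (simp add: inv_pairs_def s_zero sgen_sgen)
    then have "(?s b, ?s a) \<in> inv_pairs w" using sub by blast
    then show ?thesis by (simp add: inv_pairs_def)
  qed
  have s_less: "?s a < ?s b" if "a \<noteq> 0" "b \<noteq> 0" "a < b" "(a, b) \<notin> inv_pairs ?s" for a b
  proof -
    have "?s a \<noteq> ?s b" using that(3) sgen_sgen by (metis order_less_irrefl)
    then show ?thesis using that by (auto simp: inv_pairs_def)
  qed
  have "bij_betw (map_prod ?s ?s) (inv_pairs ?w) (inv_pairs w - inv_pairs ?s)"
  proof (rule bij_betw_byWitness[where f' = "map_prod ?s ?s"])
    show "map_prod ?s ?s ` inv_pairs ?w \<subseteq> inv_pairs w - inv_pairs ?s"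
    proof clarsimp
      fix a b assume ab: "(a, b) \<in> inv_pairs ?w"
      then have "a \<noteq> 0" "b \<noteq> 0" "a < b"
        by (simp_all add: inv_pairs_def)
      moreover have "(a, b) \<notin> inv_pairs ?s" using ab disj by blast
      ultimately have "?s a < ?s b" by (rule s_less)
      then show "(?s a, ?s b) \<in> inv_pairs w \<and> (?s a, ?s b) \<notin> inv_pairs ?s"
        using ab by (simp add: inv_pairs_def s_zero sgen_sgen)
    qed
    show "map_prod ?s ?s ` (inv_pairs w - inv_pairs ?s) \<subseteq> inv_pairs ?w"
    proof clarsimp
      fix a b assume ab: "(a, b) \<in> inv_pairs w" "(a, b) \<notin> inv_pairs ?s"
      then have "a \<noteq> 0" "b \<noteq> 0" "a < b"
        by (simp_all add: inv_pairs_def)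
      then have "?s a < ?s b" using ab(2) by (rule s_less)
      then show "(?s a, ?s b) \<in> inv_pairs ?w"
        using ab by (simp add: inv_pairs_def s_zero sgen_sgen)
    qed
  qed (auto simp: sgen_sgen)
  then have "card (inv_pairs ?w) = card (inv_pairs w - inv_pairs ?s)"
    by (rule bij_betw_same_card)
  also have "\<dots> = card (inv_pairs w) - card (inv_pairs ?s)"
    using sub finite_inv_pairs[OF w] finite_subset by (intro card_Diff_subset) auto
  finally have pairs: "card (inv_pairs w) = card (inv_pairs ?w) + card (inv_pairs ?s)"
    using card_mono[OF finite_inv_pairs[OF w] sub] by simp
  show ?thesis
  proof (cases "i = 0")
    case True
    have "sign_changes w = insert 1 (sign_changes ?w)"
      using desc minus[of 1] by (auto simp: True descent_def sign_changes_def sgen_0_apply)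
    moreover have "1 \<notin> sign_changes ?w"
      using desc minus[of 1] by (auto simp: True descent_def sign_changes_def sgen_0_apply)
    ultimately have "card (sign_changes w) = Suc (card (sign_changes ?w))"
      using finite_sign_changes[OF comp_sgen_inf[OF w]] by simp
    then show ?thesis
      using pairs by (simp add: double_length_def True inv_pairs_sgen)
  next
    case False
    have s_pos: "?s a > 0 \<longleftrightarrow> a > 0" for a
      using False by (auto simp: sgen_apply)
    have "bij_betw ?s (sign_changes ?w) (sign_changes w)"
      by (rule bij_betw_byWitness[where f' = ?s]) (auto simp: sign_changes_def sgen_sgen s_pos)
    then have "card (sign_changes ?w) = card (sign_changes w)"
      by (rule bij_betw_same_card)
    then show ?thesis
      using pairs False by (simp add: double_length_def inv_pairs_sgen)
  qed
qed

lemma descent_comp_sgen: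
  assumes "w \<in> signed_perms_inf"
  shows "descent (w \<circ> sgen i) i \<longleftrightarrow> \<not> descent w i"
proof -
  obtain k where k: "w \<in> signed_perms k" using assms by (auto simp: signed_perms_inf_def)
  show ?thesis
  proof (cases "i = 0")
    case True
    have "w 1 \<noteq> 0"
      using signed_perms_inj[OF k, of 1 0] signed_perms_zero[OF k] by simp
    then show ?thesis
      using True signed_perms_minus[OF k, of 1] by (auto simp: descent_def sgen_0_apply)
  next
    case False
    have "w (int i) \<noteq> w (int i + 1)"
      using signed_perms_inj[OF k] by simp
    then show ?thesis
      using False by (auto simp: descent_def sgen_apply)
  qed
qed

lemma double_length_ascent:
  assumes "w \<in> signed_perms_inf" "\<not> descent w i"
  shows "double_length (w \<circ> sgen i) = double_length w + 2"
  using double_length_descent[OF comp_sgen_inf[OF assms(1)], of i i] descent_comp_sgen[OF assms(1)]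
    assms(2) by (simp add: comp_sgen_sgen)

text \<open>Without descents \<open>w\<close> is strictly increasing on the nonnegative integers and fixes 0, hence
  \<open>w j \<ge> j\<close>; being the identity far out, it cannot exceed \<open>j\<close> anywhere.\<close>

lemma no_descent_id:
  assumes "w \<in> signed_perms_inf" "\<And>i. \<not> descent w i"
  shows "w = id"
proof -
  obtain k where k: "w \<in> signed_perms k" using assms by (auto simp: signed_perms_inf_def)
  have inc: "w (int j + 1) \<ge> w (int j) + 1" for j
  proof (cases "j = 0")
    case True
    have "w 1 \<noteq> 0"
      using signed_perms_inj[OF k, of 1 0] signed_perms_zero[OF k] by simp
    then show ?thesis
      using True assms(2)[of 0] signed_perms_zero[OF k] by (simp add: descent_def)
  next
    case False
    have "w (int j) \<noteq> w (int j + 1)"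
      using signed_perms_inj[OF k] by simp
    then show ?thesis
      using False assms(2)[of j] by (auto simp: descent_def)
  qed
  have grow: "w (int (j + m)) \<ge> w (int j) + int m" for j m
  proof (induction m)
    case (Suc m)
    then show ?case using inc[of "j + m"] by (simp add: add_ac)
  qed simp
  have pos: "w (int j) = int j" for j
  proof -
    have "w (int j) \<ge> int j"
      using grow[of 0 j] signed_perms_zero[OF k] by simp
    moreover have "w (int j) + int (Suc k) \<le> int (j + Suc k)"
      using grow[of j "Suc k"] signed_perms_fix[OF k, of "int (j + Suc k)"] by simp
    ultimately show ?thesis by simp
  qed
  show ?thesis
  proof
    fix a
    show "w a = id a"
      using pos[of "nat \<bar>a\<bar>"] signed_perms_minus[OF k, of a] by (cases "a \<ge> 0") auto
  qed
qed

lemma double_length_id: "double_length id = 0"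
proof -
  have "inv_pairs id = {}" "sign_changes id = {}"
    by (auto simp: inv_pairs_def sign_changes_def)
  then show ?thesis by (simp add: double_length_def)
qed

lemma double_length_word: "double_length (word_prod a) \<le> 2 * length a"
proof (induction a rule: rev_induct)
  case Nil
  show ?case unfolding word_prod_Nil double_length_id by simp
next
  case (snoc i a)
  then have "double_length (word_prod a \<circ> sgen i) \<le> 2 * length (a @ [i])"
    using double_length_descent[OF word_prod_inf, of a i] double_length_ascent[OF word_prod_inf, of a i]
    by (cases "descent (word_prod a) i") auto
  then show ?case
    unfolding word_prod_append word_prod_single .
qed

lemma ex_short_word:
  assumes "w \<in> signed_perms_inf"
  shows "\<exists>a. word_prod a = w \<and> 2 * length a = double_length w"
  using assms
proof (induction "double_length w" arbitrary: w rule: less_induct)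
  case less
  show ?case
  proof (cases "w = id")
    case True
    then show ?thesis
      using word_prod_Nil double_length_id by (intro exI[of _ "[]"]) (simp only: list.size mult_0_right simp_thms)
  next
    case False
    then obtain i where i: "descent w i" using no_descent_id less.prems by blast
    note dl = double_length_descent[OF less.prems i]
    obtain a where a: "word_prod a = w \<circ> sgen i" "2 * length a = double_length (w \<circ> sgen i)"
      using less.hyps[of "w \<circ> sgen i"] dl comp_sgen_inf[OF less.prems] by auto
    then have "word_prod (a @ [i]) = w"
      unfolding word_prod_append word_prod_single by (simp only: comp_sgen_sgen)
    then show ?thesis
      using dl a(2) by (intro exI[of _ "a @ [i]"]) simp
  qed
qed

lemma len_le_length: "len (word_prod a) \<le> length a"
  unfolding len_def by (rule Least_le) blast

lemma double_len:
  assumes "w \<in> signed_perms_inf"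
  shows "2 * len w = double_length w"
proof -
  obtain a where a: "word_prod a = w" "2 * length a = double_length w"
    using ex_short_word[OF assms] by blast
  then have "\<exists>k b. length b = k \<and> word_prod b = w" by blast
  then have "\<exists>b. length b = len w \<and> word_prod b = w"
    unfolding len_def by (rule LeastI_ex)
  then have "double_length w \<le> 2 * len w"
    using double_length_word by metis
  then show ?thesis using len_le_length[of a] a by simp
qed

lemma len_comp_sgen:
  assumes "w \<in> signed_perms_inf"
  shows len_descent: "descent w i \<Longrightarrow> len w = Suc (len (w \<circ> sgen i))"
    and len_ascent: "\<not> descent w i \<Longrightarrow> len (w \<circ> sgen i) = Suc (len w)"
  using double_len[OF assms] double_len[OF comp_sgen_inf[OF assms, of i]]
    double_length_descent[OF assms, of i] double_length_ascent[OF assms, of i] by auto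

lemma len_less_iff_descent:
  "w \<in> signed_perms_inf \<Longrightarrow> len (w \<circ> sgen i) < len w \<longleftrightarrow> descent w i"
  using len_descent[of w i] len_ascent[of w i] by (cases "descent w i") auto

lemma len_zero_iff: "w \<in> signed_perms_inf \<Longrightarrow> len w = 0 \<longleftrightarrow> w = id"
  using len_descent[of w] no_descent_id[of w] double_len[of id]
    id_signed_perms[of 0, THEN signed_perms_imp_inf] double_length_id by fastforce

lemma ex_reduced_word:
  assumes "w \<in> signed_perms_inf"
  shows "\<exists>a. reduced_word w a"
  using ex_short_word[OF assms] double_len[OF assms] unfolding reduced_word_def by auto

lemma reduced_word_snoc:
  assumes w: "w \<in> signed_perms_inf"
  shows "reduced_word w (a @ [i]) \<longleftrightarrow> descent w i \<and> reduced_word (w \<circ> sgen i) a"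
proof -
  have "word_prod (a @ [i]) = w \<longleftrightarrow> word_prod a = w \<circ> sgen i"
    by (metis word_prod_append word_prod_single comp_sgen_sgen)
  moreover have "descent w i" if "word_prod a = w \<circ> sgen i" "length a + 1 = len w"
    using that len_ascent[OF w, of i] len_le_length[of a] by (cases "descent w i") auto
  ultimately show ?thesis
    using len_descent[OF w, of i] by (auto simp: reduced_word_def)
qed

section \<open>Independence of the reduced word\<close>

definition dd_word :: "nat list \<Rightarrow> gamma_xy \<Rightarrow> gamma_xy"
  where "dd_word a = foldr (\<lambda>i D. dd_x i \<circ> D) a id"

lemma dd_word_append: "dd_word (a @ b) = dd_word a \<circ> dd_word b"
  by (induction a) (simp_all add: dd_word_def comp_assoc)

lemma dd_word_simps: "dd_word [] = id" "dd_word (i # a) = dd_x i \<circ> dd_word a"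
  by (simp_all add: dd_word_def)

text \<open>The two sides of the braid relation for \<open>i < j\<close>, both without their last letter, which is \<open>i\<close>
  on the left and \<open>j\<close> on the right.\<close>

definition braid :: "nat \<Rightarrow> nat \<Rightarrow> nat list \<times> nat list"
  where "braid i j = (if j \<noteq> i + 1 then ([j], [i]) else if i = 0 then ([1, 0, 1], [0, 1, 0])
    else ([i, j], [j, i]))"

lemma braid_equivalent:
  assumes "i < j" "braid i j = (p, q)"
  shows "length p = length q" "word_prod (p @ [i]) = word_prod (q @ [j])"
    "dd_word (p @ [i]) = dd_word (q @ [j])"
proof -
  show "length p = length q"
    using assms(2) by (auto simp: braid_def split: if_splits)
  consider "i + 2 \<le> j" "p = [j]" "q = [i]" | "i = 0" "j = 1" "p = [1, 0, 1]" "q = [0, 1, 0]"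
    | "i \<ge> 1" "j = i + 1" "p = [i, j]" "q = [j, i]"
    using assms by (auto simp: braid_def split: if_splits)
  then have "word_prod (p @ [i]) = word_prod (q @ [j]) \<and> dd_word (p @ [i]) = dd_word (q @ [j])"
  proof cases
    case 1
    have "sgen j (sgen i a) = sgen i (sgen j a)" for a
      using 1(1) by (cases "i = 0") (auto simp: sgen_0_apply sgen_apply)
    then show ?thesis
      using 1 dd_x_commute[OF 1(1)] by (simp add: word_prod_def dd_word_simps fun_eq_iff)
  next
    case 2
    have "sgen 1 (sgen 0 (sgen 1 (sgen 0 a))) = sgen 0 (sgen 1 (sgen 0 (sgen 1 a)))" for a
    proof -
      consider "a = 1" | "a = 2" | "a = - 1" | "a = - 2" | "a \<notin> {1, 2, - 1, - 2}" by blast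
      then show ?thesis by cases (simp_all add: sgen_0_apply sgen_apply)
    qed
    then show ?thesis
      using 2 dd_x_braid4 by (simp add: word_prod_def dd_word_simps fun_eq_iff)
  next
    case 3
    have "sgen i (sgen j (sgen i a)) = sgen j (sgen i (sgen j a))" for a
    proof -
      let ?m = "int i"
      consider "a = ?m" | "a = ?m + 1" | "a = ?m + 2" | "a = - ?m" | "a = - ?m - 1" | "a = - ?m - 2"
        | "a \<notin> {?m, ?m + 1, ?m + 2, - ?m, - ?m - 1, - ?m - 2}" by blast
      then show ?thesis using 3(1,2) by cases (simp_all add: sgen_apply)
    qed
    then show ?thesis
      using 3 dd_x_braid3[OF 3(1)] by (simp add: word_prod_def dd_word_simps fun_eq_iff)
  qed
  then show "word_prod (p @ [i]) = word_prod (q @ [j])"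
    "dd_word (p @ [i]) = dd_word (q @ [j])" by auto
qed

text \<open>If \<open>i\<close> and \<open>j\<close> are descents, the values of \<open>w\<close> involved in the braid relation are in
  reversed order, so that all letters of the left side can be split off one after the other.\<close>

lemma ex_braid_factorization:
  assumes w: "w \<in> signed_perms_inf" and ij: "i < j" "descent w i" "descent w j"
    and pq: "braid i j = (p, q)"
  shows "\<exists>c. reduced_word w (c @ p @ [i])"
proof -
  note inf = comp_sgen_inf
  obtain k where k: "w \<in> signed_perms k" using w by (auto simp: signed_perms_inf_def)
  have minus: "w (- a) = - w a" for a using signed_perms_minus[OF k] .
  consider "i + 2 \<le> j" "p = [j]" | "i = 0" "j = 1" "p = [1, 0, 1]"
    | "i \<ge> 1" "j = i + 1" "p = [i, j]"
    using ij pq by (auto simp: braid_def split: if_splits)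
  then show ?thesis
  proof cases
    case 1
    have "descent (w \<circ> sgen i) j"
      using 1 ij by (cases "i = 0") (auto simp: descent_def sgen_0_apply sgen_apply)
    moreover obtain c where "reduced_word (w \<circ> sgen i \<circ> sgen j) c"
      using ex_reduced_word inf w by metis
    ultimately have "reduced_word w ((c @ [j]) @ [i])"
      using ij w by (simp only: reduced_word_snoc inf simp_thms)
    then show ?thesis using 1 by auto
  next
    case 2
    have "w 1 < 0" "w 2 < w 1" using ij 2 by (simp_all add: descent_def)
    then have "descent (w \<circ> sgen 0) 1" "descent (w \<circ> sgen 0 \<circ> sgen 1) 0"
      "descent (w \<circ> sgen 0 \<circ> sgen 1 \<circ> sgen 0) 1"
      by (simp_all add: descent_def sgen_0_apply sgen_apply minus)
    moreover obtain c where "reduced_word (w \<circ> sgen 0 \<circ> sgen 1 \<circ> sgen 0 \<circ> sgen 1) c"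
      using ex_reduced_word inf w by metis
    ultimately have "reduced_word w ((((c @ [1]) @ [0]) @ [1]) @ [0])"
      using ij 2 w by (simp only: reduced_word_snoc inf simp_thms)
    then show ?thesis using 2 by auto
  next
    case 3
    have "w (int i) > w (int i + 1)" "w (int i + 1) > w (int i + 2)"
      using ij 3 by (simp_all add: descent_def add_ac)
    then have "descent (w \<circ> sgen i) j" "descent (w \<circ> sgen i \<circ> sgen j) i"
      using 3 by (simp_all add: descent_def sgen_apply add_ac)
    moreover obtain c where "reduced_word (w \<circ> sgen i \<circ> sgen j \<circ> sgen i) c"
      using ex_reduced_word inf w by metis
    ultimately have "reduced_word w (((c @ [i]) @ [j]) @ [i])"
      using ij w by (simp only: reduced_word_snoc inf simp_thms)
    then show ?thesis using 3 by auto
  qed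
qed

text \<open>
  Matsumoto's theorem for divided differences, by induction on the length. Words with the same last
  letter are compared by the induction hypothesis. If the last letters are \<open>i < j\<close>, then both are
  descents, and \<open>w\<close> has reduced words ending in the left and in the right side of the braid relation;
  the given words agree with these by the first case.
\<close>

theorem dd_word_reduced_unique:
  assumes "w \<in> signed_perms_inf" "reduced_word w a" "reduced_word w b"
  shows "dd_word a = dd_word b"
  using assms
proof (induction "len w" arbitrary: w a b rule: less_induct)
  case less
  note w = less.prems(1)
  have len: "length a = len w" "length b = len w"
    using less.prems by (simp_all add: reduced_word_def)
  have step: "dd_word a = dd_word b" if "reduced_word w (a @ [i])" "reduced_word w (b @ [i])" for a b i
  proof (rule less.hyps)
    show "len (w \<circ> sgen i) < len w"
      using that len_descent[OF w, of i] by (simp add: reduced_word_snoc[OF w])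
  qed (use that w in \<open>simp_all only: reduced_word_snoc comp_sgen_inf\<close>)
  have exchange: "dd_word (a @ [i]) = dd_word (b @ [j])"
    if red: "reduced_word w (a @ [i])" "reduced_word w (b @ [j])" and "i < j" for a b i j
  proof -
    obtain p q where pq: "braid i j = (p, q)" by (cases "braid i j")
    note eq = braid_equivalent[OF \<open>i < j\<close> pq]
    obtain c where c: "reduced_word w ((c @ p) @ [i])"
      using ex_braid_factorization[OF w \<open>i < j\<close> _ _ pq] red reduced_word_snoc[OF w] by auto
    have "word_prod ((c @ q) @ [j]) = word_prod ((c @ p) @ [i])"
      using eq(2) by (simp add: word_prod_append)
    then have d: "reduced_word w ((c @ q) @ [j])"
      using c eq(1) by (simp add: reduced_word_def)
    have "dd_word (a @ [i]) = dd_word c \<circ> dd_word (p @ [i])"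
      using step[OF red(1) c] by (simp add: dd_word_append comp_assoc)
    also have "\<dots> = dd_word (b @ [j])"
      unfolding eq(3) using step[OF red(2) d] by (simp add: dd_word_append comp_assoc)
    finally show ?thesis .
  qed
  show ?case
  proof (cases "len w = 0")
    case True
    then show ?thesis using len by simp
  next
    case False
    then obtain a' i b' j where ab: "a = a' @ [i]" "b = b' @ [j]"
      using len by (metis length_0_conv rev_exhaust)
    note red = less.prems(2)[unfolded ab] less.prems(3)[unfolded ab]
    consider "i = j" | "i < j" | "j < i" by linarith
    then show ?thesis
    proof cases
      case 1
      then show ?thesis
        using step[of a' i b'] red unfolding ab dd_word_append by simp
    next
      case 2
      then show ?thesis unfolding ab using exchange red by blast
    next
      case 3
      then show ?thesis unfolding ab using exchange[OF red(2,1)] by simp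
    qed
  qed
qed

lemma dd_eq_dd_word:
  assumes "w \<in> signed_perms_inf" "reduced_word w a"
  shows "dd w = dd_word a"
proof -
  have "reduced_word w (SOME a. reduced_word w a)"
    using assms(2) by (rule someI)
  then show ?thesis
    unfolding dd_def dd_word_def[symmetric] using dd_word_reduced_unique assms by blast
qed

section \<open>The longest element\<close>

lemma w0_signed_perms: "w0 n \<in> signed_perms n"
proof -
  have "bij (w0 n)"
    by (rule o_bij[of "w0 n"]) (auto simp: w0_def fun_eq_iff)
  then show ?thesis by (auto simp: signed_perms_def w0_def)
qed

lemma w0_w0: "w0 n \<circ> w0 n = id"
  by (auto simp: w0_def fun_eq_iff)

definition index_pairs :: "nat \<Rightarrow> (int \<times> int) set"
  where "index_pairs n = {(a, b). a \<in> {- int n..int n} - {0} \<and> b \<in> {- int n..int n} - {0} \<and> a < b}"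

lemma finite_index_pairs: "finite (index_pairs n)"
  by (rule finite_subset[of _ "{- int n..int n} \<times> {- int n..int n}"]) (auto simp: index_pairs_def)

lemma card_index_pairs: "card (index_pairs n) + n = 2 * n\<^sup>2"
proof -
  define A where "A = {- int n..int n} - {0}"
  have A: "finite A" "card A = 2 * n" by (simp_all add: A_def)
  have swap: "card (prod.swap ` index_pairs n) = card (index_pairs n)"
    by (rule card_image) simp
  have diag: "card ((\<lambda>a. (a, a)) ` A) = 2 * n"
    using A(2) by (subst card_image) (auto simp: inj_on_def)
  have "A \<times> A = index_pairs n \<union> (prod.swap ` index_pairs n \<union> (\<lambda>a. (a, a)) ` A)"
    by (auto simp: A_def index_pairs_def image_iff)
  moreover have "card (index_pairs n \<union> (prod.swap ` index_pairs n \<union> (\<lambda>a. (a, a)) ` A)) =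
      card (index_pairs n) + (card (prod.swap ` index_pairs n) + card ((\<lambda>a. (a, a)) ` A))"
    using A finite_index_pairs
    by (subst card_Un_disjoint; (subst card_Un_disjoint)?) (auto simp: index_pairs_def)
  ultimately have "(2 * n) * (2 * n) = 2 * card (index_pairs n) + 2 * n"
    using A swap diag card_cartesian_product[of A A] by simp
  then show ?thesis by (simp add: power2_eq_square)
qed

text \<open>Composing with \<open>w\<^sub>0\<close> reverses the order of the values on \<open>{-n..n}\<close>, so the inversions of
  \<open>w\<^sub>0 u\<close> are exactly the pairs that \<open>u\<close> does not invert.\<close>

lemma len_w0_comp:
  assumes u: "u \<in> signed_perms n"
  shows "len (w0 n \<circ> u) + len u = n\<^sup>2"
proof -
  have bound: "\<bar>u a\<bar> \<le> int n" if "\<bar>a\<bar> \<le> int n" for a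
    using signed_perms_bound[OF u that] .
  have sub: "inv_pairs u \<subseteq> index_pairs n"
    using inv_pairs_bound[OF u] by (auto simp: inv_pairs_def index_pairs_def)
  have sub_sign: "sign_changes u \<subseteq> {1..int n}" by (rule sign_changes_bound[OF u])
  note wu = signed_perms_comp[OF w0_signed_perms u]
  have nz: "u a \<noteq> 0" if "a \<noteq> 0" for a
    using that signed_perms_inj[OF u, of a 0] signed_perms_zero[OF u] by simp
  have w0u: "(w0 n \<circ> u) a = - u a" if "\<bar>a\<bar> \<le> int n" for a
    using bound[OF that] by (simp add: w0_def)
  have "inv_pairs (w0 n \<circ> u) \<subseteq> index_pairs n"
    using inv_pairs_bound[OF wu] by (auto simp: inv_pairs_def index_pairs_def)
  moreover have "(a, b) \<in> inv_pairs (w0 n \<circ> u) \<longleftrightarrow> (a, b) \<notin> inv_pairs u"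
    if "(a, b) \<in> index_pairs n" for a b
  proof -
    have "\<bar>a\<bar> \<le> int n" "\<bar>b\<bar> \<le> int n" "a < b" using that by (auto simp: index_pairs_def)
    moreover have "u a \<noteq> u b" using \<open>a < b\<close> signed_perms_inj[OF u] by simp
    ultimately show ?thesis
      using that w0u[of a] w0u[of b] by (auto simp: inv_pairs_def index_pairs_def)
  qed
  ultimately have "inv_pairs (w0 n \<circ> u) = index_pairs n - inv_pairs u" by auto
  then have pairs: "card (inv_pairs (w0 n \<circ> u)) + card (inv_pairs u) = card (index_pairs n)"
    using sub finite_index_pairs[of n] card_mono[OF finite_index_pairs sub]
    by (simp add: card_Diff_subset finite_subset)
  have "a \<in> sign_changes (w0 n \<circ> u) \<longleftrightarrow> a \<in> {1..int n} - sign_changes u" for a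
  proof (cases "\<bar>a\<bar> \<le> int n")
    case True
    then show ?thesis using w0u[OF True] nz[of a] by (auto simp: sign_changes_def)
  next
    case False
    then show ?thesis using sign_changes_bound[OF wu] by auto
  qed
  then have "sign_changes (w0 n \<circ> u) = {1..int n} - sign_changes u" by blast
  then have "card (sign_changes (w0 n \<circ> u)) + card (sign_changes u) = n"
    using sub_sign card_mono[OF _ sub_sign] by (simp add: card_Diff_subset finite_subset)
  then have "double_length (w0 n \<circ> u) + double_length u = 2 * n\<^sup>2"
    using pairs card_index_pairs[of n] by (simp add: double_length_def)
  then show ?thesis
    using double_len[OF signed_perms_imp_inf[OF u]] double_len[OF signed_perms_imp_inf[OF wu]]
    by simp
qed

lemma len_w0: "len (w0 n) = n\<^sup>2"
  using len_w0_comp[OF id_signed_perms, of n] len_zero_iff[of id] id_signed_perms[of 0]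
    signed_perms_imp_inf by fastforce

lemma descent_less:
  assumes "w \<in> signed_perms n" "descent w i"
  shows "i < n"
proof (rule ccontr)
  assume "\<not> i < n"
  then have "w (int i + 1) = int i + 1"
    using signed_perms_fix[OF assms(1)] by simp
  moreover have "w (int i) \<le> int i"
    using \<open>\<not> i < n\<close> signed_perms_fix[OF assms(1), of "int i"]
      signed_perms_bound[OF assms(1), of "int i"]
    by (cases "i = n") auto
  ultimately show False using assms(2) by (auto simp: descent_def split: if_splits)
qed

text \<open>A descent of \<open>w\<^sub>0 u\<close> is an ascent of \<open>u\<close>, and only the identity has no descents.\<close>

lemma ex_ascent:
  assumes "u \<in> signed_perms n" "u \<noteq> w0 n"
  shows "\<exists>i<n. \<not> descent u i"
proof -
  let ?v = "w0 n \<circ> u"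
  have v: "?v \<in> signed_perms n" by (intro signed_perms_comp w0_signed_perms assms)
  have "?v \<noteq> id"
    using assms(2) w0_w0 by (metis comp_assoc comp_id id_comp)
  then obtain i where i: "descent ?v i"
    using no_descent_id signed_perms_imp_inf[OF v] by blast
  have "i < n" by (rule descent_less[OF v i])
  moreover have "\<not> descent u i"
  proof -
    have us: "u \<circ> sgen i \<in> signed_perms n"
      using sgen_signed_perms[OF \<open>i < n\<close>] signed_perms_comp assms(1) by blast
    have "len ?v = Suc (len (?v \<circ> sgen i))"
      using len_descent[OF signed_perms_imp_inf[OF v] i] .
    then have "len (u \<circ> sgen i) > len u"
      using len_w0_comp[OF assms(1)] len_w0_comp[OF us] by (simp add: comp_assoc)
    then show ?thesis
      using len_less_iff_descent[OF signed_perms_imp_inf[OF assms(1)], of i] by simp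
  qed
  ultimately show ?thesis by blast
qed

section \<open>Invariants are constant\<close>

text \<open>Besides all \<open>y\<^sub>j\<close>, the \<open>x\<^sub>j\<close> with \<open>P j\<close> are set to 0.\<close>

definition drop_x :: "(nat \<Rightarrow> bool) \<Rightarrow> gamma_xy \<Rightarrow> gamma_xy"
  where "drop_x P = gamma_xy_hom cgen (\<lambda>j. if P j then 0 else xvar j) (\<lambda>j. 0)"

lemma ring_hom_drop_x: "ring_hom (drop_x P)"
  unfolding drop_x_def by (intro ring_hom_gamma_xy_hom) (simp add: cgen_upd_0 gamma_point_cgen)

lemma drop_x_c: "drop_x P (cgen p) = cgen p"
  by (cases "p = 0") (simp_all add: cgen_0 ring_hom_one[OF ring_hom_drop_x],
      simp add: drop_x_def gamma_xy_hom_c cgen_upd_0 gamma_point_cgen)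

lemma drop_x_x: "j \<ge> 1 \<Longrightarrow> drop_x P (xvar j) = (if P j then 0 else xvar j)"
  and drop_x_y: "j \<ge> 1 \<Longrightarrow> drop_x P (yvar j) = 0"
  by (simp_all add: drop_x_def gamma_xy_hom_x gamma_xy_hom_y cgen_upd_0 gamma_point_cgen)

lemmas drop_x_gen = drop_x_c drop_x_x drop_x_y

lemma drop_x_drop_x: "drop_x P (drop_x Q f) = drop_x (\<lambda>j. P j \<or> Q j) f"
  by (rule gamma_xy_hom_eqI[OF ring_hom_comp[OF ring_hom_drop_x ring_hom_drop_x] ring_hom_drop_x])
    (simp_all add: drop_x_gen ring_hom_zero[OF ring_hom_drop_x])

lemma drop_x_s_act:
  assumes "k \<ge> 1"
  shows "drop_x (\<lambda>j. j = k) (s_act k f) = s_act k (drop_x (\<lambda>j. j = k + 1) f)"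
proof (rule gamma_xy_hom_eqI[OF ring_hom_comp[OF ring_hom_drop_x ring_hom_s_act]
      ring_hom_comp[OF ring_hom_s_act ring_hom_drop_x]])
  fix j :: nat assume j: "j \<ge> 1"
  show "drop_x (\<lambda>j. j = k) (s_act k (xvar j)) = s_act k (drop_x (\<lambda>j. j = k + 1) (xvar j))"
    using j assms by (auto simp: s_act_x drop_x_x s_act_simps transpose_def)
qed (use assms in \<open>simp_all add: drop_x_gen s_act_gen s_act_simps\<close>)

lemma drop_x_large: "\<exists>N. \<forall>k\<ge>N. drop_x (\<lambda>j. j \<ge> k) (set_Y_zero f) = set_Y_zero f"
proof (induction f rule: gamma_xy_induct)
  case (x j)
  then show ?case by (intro exI[of _ "Suc j"]) (auto simp: set_Y_zero_x drop_x_x)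
next
  case (add f g)
  then obtain M N where "\<forall>k\<ge>M. drop_x (\<lambda>j. j \<ge> k) (set_Y_zero f) = set_Y_zero f"
    "\<forall>k\<ge>N. drop_x (\<lambda>j. j \<ge> k) (set_Y_zero g) = set_Y_zero g" by blast
  then show ?case
    by (intro exI[of _ "max M N"]) (simp add: ring_hom_add[OF ring_hom_set_Y_zero]
        ring_hom_add[OF ring_hom_drop_x])
next
  case (mult f g)
  then obtain M N where "\<forall>k\<ge>M. drop_x (\<lambda>j. j \<ge> k) (set_Y_zero f) = set_Y_zero f"
    "\<forall>k\<ge>N. drop_x (\<lambda>j. j \<ge> k) (set_Y_zero g) = set_Y_zero g" by blast
  then show ?case
    by (intro exI[of _ "max M N"]) (simp add: ring_hom_mult[OF ring_hom_set_Y_zero]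
        ring_hom_mult[OF ring_hom_drop_x])
qed (simp_all add: ring_hom_of_int[OF ring_hom_set_Y_zero] ring_hom_of_int[OF ring_hom_drop_x]
    set_Y_zero_c set_Y_zero_y drop_x_c ring_hom_zero[OF ring_hom_drop_x])

text \<open>
  If \<open>f\<close> involves no \<open>x\<^sub>j\<close> with \<open>j > k\<close>, then \<open>s\<^sub>k f\<close> does not involve \<open>x\<^sub>k\<close>, and \<open>s\<^sub>k f = f\<close>. Starting
  from an index beyond all variables of \<open>f\<close>, this removes the variables one at a time.
\<close>

lemma symmetric_no_x:
  assumes inv: "\<And>i. i \<ge> 1 \<Longrightarrow> s_act i f = f" and f: "set_Y_zero f = f"
  shows "drop_x (\<lambda>j. j \<ge> 1) f = f"
proof -
  obtain N where N: "drop_x (\<lambda>j. j \<ge> Suc N) f = f"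
    using drop_x_large[of f] f by (metis le_Suc_eq order_refl)
  have step: "drop_x (\<lambda>j. j \<ge> k) f = f" if k: "k \<ge> 1" and f': "drop_x (\<lambda>j. j \<ge> Suc k) f = f" for k
  proof -
    have eq: "(\<lambda>j. j = Suc k \<or> j \<ge> Suc k) = (\<lambda>j. j \<ge> Suc k)" "(\<lambda>j. j \<ge> Suc k \<or> j = k) = (\<lambda>j. j \<ge> k)"
      by auto
    have "drop_x (\<lambda>j. j = Suc k) f = f"
      using drop_x_drop_x[of "\<lambda>j. j = Suc k" "\<lambda>j. j \<ge> Suc k" f] unfolding eq f' .
    then have "drop_x (\<lambda>j. j = k) f = f"
      using drop_x_s_act[OF k, of f] inv[OF k] by simp
    then show ?thesis
      using drop_x_drop_x[of "\<lambda>j. j \<ge> Suc k" "\<lambda>j. j = k" f] unfolding eq using f' by simp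
  qed
  have "drop_x (\<lambda>j. j \<ge> Suc N - m) f = f" if "m \<le> N" for m
    using that
  proof (induction m)
    case (Suc m)
    then have "Suc (Suc N - Suc m) = Suc N - m" by simp
    then show ?case using step[of "Suc N - Suc m"] Suc by simp
  qed (simp add: N)
  from this[of N] show ?thesis by simp
qed

lemma drop_x_all: "\<exists>g. drop_x (\<lambda>j. j \<ge> 1) f = Const g"
proof (induction f rule: gamma_xy_induct)
  case (int k)
  then show ?case
    by (metis ring_hom_of_int[OF ring_hom_drop_x] ring_hom_of_int[OF ring_hom_Const])
next
  case (c p)
  show ?case unfolding drop_x_c unfolding cgen_def by blast
next
  case (x j)
  then show ?case by (metis drop_x_x ring_hom_zero[OF ring_hom_Const])
next
  case (y j)
  then show ?case by (metis drop_x_y ring_hom_zero[OF ring_hom_Const])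
next
  case (add f g)
  then show ?case
    by (metis ring_hom_add[OF ring_hom_drop_x] ring_hom_add[OF ring_hom_Const])
next
  case (mult f g)
  then show ?case
    by (metis ring_hom_mult[OF ring_hom_drop_x] ring_hom_mult[OF ring_hom_Const])
qed

text \<open>
  By symmetry \<open>f\<close> lies in \<open>\<Gamma>\<close>. Evaluating \<open>s\<^sub>0 f = f\<close> at a complex point \<open>c\<close> with \<open>x\<^sub>1 = x\<close>
  gives the value at the twisted point on the left and the value at \<open>c\<close> on the right.
\<close>

theorem invariant_constant:
  assumes inv: "\<And>i. s_act i f = f" and f: "set_Y_zero f = f"
  shows "f = of_int (constant_term f)"
proof -
  obtain g where g: "f = Const g"
    using drop_x_all[of f] symmetric_no_x[OF inv f] by auto
  have "gamma_hom (twist x c) g = gamma_hom c g" if c: "gamma_point c" for c :: "nat \<Rightarrow> complex" and x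
  proof -
    define ev where "ev = gamma_xy_hom c (\<lambda>j. x) (\<lambda>j. 0)"
    have c0: "c 0 = 1" using c by (simp add: gamma_point_def)
    then have "c(0 := 1) = c" by (simp add: fun_upd_idem)
    then have pt: "gamma_point (c(0 := 1))" using c by simp
    have hom: "ring_hom ev" unfolding ev_def by (rule ring_hom_gamma_xy_hom[OF pt])
    have ev_c: "ev (cgen p) = c p" for p
      by (cases "p = 0") (simp_all add: cgen_0 c0 ring_hom_one[OF hom],
          simp add: ev_def gamma_xy_hom_c[OF pt])
    have ev_x: "ev (xvar 1) = x"
      by (simp only: ev_def gamma_xy_hom_x[OF pt] order_refl)
    note homs = ring_hom_comp[OF hom ring_hom_Const] ring_hom_comp[OF hom ring_hom_comp[OF ring_hom_s_act ring_hom_Const]]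
    have "ev (Const g) = gamma_hom c g"
      by (induction g rule: gamma_induct)
        (simp_all add: ring_hom_of_int[OF homs(1)] ring_hom_add[OF homs(1)] ring_hom_mult[OF homs(1)]
          ring_hom_of_int ring_hom_add ring_hom_mult ring_hom_gamma_hom[OF c] gamma_hom_gen[OF c]
          ev_c flip: cgen_def)
    moreover have "ev (s_act 0 (Const g)) = gamma_hom (twist x c) g"
    proof -
      note ct = gamma_point_twist[OF c, of x]
      have "ev (s_act 0 (cgen p)) = twist x c p" for p
        by (simp add: s_act_0_c ring_hom_twist[OF hom] ev_c ev_x[simplified])
      then show ?thesis
        by (induction g rule: gamma_induct)
          (simp_all add: ring_hom_of_int[OF homs(2)] ring_hom_add[OF homs(2)] ring_hom_mult[OF homs(2)]
            ring_hom_of_int ring_hom_add ring_hom_mult ring_hom_gamma_hom[OF ct] gamma_hom_gen[OF ct]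
            flip: cgen_def)
    qed
    ultimately show ?thesis using inv[of 0] by (simp add: g)
  qed
  then obtain k where "g = of_int k"
    using twist_invariant_constant by blast
  then have "f = of_int k"
    by (simp add: g ring_hom_of_int[OF ring_hom_Const])
  then show ?thesis
    by (simp add: ring_hom_of_int[OF ring_hom_constant_term])
qed

section \<open>The pairing of Schubert polynomials\<close>

locale schubert_family =
  fixes \<CC> :: "sperm \<Rightarrow> gamma_xy"
  assumes family: "is_schubert_family \<CC>"
begin

definition schub :: "sperm \<Rightarrow> gamma_xy"
  where "schub w = set_Y_zero (\<CC> w)"

lemma dd_x_schub:
  assumes "w \<in> signed_perms_inf"
  shows "dd_x i (schub w) = (if descent w i then schub (w \<circ> sgen i) else 0)"
proof -
  have "dd_x i (\<CC> w) = (if descent w i then \<CC> (w \<circ> sgen i) else 0)"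
    using family assms unfolding is_schubert_family_def by (simp add: len_less_iff_descent)
  then show ?thesis
    unfolding schub_def set_Y_zero_dd_x[symmetric]
    by (simp add: ring_hom_zero[OF ring_hom_set_Y_zero])
qed

lemma id_no_descent: "\<not> descent id i"
  by (simp add: descent_def)

text \<open>No generator shortens the identity, so every \<open>\<partial>\<^sub>i\<close> annihilates \<open>schub id\<close>, which is therefore
  invariant; the constant term fixes its value.\<close>

lemma schub_id: "schub id = 1"
proof -
  have id: "id \<in> signed_perms_inf"
    by (rule signed_perms_imp_inf[OF id_signed_perms])
  have "s_act i (schub id) = schub id" for i
    using dd_x_schub[OF id, of i] id_no_descent by (simp only: dd_x_eq_zero_iff if_False)
  moreover have "set_Y_zero (schub id) = schub id"
    unfolding schub_def set_Y_zero_def[symmetric]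
    by (rule gamma_xy_hom_eqI[OF ring_hom_comp[OF ring_hom_set_Y_zero ring_hom_set_Y_zero]
        ring_hom_set_Y_zero])
      (simp_all add: set_Y_zero_c set_Y_zero_x set_Y_zero_y ring_hom_zero[OF ring_hom_set_Y_zero])
  moreover have "constant_term (schub id) = 1"
    using family id unfolding is_schubert_family_def schub_def constant_term_set_Y_zero by simp
  ultimately show ?thesis
    using invariant_constant[of "schub id"] by simp
qed

lemma dd_word_schub:
  assumes "w \<in> signed_perms_inf" "reduced_word w a"
  shows "dd_word a (schub w) = 1"
  using assms
proof (induction a arbitrary: w rule: rev_induct)
  case Nil
  then have w: "w = id" by (simp add: reduced_word_def word_prod_Nil)
  show ?case unfolding w dd_word_simps schub_id by simp
next
  case (snoc i a)
  then have i: "descent w i" and a: "reduced_word (w \<circ> sgen i) a"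
    by (simp_all only: reduced_word_snoc)
  have "dd_word a (schub (w \<circ> sgen i)) = 1"
    by (rule snoc.IH[OF comp_sgen_inf[OF snoc.prems(1)] a])
  then show ?case
    using dd_x_schub[OF snoc.prems(1), of i] i
    by (simp only: dd_word_append dd_word_simps o_apply id_apply if_True)
qed

text \<open>All \<open>i < n\<close> are descents of \<open>w\<^sub>0\<close>, so there is a reduced word of \<open>w\<^sub>0\<close> that ends in \<open>i\<close>.\<close>

lemma pairing_adjoint:
  assumes "i < n"
  shows "pairing n (dd_x i f) g = pairing n f (dd_x i g)"
proof -
  have w0: "w0 n \<in> signed_perms_inf" by (rule signed_perms_imp_inf[OF w0_signed_perms])
  have "w0 n \<circ> sgen i \<in> signed_perms n"
    by (intro signed_perms_comp w0_signed_perms sgen_signed_perms assms)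
  have "descent (w0 n) i"
    using assms by (auto simp: descent_def w0_def)
  then obtain a where a: "reduced_word (w0 n) (a @ [i])"
    using ex_reduced_word[OF comp_sgen_inf[OF w0]] reduced_word_snoc[OF w0] by blast
  show ?thesis
    unfolding pairing_def dd_eq_dd_word[OF w0 a] dd_word_append
    by (simp add: dd_word_simps dd_x_adjoint)
qed

lemma dd_word_zero: "dd_word a 0 = 0"
  by (induction a) (simp_all add: dd_word_simps dd_x_zero)

text \<open>
  Induction on the length of \<open>v\<close>. An ascent \<open>i < n\<close> of \<open>u\<close> gives \<open>schub u = \<partial>\<^sub>i (schub (u s\<^sub>i))\<close>,
  and \<open>\<partial>\<^sub>i\<close> is moved to the other factor. If \<open>i\<close> is a descent of \<open>v\<close>, the pair \<open>(u s\<^sub>i, v s\<^sub>i)\<close> has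
  the same total length and satisfies the condition on the right iff \<open>(u, v)\<close> does. Otherwise
  the pairing is 0, and \<open>v \<noteq> w\<^sub>0 u\<close> because \<open>i\<close> is a descent of \<open>w\<^sub>0 u\<close>.
\<close>

theorem pairing_schub:
  assumes "u \<in> signed_perms n" "v \<in> signed_perms n" "len u + len v = n\<^sup>2"
  shows "pairing n (schub u) (schub v) = (if v = w0 n \<circ> u then 1 else 0)"
  using assms
proof (induction "len v" arbitrary: u v)
  case 0
  have v: "v = id"
    using 0 len_zero_iff[OF signed_perms_imp_inf[OF 0(3)]] by simp
  have u: "u = w0 n"
  proof -
    have "len (w0 n \<circ> u) = 0"
      using 0 len_w0_comp[of u n] by simp
    then have "w0 n \<circ> u = id"
      using len_zero_iff signed_perms_imp_inf[OF signed_perms_comp[OF w0_signed_perms 0(2)]] by blast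
    then show ?thesis
      by (metis w0_w0 comp_assoc comp_id id_comp)
  qed
  have w0: "w0 n \<in> signed_perms_inf" by (rule signed_perms_imp_inf[OF w0_signed_perms])
  obtain a where a: "reduced_word (w0 n) a" using ex_reduced_word[OF w0] by blast
  show ?case
    unfolding u v schub_id pairing_def mult_1_right dd_eq_dd_word[OF w0 a] dd_word_schub[OF w0 a] w0_w0
    by simp
next
  case (Suc m)
  note u = Suc.prems(1) and v = Suc.prems(2)
  note uinf = signed_perms_imp_inf[OF u] and vinf = signed_perms_imp_inf[OF v]
  have "u \<noteq> w0 n"
    using Suc.prems(3) Suc.hyps(2) len_w0[of n] by auto
  then obtain i where i: "i < n" "\<not> descent u i"
    using ex_ascent[OF u] by blast
  define u' where "u' = u \<circ> sgen i"
  have u': "u' \<in> signed_perms n"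
    unfolding u'_def by (intro signed_perms_comp u sgen_signed_perms i)
  have u's: "u' \<circ> sgen i = u" by (simp only: u'_def comp_sgen_sgen)
  have len_u': "len u' = Suc (len u)"
    unfolding u'_def using len_ascent[OF uinf i(2)] .
  have desc_u': "descent u' i"
    unfolding u'_def using descent_comp_sgen[OF uinf] i(2) by blast
  have "pairing n (schub u) (schub v) = pairing n (dd_x i (schub u')) (schub v)"
    using dd_x_schub[OF signed_perms_imp_inf[OF u'], of i] desc_u' u's by simp
  also have "\<dots> = pairing n (schub u') (dd_x i (schub v))"
    by (rule pairing_adjoint[OF i(1)])
  finally have eq: "pairing n (schub u) (schub v) = pairing n (schub u') (dd_x i (schub v))" .
  show ?case
  proof (cases "descent v i")
    case True
    define v' where "v' = v \<circ> sgen i"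
    have v': "v' \<in> signed_perms n"
      unfolding v'_def by (intro signed_perms_comp v sgen_signed_perms i)
    have "len v = Suc (len v')"
      unfolding v'_def using len_descent[OF vinf True] .
    then have "pairing n (schub u') (schub v') = (if v' = w0 n \<circ> u' then 1 else 0)"
      using Suc.hyps(1)[OF _ u' v'] Suc.hyps(2) Suc.prems(3) len_u' by simp
    moreover have "v' = w0 n \<circ> u' \<longleftrightarrow> v = w0 n \<circ> u"
      unfolding v'_def u'_def by (metis comp_assoc comp_sgen_sgen)
    ultimately show ?thesis
      using eq dd_x_schub[OF vinf, of i] True by (simp add: v'_def)
  next
    case False
    have "v \<noteq> w0 n \<circ> u"
    proof
      assume v_eq: "v = w0 n \<circ> u"
      have "len (v \<circ> sgen i) = len (w0 n \<circ> u')"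
        by (simp only: v_eq u'_def comp_assoc)
      then show False
        using len_ascent[OF vinf False] len_w0_comp[OF u] len_w0_comp[OF u'] len_u' v_eq by simp
    qed
    moreover have "pairing n (schub u) (schub v) = 0"
    proof -
      have w0: "w0 n \<in> signed_perms_inf" by (rule signed_perms_imp_inf[OF w0_signed_perms])
      obtain a where a: "reduced_word (w0 n) a" using ex_reduced_word[OF w0] by blast
      show ?thesis
        unfolding eq using dd_x_schub[OF vinf, of i] False
        by (simp add: pairing_def dd_eq_dd_word[OF w0 a] dd_word_zero)
    qed
    ultimately show ?thesis by simp
  qed
qed

end

theorem proposition9:
  fixes \<CC> :: "sperm \<Rightarrow> gamma_xy" and n :: nat and u v :: sperm
  assumes "is_schubert_family \<CC>"
    and "n \<ge> 1"
    and "u \<in> signed_perms n" and "v \<in> signed_perms n"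
    and "len u + len v = n\<^sup>2"
  shows "pairing n (set_Y_zero (\<CC> u)) (set_Y_zero (\<CC> v)) = (if v = w0 n \<circ> u then 1 else 0)"
proof -
  interpret schubert_family \<CC>
    by unfold_locales (rule assms(1))
  show ?thesis
    using pairing_schub[OF assms(3-5)] by (simp only: schub_def)
qed

end
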